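(* The Duistermaat index $\iota$ has the following properties. (1) (Special values) For any Lagrangian planes $\mathcal{L},\mathcal{M}$ in $\mathbb{C}^n\oplus\mathbb{C}^n$, $$\iota(\mathcal{L},\mathcal{L},\mathcal{M})=\iota(\mathcal{M},\mathcal{L},\mathcal{L})=0,\qquad \iota(\mathcal{L},\mathcal{M},\mathcal{L})=n-\dim(\mathcal{L}\cap\mathcal{M}).$$ (2) (Permuting the arguments) For any Lagrangian planes $\mathcal{L}_1,\mathcal{L}_2,\mathcal{L}_3$ in $\mathbb{C}^n\oplus\mathbb{C}^n$, $$\iota(\mathcal{L}_1,\mathcal{L}_2,\mathcal{L}_3)+\iota(\mathcal{L}_2,\mathcal{L}_1,\mathcal{L}_3)=n-\dim(\mathcal{L}_1\cap\mathcal{L}_2),$$ $$\iota(\mathcal{L}_1,\mathcal{L}_2,\mathcal{L}_3)+\iota(\mathcal{L}_1,\mathcal{L}_3,\mathcal{L}_2)=n-\dim(\mathcal{L}_2\cap\mathcal{L}_3),$$ $$\iota(\mathcal{L}_1,\mathcal{L}_2,\mathcal{L}_3)+\iota(\mathcal{L}_3,\mathcal{L}_2,\mathcal{L}_1)=n-\dim(\mathcal{L}_1\cap\mathcal{L}_2)-\dim(\mathcal{L}_2\cap\mathcal{L}_3)+\dim(\mathcal{L}_1\cap\mathcal{L}_3),$$ $$\iota(\mathcal{L}_1,\mathcal{L}_2,\mathcal{L}_3)-\dim(\mathcal{L}_1\cap\mathcal{L}_3)=\iota(\mathcal{L}_3,\mathcal{L}_1,\mathcal{L}_2)-\dim(\mathcal{L}_2\cap\mathcal{L}_3)=\iota(\mathcal{L}_2,\mathcal{L}_3,\mathcal{L}_1)-\dim(\mathcal{L}_1\cap\mathcal{L}_2).$$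 (3) (Symplectic additivity) For any three Lagrangian subspaces $\mathcal{L}_1,\mathcal{L}_2,\mathcal{L}_3$ of a symplectic space $V$ and any three Lagrangian subspaces $\mathcal{M}_1,\mathcal{M}_2,\mathcal{M}_3$ of a symplectic space $W$, $$\iota(\mathcal{L}_1\oplus\mathcal{M}_1,\mathcal{L}_2\oplus\mathcal{M}_2,\mathcal{L}_3\oplus\mathcal{M}_3)=\iota(\mathcal{L}_1,\mathcal{L}_2,\mathcal{L}_3)+\iota(\mathcal{M}_1,\mathcal{M}_2,\mathcal{M}_3),$$ where the left-hand side is computed in $V\oplus W$. (4) (Anti-symplectic transformation) If $\mathsf{A}$ is an anti-symplectic linear transformation on $(\mathbb{C}^n\oplus\mathbb{C}^n,\omega)$, i.e. a linear bijection with $\omega(\mathsf{A}u,\mathsf{A}v)=-\omega(u,v)$ for all $u,v$, then for any Lagrangian planes $\mathcal{L}_1,\mathcal{L}_2,\mathcal{L}_3$ in $\mathbb{C}^n\oplus\mathbb{C}^n$, $$\iota(\mathsf{A}\mathcal{L}_1,\mathsf{A}\mathcal{L}_2,\mathsf{A}\mathcal{L}_3)=\iota(\mathcal{L}_3,\mathcal{L}_2,\mathcal{L}_1).$$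
   Context: $\mathbb{C}^n\oplus\mathbb{C}^n$ is equipped with the canonical (sesquilinear) Hermitian symplectic form $\omega((x_1,x_2),(y_1,y_2)) := \langle x_1,y_2\rangle_{\mathbb{C}^n} - \langle x_2,y_1\rangle_{\mathbb{C}^n}$. A subspace $\mathcal{L}$ is Lagrangian if it equals $\{v : \omega(u,v)=0 \text{ for all } u\in\mathcal{L}\}$; $\Lambda(n)$ is the set of Lagrangian planes. For an $n\times n$ Hermitian matrix $M$, $\mathcal{G}_M := \{(x,Mx): x\in\mathbb{C}^n\}$, and $\mathcal{G}_\infty := 0\oplus\mathbb{C}^n$. $n_-$ is the number of negative eigenvalues counted with multiplicity. The Duistermaat index $\iota:\Lambda(n)^3\to\{0,\dots,n\}$ is the unique function such that (1) $\iota(\mathcal{G}_0,\mathcal{G}_A,\mathcal{G}_\infty)=n_-(A)$ for every Hermitian $A$; (2) $\iota$ is invariant under applying a linear symplectic transformation to all three arguments; (3) $\iota(\mathcal{L}_1,\mathcal{L}_2,\mathcal{L}_3)-\iota(\mathcal{L}_1,\mathcal{L}_2,\mathcal{L}_4)+\iota(\mathcal{L}_1,\mathcal{L}_3,\mathcal{L}_4)-\iota(\mathcal{L}_2,\mathcal{L}_3,\mathcal{L}_4)=0$ for all Lagrangian planes. Explicitly, $\iota(\mathcal{L}_1,\mathcal{L}_2,\mathcal{L}_3)=n_-(\Omega)-n+\dim(\mathcal{L}_1\cap\mathcal{L}_3)$, where $\Omega$ is the Hermitian form on $\mathcal{L}_1\oplus\mathcal{L}_2\oplus\mathcal{L}_3$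 given by $\Omega(u_1,u_2,u_3;v_1,v_2,v_3)=\omega(u_1,v_2)+\omega(u_2,v_3)+\omega(u_3,v_1)-\omega(u_2,v_1)-\omega(u_3,v_2)-\omega(u_1,v_3)$. In (3), a symplectic space is a finite-dimensional complex vector space with a form isomorphic to some $(\mathbb{C}^m\oplus\mathbb{C}^m,\omega)$; $\iota$ on it is defined by transport along any symplectic isomorphism (well defined by symplectic invariance), equivalently by the explicit formula with $n$ replaced by half the dimension of the space. $V\oplus W$ carries the direct sum $\omega_V\oplus\omega_W$ of the symplectic forms. *)

theory Defs
  imports Complex_Main "HOL-Library.Function_Algebras" "HOL-Library.Product_Plus"
begin

text \<open>A complex vector space (a linear subspace \<open>carr\<close> of an ambient type) carrying a form. The
  dimension \<open>n\<close> of the model spaces has to be a term rather than a type, because a symplectic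
  space is one isomorphic to the model of \<^emph>\<open>some\<close> dimension; so \<open>\<complex>\<^sup>n\<close> is the space of those
  functions on \<open>nat\<close> that vanish from \<open>n\<close> on.\<close>

record 'v form_space =
  scal :: "complex \<Rightarrow> 'v \<Rightarrow> 'v"
  carr :: "'v set"
  form :: "'v \<Rightarrow> 'v \<Rightarrow> complex"

type_synonym cvec = "nat \<Rightarrow> complex"

definition Cn :: "nat \<Rightarrow> cvec set" where
  "Cn n = {x. \<forall>i\<ge>n. x i = 0}"

definition vscale :: "complex \<Rightarrow> cvec \<Rightarrow> cvec" where
  "vscale c x = (\<lambda>i. c * x i)"

definition pscale :: "complex \<Rightarrow> cvec \<times> cvec \<Rightarrow> cvec \<times> cvec" where
  "pscale c v = (vscale c (fst v), vscale c (snd v))"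

definition hinner :: "nat \<Rightarrow> cvec \<Rightarrow> cvec \<Rightarrow> complex" where
  "hinner n x y = (\<Sum>i<n. x i * cnj (y i))"

definition omega :: "nat \<Rightarrow> cvec \<times> cvec \<Rightarrow> cvec \<times> cvec \<Rightarrow> complex" where
  "omega n u v = hinner n (fst u) (snd v) - hinner n (snd u) (fst v)"

definition Csymp :: "nat \<Rightarrow> (cvec \<times> cvec) form_space" where
  "Csymp n = \<lparr>scal = pscale, carr = Cn n \<times> Cn n, form = omega n\<rparr>"

definition lagrangian :: "'v::ab_group_add form_space \<Rightarrow> 'v set \<Rightarrow> bool" where
  "lagrangian V L \<longleftrightarrow>
     module.subspace (scal V) L \<and> L = {v \<in> carr V. \<forall>u\<in>L. form V u v = 0}"

definition Lagr :: "nat \<Rightarrow> (cvec \<times> cvec) set set" where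
  "Lagr n = {L. lagrangian (Csymp n) L}"

definition linear_bij ::
  "'v::ab_group_add form_space \<Rightarrow> 'w::ab_group_add form_space \<Rightarrow> ('v \<Rightarrow> 'w) \<Rightarrow> bool" where
  "linear_bij V W T \<longleftrightarrow>
     (\<forall>u\<in>carr V. \<forall>v\<in>carr V. T (u + v) = T u + T v) \<and>
     (\<forall>c. \<forall>u\<in>carr V. T (scal V c u) = scal W c (T u)) \<and>
     bij_betw T (carr V) (carr W)"

definition symplectic_iso ::
  "'v::ab_group_add form_space \<Rightarrow> 'w::ab_group_add form_space \<Rightarrow> ('v \<Rightarrow> 'w) \<Rightarrow> bool" where
  "symplectic_iso V W T \<longleftrightarrow>
     linear_bij V W T \<and> (\<forall>u\<in>carr V. \<forall>v\<in>carr V. form W (T u) (T v) = form V u v)"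

definition anti_symplectic :: "nat \<Rightarrow> (cvec \<times> cvec \<Rightarrow> cvec \<times> cvec) \<Rightarrow> bool" where
  "anti_symplectic n T \<longleftrightarrow>
     linear_bij (Csymp n) (Csymp n) T \<and>
     (\<forall>u\<in>carr (Csymp n). \<forall>v\<in>carr (Csymp n). omega n (T u) (T v) = - omega n u v)"

text \<open>An \<open>n \<times> n\<close> matrix is a function of two indices, of which only the entries below \<open>n\<close>
  matter.\<close>

definition hermitian :: "nat \<Rightarrow> (nat \<Rightarrow> nat \<Rightarrow> complex) \<Rightarrow> bool" where
  "hermitian n M \<longleftrightarrow> (\<forall>i<n. \<forall>j<n. M j i = cnj (M i j))"

definition mat_vec :: "nat \<Rightarrow> (nat \<Rightarrow> nat \<Rightarrow> complex) \<Rightarrow> cvec \<Rightarrow> cvec" where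
  "mat_vec n M x = (\<lambda>i. if i < n then \<Sum>j<n. M i j * x j else 0)"

definition graph_plane :: "nat \<Rightarrow> (nat \<Rightarrow> nat \<Rightarrow> complex) \<Rightarrow> (cvec \<times> cvec) set" where
  "graph_plane n M = {(x, mat_vec n M x) | x. x \<in> Cn n}"

definition infinity_plane :: "nat \<Rightarrow> (cvec \<times> cvec) set" where
  "infinity_plane n = {0} \<times> Cn n"

definition eigenspace :: "nat \<Rightarrow> (nat \<Rightarrow> nat \<Rightarrow> complex) \<Rightarrow> complex \<Rightarrow> cvec set" where
  "eigenspace n M c = {x \<in> Cn n. mat_vec n M x = vscale c x}"

text \<open>Only used for Hermitian matrices, whose eigenvalues are real and finitely many, with the
  multiplicity of each equal to the dimension of its eigenspace.\<close>

definition n_minus :: "nat \<Rightarrow> (nat \<Rightarrow> nat \<Rightarrow> complex) \<Rightarrow> nat" where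
  "n_minus n M =
     (\<Sum>l\<in>{l::real. l < 0 \<and> eigenspace n M (of_real l) \<noteq> {0}}.
        vector_space.dim vscale (eigenspace n M (of_real l)))"

type_synonym triple_index =
  "(cvec \<times> cvec) set \<Rightarrow> (cvec \<times> cvec) set \<Rightarrow> (cvec \<times> cvec) set \<Rightarrow> nat"

text \<open>The first clause fixes the value \<open>0\<close> outside \<open>\<Lambda>(n)\<^sup>3\<close>, so that uniqueness on \<open>\<Lambda>(n)\<^sup>3\<close> becomes
  uniqueness of the total function.\<close>

definition is_duistermaat :: "nat \<Rightarrow> triple_index \<Rightarrow> bool" where
  "is_duistermaat n f \<longleftrightarrow>
     (\<forall>L1 L2 L3. \<not> (L1 \<in> Lagr n \<and> L2 \<in> Lagr n \<and> L3 \<in> Lagr n) \<longrightarrow> f L1 L2 L3 = 0) \<and>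
     (\<forall>L1\<in>Lagr n. \<forall>L2\<in>Lagr n. \<forall>L3\<in>Lagr n. f L1 L2 L3 \<le> n) \<and>
     (\<forall>A. hermitian n A \<longrightarrow>
        f (graph_plane n (\<lambda>i j. 0)) (graph_plane n A) (infinity_plane n) = n_minus n A) \<and>
     (\<forall>T. symplectic_iso (Csymp n) (Csymp n) T \<longrightarrow>
        (\<forall>L1\<in>Lagr n. \<forall>L2\<in>Lagr n. \<forall>L3\<in>Lagr n.
           f (T ` L1) (T ` L2) (T ` L3) = f L1 L2 L3)) \<and>
     (\<forall>L1\<in>Lagr n. \<forall>L2\<in>Lagr n. \<forall>L3\<in>Lagr n. \<forall>L4\<in>Lagr n.
        int (f L1 L2 L3) - int (f L1 L2 L4) + int (f L1 L3 L4) - int (f L2 L3 L4) = 0)"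

definition duistermaat :: "nat \<Rightarrow> triple_index" where
  "duistermaat n = (THE f. is_duistermaat n f)"

text \<open>Finite-dimensionality is implied by the isomorphism.\<close>

definition symplectic_space :: "'v::ab_group_add form_space \<Rightarrow> bool" where
  "symplectic_space V \<longleftrightarrow>
     vector_space (scal V) \<and> module.subspace (scal V) (carr V) \<and>
     (\<exists>m T. symplectic_iso V (Csymp m) T)"

definition duistermaat_on ::
  "'v::ab_group_add form_space \<Rightarrow> 'v set \<Rightarrow> 'v set \<Rightarrow> 'v set \<Rightarrow> nat" where
  "duistermaat_on V L1 L2 L3 =
     (THE k. \<exists>m T. symplectic_iso V (Csymp m) T \<and>
                   k = duistermaat m (T ` L1) (T ` L2) (T ` L3))"

definition symp_sum :: "'v form_space \<Rightarrow> 'w form_space \<Rightarrow> ('v \<times> 'w) form_space" where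
  "symp_sum V W =
     \<lparr>scal = (\<lambda>c u. (scal V c (fst u), scal W c (snd u))),
      carr = carr V \<times> carr W,
      form = (\<lambda>u v. form V (fst u) (fst v) + form W (snd u) (snd v))\<rparr>"

abbreviation pdim :: "(cvec \<times> cvec) set \<Rightarrow> int" where
  "pdim S \<equiv> int (vector_space.dim pscale S)"

end

theory Submission
  imports Defs "HOL-Computational_Algebra.Fundamental_Theorem_Algebra"
begin

text \<open>Write \<open>\<nu>(M)\<close> for the number of negative eigenvalues of a Hermitian matrix. For every Lagrangian
  plane \<open>L\<close> the graph of the scalar matrix \<open>t I\<close> with \<open>t\<close> real is transversal to \<open>L\<close> for all but
  finitely many \<open>t\<close>: the vectors \<open>x\<close> with \<open>(x, t x) \<in> L\<close> for distinct \<open>t\<close> are orthogonal. Hence one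
  symplectic map turns any finite family of Lagrangian planes into graphs of Hermitian matrices. In
  such coordinates a function with the three defining properties must be
  \<open>\<iota>(G\<^sub>A, G\<^sub>B, G\<^sub>C) = \<nu>(B - A) - \<nu>(C - A) + \<nu>(C - B)\<close>, by the cocycle identity with fourth argument
  \<open>G\<^sub>\<infinity>\<close> and a symplectic shear. This gives uniqueness, and the identities for repeated and
  permuted arguments follow from \<open>\<nu>(M) + \<nu>(- M) = n - dim ker M\<close>. For existence, the explicit formula
  with the triple form is symplectically invariant and additive for evident reasons, and
  diagonalising the triple form of three graphs shows that it equals the expression above, so that
  it is a cocycle; subadditivity of \<open>\<nu>\<close> gives the bounds \<open>0\<close> and \<open>n\<close>.\<close>

section \<open>Finite-dimensional subspaces of complex vector spaces\<close>

text \<open>The defining properties count eigenvalues, while the rest of the argument moves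
  Hermitian forms between subspaces and direct sums. The negative index is therefore taken as the
  largest dimension of a negative definite subspace, which refers to no basis; the spectral theorem
  enters once, in \<open>n_minus_eq_mat_neg_index\<close>, to identify the two counts. All linear
  algebra is relative to subspaces, because the ambient type of the model spaces is
  infinite-dimensional and a map of form spaces is controlled only on the carrier. The summand
  dim(L1 \<inter> L3) - n of the explicit formula has a definite task: diagonalising the triple form
  of three graphs yields \<nu>(B - A) + \<nu>(C - B) + \<nu>(A - C), which is cyclically symmetric,
  and the correction turns \<nu>(A - C) into - \<nu>(C - A), which makes it a cocycle. As
  G_\<infinity> is not a graph, the normalisation property requires a second
  diagonalisation.\<close>

locale complex_space = vector_space scale
  for scale :: "complex \<Rightarrow> 'b::ab_group_add \<Rightarrow> 'b"
begin

text \<open>A property of subspaces rather than of types: the type \<open>cvec\<close> itself has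
  infinite dimension.\<close>

definition fin_dim :: "'b set \<Rightarrow> bool" where
  "fin_dim S \<longleftrightarrow> subspace S \<and> (\<exists>B. finite B \<and> S \<subseteq> span B)"

lemma fin_dim_subspace: "fin_dim S \<Longrightarrow> subspace S"
  by (simp add: fin_dim_def)

lemma fin_dim_basis:
  assumes "fin_dim S"
  obtains B where "finite B" "B \<subseteq> S" "independent B" "span B = S" "card B = dim S"
proof -
  obtain C where C: "finite C" "S \<subseteq> span C" and S: "subspace S"
    using assms by (auto simp: fin_dim_def)
  obtain B where B: "B \<subseteq> S" "independent B" "S \<subseteq> span B" "card B = dim S"
    using basis_exists[of S] by blast
  have "finite B" using independent_span_bound[of C B] B C by auto
  moreover have "span B = S" using B S span_subspace by blast
  ultimately show ?thesis using that B by blast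
qed

lemma fin_dim_span: "finite B \<Longrightarrow> fin_dim (span B)"
  by (auto simp: fin_dim_def)

lemma fin_dim_subset: "fin_dim S \<Longrightarrow> subspace U \<Longrightarrow> U \<subseteq> S \<Longrightarrow> fin_dim U"
  by (auto simp: fin_dim_def)

lemma card_le_dim:
  assumes "fin_dim S" "independent C" "C \<subseteq> S"
  shows "finite C" "card C \<le> dim S"
proof -
  obtain B where B: "finite B" "span B = S" "card B = dim S"
    using fin_dim_basis[OF assms(1)] by blast
  then show "finite C" "card C \<le> dim S"
    using independent_span_bound[of B C] assms by auto
qed

lemma fin_dim_dim_mono:
  assumes "fin_dim S" "subspace U" "U \<subseteq> S"
  shows "dim U \<le> dim S"
proof -
  obtain C where "independent C" "C \<subseteq> U" "card C = dim U"
    using fin_dim_basis[OF fin_dim_subset[OF assms]] by blast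
  then show ?thesis using card_le_dim(2)[of S C] assms by auto
qed

lemma fin_dim_dim_strict_mono:
  assumes "fin_dim S" "subspace U" "U \<subset> S"
  shows "dim U < dim S"
proof -
  have "U \<subseteq> S" using assms by blast
  obtain C where C: "finite C" "independent C" "C \<subseteq> U" "span C = U" "card C = dim U"
    using fin_dim_basis[OF fin_dim_subset[OF assms(1,2) \<open>U \<subseteq> S\<close>]] by metis
  obtain x where x: "x \<in> S" "x \<notin> U" using assms by blast
  have "independent (insert x C)" using C x by (simp add: independent_insertI)
  then have "card (insert x C) \<le> dim S"
    using card_le_dim(2)[of S "insert x C"] assms C x by auto
  moreover have "x \<notin> C" using C x by auto
  ultimately show ?thesis using C by auto
qed

lemma fin_dim_dim_0:
  assumes "fin_dim S" "dim S = 0"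
  shows "S = {0}"
proof -
  obtain B where "finite B" "span B = S" "card B = dim S"
    using fin_dim_basis[OF assms(1)] by blast
  then show ?thesis using assms by auto
qed

lemma dim_zero_space: "dim {0} = 0"
  using dim_span[of "{}"] dim_eq_card_independent[of "{}"] by (simp add: independent_empty)

lemma fin_dim_zero: "fin_dim {0}"
  using fin_dim_span[of "{}"] by simp

lemma dim_span_singleton: "x \<noteq> 0 \<Longrightarrow> dim (span {x}) = 1"
  using dim_span_eq_card_independent[of "{x}"] by simp

lemma dim_direct_sum:
  assumes "fin_dim U" "fin_dim W" "U \<inter> W = {0}"
  shows "fin_dim {u + w | u w. u \<in> U \<and> w \<in> W}"
    and "dim {u + w | u w. u \<in> U \<and> w \<in> W} = dim U + dim W"
proof -
  obtain B where B: "finite B" "independent B" "span B = U" "card B = dim U"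
    using fin_dim_basis[OF assms(1)] by metis
  obtain C where C: "finite C" "independent C" "span C = W" "card C = dim W"
    using fin_dim_basis[OF assms(2)] by metis
  have sp: "span (B \<union> C) = {u + w | u w. u \<in> U \<and> w \<in> W}"
    using span_Un[of B C] B C by simp
  show "fin_dim {u + w | u w. u \<in> U \<and> w \<in> W}"
    using fin_dim_span[of "B \<union> C"] sp B C by simp
  have disj: "B \<inter> C = {}"
  proof -
    have "B \<inter> C \<subseteq> {0}" using B C assms(3) span_superset by blast
    moreover have "0 \<notin> B" using B(2) dependent_zero by blast
    ultimately show ?thesis by blast
  qed
  have "independent (B \<union> C)"
  proof (rule independent_if_scalars_zero)
    show "finite (B \<union> C)" using B C by simp
    fix f x assume s: "(\<Sum>y\<in>B \<union> C. scale (f y) y) = 0" and x: "x \<in> B \<union> C"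
    have eq: "(\<Sum>y\<in>B. scale (f y) y) + (\<Sum>y\<in>C. scale (f y) y) = 0"
      using s sum.union_disjoint[OF B(1) C(1) disj] by metis
    have 1: "(\<Sum>y\<in>B. scale (f y) y) \<in> U"
      unfolding B(3)[symmetric] by (intro span_sum span_scale span_base)
    have "(\<Sum>y\<in>C. scale (f y) y) \<in> W"
      unfolding C(3)[symmetric] by (intro span_sum span_scale span_base)
    moreover have "(\<Sum>y\<in>B. scale (f y) y) = - (\<Sum>y\<in>C. scale (f y) y)"
      using eq by (simp add: eq_neg_iff_add_eq_0)
    ultimately have "(\<Sum>y\<in>B. scale (f y) y) \<in> W"
      using assms(2) subspace_neg by (simp add: fin_dim_def)
    with 1 have z: "(\<Sum>y\<in>B. scale (f y) y) = 0" using assms(3) by blast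
    with eq have z': "(\<Sum>y\<in>C. scale (f y) y) = 0" by simp
    show "f x = 0"
      using x independentD[OF B(2,1) subset_refl z] independentD[OF C(2,1) subset_refl z'] by blast
  qed
  then have "dim (span (B \<union> C)) = card (B \<union> C)" by (rule dim_span_eq_card_independent)
  also have "\<dots> = dim U + dim W" using card_Un_disjoint[OF B(1) C(1) disj] B C by simp
  finally show "dim {u + w | u w. u \<in> U \<and> w \<in> W} = dim U + dim W" using sp by simp
qed

text \<open>Stated for an indexed family because it is applied to the iterates of a vector under a
  map, where members may repeat. A repetition is itself a relation, with coefficients 1 and
  -1.\<close>

lemma linear_dependence:
  assumes "fin_dim S" "\<And>i. i \<le> dim S \<Longrightarrow> v i \<in> S"
  shows "\<exists>c::nat \<Rightarrow> complex. (\<exists>i\<le>dim S. c i \<noteq> 0) \<and> (\<Sum>i\<le>dim S. scale (c i) (v i)) = 0"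
proof (cases "inj_on v {..dim S}")
  case True
  have "dependent (v ` {..dim S})"
  proof (rule ccontr)
    assume "independent (v ` {..dim S})"
    then have "card (v ` {..dim S}) \<le> dim S" using card_le_dim[OF assms(1)] assms(2) by auto
    then show False using card_image[OF True] by simp
  qed
  then obtain u where u: "\<exists>x\<in>v ` {..dim S}. u x \<noteq> 0" "(\<Sum>x\<in>v ` {..dim S}. scale (u x) x) = 0"
    by (subst (asm) dependent_finite) auto
  have "(\<Sum>i\<le>dim S. scale (u (v i)) (v i)) = 0"
    using u(2) sum.reindex[OF True, of "\<lambda>x. scale (u x) x"] by (simp add: comp_def)
  then show ?thesis using u(1) by (intro exI[of _ "u \<circ> v"]) auto
next
  case False
  then obtain i j where ij: "i \<le> dim S" "j \<le> dim S" "i \<noteq> j" "v i = v j" by (auto simp: inj_on_def)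
  let ?c = "\<lambda>k. if k = i then 1 else if k = j then -1 else (0::complex)"
  have "(\<Sum>k\<le>dim S. scale (?c k) (v k)) = (\<Sum>k\<in>{i,j}. scale (?c k) (v k))"
    using ij by (intro sum.mono_neutral_right) auto
  also have "\<dots> = 0" using ij by (simp)
  finally show ?thesis using ij by (intro exI[of _ ?c]) auto
qed

end

text \<open>A map of form spaces is constrained on the carrier alone, so linearity is asked for only
  on S. \<open>lin_on_eq_linear\<close> recovers a global linear map from it.\<close>

definition lin_on ::
  "(complex \<Rightarrow> 'v::ab_group_add \<Rightarrow> 'v) \<Rightarrow> (complex \<Rightarrow> 'w::ab_group_add \<Rightarrow> 'w) \<Rightarrow> 'v set \<Rightarrow> ('v \<Rightarrow> 'w) \<Rightarrow> bool"
  where "lin_on s t S f \<longleftrightarrow>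
    (\<forall>u\<in>S. \<forall>v\<in>S. f (u + v) = f u + f v) \<and> (\<forall>c. \<forall>u\<in>S. f (s c u) = t c (f u))"

lemma lin_on_subset: "lin_on s t S f \<Longrightarrow> U \<subseteq> S \<Longrightarrow> lin_on s t U f"
  by (auto simp: lin_on_def subset_iff)

lemma lin_on_inv_into:
  assumes "complex_space s" "module.subspace s S" "lin_on s t S f" "inj_on f S"
  shows "lin_on t s (f ` S) (inv_into S f)"
proof -
  interpret complex_space s by fact
  note S = assms(2)
  show ?thesis
    unfolding lin_on_def
  proof (intro conjI allI ballI)
    fix x y assume "x \<in> f ` S" "y \<in> f ` S"
    then obtain u v where "u \<in> S" "v \<in> S" "x = f u" "y = f v" by auto
    moreover from this have "f u + f v = f (u + v)" "u + v \<in> S"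
      using assms(3) subspace_add[OF S] by (auto simp: lin_on_def)
    ultimately show "inv_into S f (x + y) = inv_into S f x + inv_into S f y"
      using assms(4) by simp
  next
    fix c x assume "x \<in> f ` S"
    then obtain u where "u \<in> S" "x = f u" by auto
    moreover from this have "t c (f u) = f (s c u)" "s c u \<in> S"
      using assms(3) subspace_scale[OF S] by (auto simp: lin_on_def)
    ultimately show "inv_into S f (t c x) = s c (inv_into S f x)"
      using assms(4) by simp
  qed
qed

locale complex_space_pair = vs1: complex_space s1 + vs2: complex_space s2
  for s1 :: "complex \<Rightarrow> 'b::ab_group_add \<Rightarrow> 'b" and s2 :: "complex \<Rightarrow> 'c::ab_group_add \<Rightarrow> 'c"
begin

sublocale vector_space_pair s1 s2 ..

lemma lin_on_subspace_image:
  assumes "vs1.subspace S" "lin_on s1 s2 S f"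
  shows "vs2.subspace (f ` S)"
proof (rule vs2.subspaceI)
  have z: "0 \<in> S" using assms vs1.subspace_0 by blast
  have "f (s1 0 0) = s2 0 (f 0)" using assms(2) z unfolding lin_on_def by blast
  then have "f 0 = 0" by simp
  then show "0 \<in> f ` S" using z by force
next
  fix x y assume "x \<in> f ` S" "y \<in> f ` S"
  then obtain u v where "u \<in> S" "v \<in> S" "x = f u" "y = f v" by auto
  then show "x + y \<in> f ` S" using assms vs1.subspace_add[of S u v]
    by (auto simp: lin_on_def intro!: image_eqI[of _ _ "u + v"])
next
  fix c x assume "x \<in> f ` S"
  then obtain u where "u \<in> S" "x = f u" by auto
  then show "s2 c x \<in> f ` S" using assms vs1.subspace_scale[of S u c]
    by (auto simp: lin_on_def intro!: image_eqI[of _ _ "s1 c u"])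
qed

text \<open>The global map is prescribed on a basis of S. It makes the facts on maps that are linear
  on a whole type available for f.\<close>

lemma lin_on_eq_linear:
  assumes "vs1.fin_dim S" "lin_on s1 s2 S f"
  obtains g where "Vector_Spaces.linear s1 s2 g" "\<And>x. x \<in> S \<Longrightarrow> g x = f x"
proof -
  obtain B where B: "finite B" "B \<subseteq> S" "vs1.independent B" "vs1.span B = S"
    using vs1.fin_dim_basis[OF assms(1)] by metis
  let ?g = "construct B f"
  have lin: "Vector_Spaces.linear s1 s2 ?g" using linear_construct[OF B(3)] by simp
  interpret g: Vector_Spaces.linear s1 s2 ?g by (fact lin)
  have S: "vs1.subspace S" using assms(1) by (rule vs1.fin_dim_subspace)
  have z: "0 \<in> S" using S vs1.subspace_0 by blast
  have "f (s1 0 0) = s2 0 (f 0)" using assms(2) z unfolding lin_on_def by blast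
  then have f0: "f 0 = 0" by simp
  have "x \<in> S \<and> ?g x = f x" if "x \<in> vs1.span B" for x
    using that
  proof (induct rule: vs1.span_induct_alt)
    case base
    show ?case using f0 z by simp
  next
    case (step c x y)
    have x: "x \<in> S" "s1 c x \<in> S" using step B S vs1.subspace_scale by auto
    moreover have "?g x = f x" using construct_basis[OF B(3), of x f] step by blast
    moreover have "f (s1 c x + y) = s2 c (f x) + f y"
      using assms(2) x step by (simp add: lin_on_def)
    ultimately show ?case using step S vs1.subspace_add by (auto simp: g.add g.scale)
  qed
  then show ?thesis using that lin B by blast
qed

lemma fin_dim_image:
  assumes "vs1.fin_dim S" "lin_on s1 s2 S f"
  shows "vs2.fin_dim (f ` S)"
proof -
  obtain g where g: "Vector_Spaces.linear s1 s2 g" "\<And>x. x \<in> S \<Longrightarrow> g x = f x"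
    using lin_on_eq_linear[OF assms] by metis
  interpret g: Vector_Spaces.linear s1 s2 g by (fact g(1))
  obtain B where B: "finite B" "vs1.span B = S"
    using vs1.fin_dim_basis[OF assms(1)] by metis
  have "f ` S = g ` S" using g(2) by force
  also have "\<dots> = vs2.span (g ` B)" using g.span_image[of B] B by simp
  finally show ?thesis using B vs2.fin_dim_span[of "g ` B"] by simp
qed

lemma dim_image_inj:
  assumes "vs1.fin_dim S" "lin_on s1 s2 S f" "inj_on f S"
  shows "vs2.dim (f ` S) = vs1.dim S"
proof -
  obtain g where g: "Vector_Spaces.linear s1 s2 g" "\<And>x. x \<in> S \<Longrightarrow> g x = f x"
    using lin_on_eq_linear[OF assms(1,2)] by metis
  interpret g: Vector_Spaces.linear s1 s2 g by (fact g(1))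
  obtain B where B: "finite B" "vs1.independent B" "vs1.span B = S" "card B = vs1.dim S"
    using vs1.fin_dim_basis[OF assms(1)] by metis
  have inj: "inj_on g S" using assms(3) g(2) by (simp cong: inj_on_cong)
  have "B \<subseteq> S" using B(3) vs1.span_superset by blast
  have "f ` S = g ` S" using g(2) by force
  also have "\<dots> = vs2.span (g ` B)" using g.span_image[of B] B by simp
  finally have "vs2.dim (f ` S) = vs2.dim (vs2.span (g ` B))" by simp
  also have "\<dots> = card (g ` B)"
    using g.independent_injective_image[of B] B inj by (intro vs2.dim_span_eq_card_independent) auto
  also have "\<dots> = vs1.dim S" using card_image[OF inj_on_subset[OF inj \<open>B \<subseteq> S\<close>]] B by simp
  finally show ?thesis .
qed

end

section \<open>Direct products of complex vector spaces\<close>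

definition prod_scale ::
  "('a \<Rightarrow> 'v \<Rightarrow> 'v) \<Rightarrow> ('a \<Rightarrow> 'w \<Rightarrow> 'w) \<Rightarrow> 'a \<Rightarrow> 'v \<times> 'w \<Rightarrow> 'v \<times> 'w"
  where "prod_scale s t c u = (s c (fst u), t c (snd u))"

lemma prod_scale_Pair [simp]: "prod_scale s t c (x, y) = (s c x, t c y)"
  by (simp add: prod_scale_def)

context complex_space_pair
begin

lemma complex_space_prod: "complex_space (prod_scale s1 s2)"
  by unfold_locales
    (auto simp: prod_scale_def vs1.scale_right_distrib vs2.scale_right_distrib
      vs1.scale_left_distrib vs2.scale_left_distrib)

lemma subspace_Times:
  assumes "vs1.subspace U" "vs2.subspace W"
  shows "module.subspace (prod_scale s1 s2) (U \<times> W)"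
proof -
  interpret p: complex_space "prod_scale s1 s2" by (rule complex_space_prod)
  show ?thesis
    by (rule p.subspaceI)
      (use assms in \<open>auto simp: zero_prod_def vs1.subspace_0 vs2.subspace_0 vs1.subspace_add
        vs2.subspace_add vs1.subspace_scale vs2.subspace_scale\<close>)
qed

lemma fin_dim_dim_Times:
  assumes U: "vs1.fin_dim U" and W: "vs2.fin_dim W"
  shows "complex_space.fin_dim (prod_scale s1 s2) (U \<times> W)"
    and "vector_space.dim (prod_scale s1 s2) (U \<times> W) = vs1.dim U + vs2.dim W"
proof -
  interpret p: complex_space "prod_scale s1 s2" by (rule complex_space_prod)
  interpret p1: complex_space_pair s1 "prod_scale s1 s2" ..
  interpret p2: complex_space_pair s2 "prod_scale s1 s2" ..
  have l1: "lin_on s1 (prod_scale s1 s2) U (\<lambda>u. (u, 0))"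
    by (auto simp: lin_on_def)
  have l2: "lin_on s2 (prod_scale s1 s2) W (\<lambda>w. (0, w))"
    by (auto simp: lin_on_def)
  have i: "inj_on (\<lambda>u. (u, 0)) U" "inj_on (\<lambda>w. (0, w)) W" by (auto simp: inj_on_def)
  have 0: "0 \<in> U" "0 \<in> W" using U W vs1.subspace_0 vs2.subspace_0
    by (auto simp: vs1.fin_dim_def vs2.fin_dim_def)
  let ?U = "(\<lambda>u. (u, 0)) ` U" and ?W = "(\<lambda>w. (0, w)) ` W"
  have f: "p.fin_dim ?U" "p.fin_dim ?W"
    using p1.fin_dim_image[OF U l1] p2.fin_dim_image[OF W l2] by auto
  have int: "?U \<inter> ?W = {0}" using 0 by (auto simp: zero_prod_def)
  have eq: "{u + w | u w. u \<in> ?U \<and> w \<in> ?W} = U \<times> W" by force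
  show "p.fin_dim (U \<times> W)" using p.dim_direct_sum(1)[OF f int] unfolding eq .
  show "p.dim (U \<times> W) = vs1.dim U + vs2.dim W"
    using p.dim_direct_sum(2)[OF f int] p1.dim_image_inj[OF U l1 i(1)] p2.dim_image_inj[OF W l2 i(2)]
    unfolding eq by simp
qed

end

section \<open>Negative index of Hermitian forms\<close>

context complex_space
begin

text \<open>The variational form of the number of negative eigenvalues. It sees only the quadratic
  form q and the subspace S, so it passes along injections without any choice of basis. The maximum
  is meaningful for finite-dimensional S, where the dimensions are bounded and {0} always
  competes.\<close>

definition neg_index :: "'b set \<Rightarrow> ('b \<Rightarrow> real) \<Rightarrow> nat" where
  "neg_index S q = Max {dim U | U. subspace U \<and> U \<subseteq> S \<and> (\<forall>u\<in>U. u \<noteq> 0 \<longrightarrow> q u < 0)}"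

lemma neg_index_ge:
  assumes "fin_dim S" "subspace U" "U \<subseteq> S" "\<And>u. u \<in> U \<Longrightarrow> u \<noteq> 0 \<Longrightarrow> q u < 0"
  shows "dim U \<le> neg_index S q"
proof -
  have "{dim U | U. subspace U \<and> U \<subseteq> S \<and> (\<forall>u\<in>U. u \<noteq> 0 \<longrightarrow> q u < 0)} \<subseteq> {..dim S}"
    using fin_dim_dim_mono[OF assms(1)] by auto
  then have "finite {dim U | U. subspace U \<and> U \<subseteq> S \<and> (\<forall>u\<in>U. u \<noteq> 0 \<longrightarrow> q u < 0)}"
    using finite_subset by blast
  then show ?thesis unfolding neg_index_def using assms by (intro Max_ge) auto
qed

lemma neg_index_attained:
  assumes "fin_dim S"
  obtains U where "subspace U" "U \<subseteq> S" "dim U = neg_index S q"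
    "\<And>u. u \<in> U \<Longrightarrow> u \<noteq> 0 \<Longrightarrow> q u < 0"
proof -
  let ?D = "{dim U | U. subspace U \<and> U \<subseteq> S \<and> (\<forall>u\<in>U. u \<noteq> 0 \<longrightarrow> q u < 0)}"
  have "?D \<subseteq> {..dim S}"
    using fin_dim_dim_mono[OF assms(1)] by auto
  then have "finite ?D" using finite_subset by blast
  moreover have "dim {0} \<in> ?D"
    using fin_dim_subspace[OF assms] subspace_0 by (auto intro!: exI[of _ "{0}"])
  ultimately have "Max ?D \<in> ?D" by (intro Max_in) auto
  then show ?thesis using that unfolding neg_index_def by auto
qed

text \<open>A negative definite U meets Z only in 0, so dim U + dim Z is at most dim S, which is dim
  N + dim Z. Every later computation of a negative index is done by exhibiting such N and Z.\<close>

lemma neg_index_eqI: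
  assumes S: "fin_dim S" and N: "subspace N" "N \<subseteq> S" and Z: "subspace Z" "Z \<subseteq> S"
    and dec: "\<And>s. s \<in> S \<Longrightarrow> \<exists>n\<in>N. \<exists>z\<in>Z. s = n + z"
    and neg: "\<And>u. u \<in> N \<Longrightarrow> u \<noteq> 0 \<Longrightarrow> q u < 0" and nonneg: "\<And>u. u \<in> Z \<Longrightarrow> 0 \<le> q u"
  shows "neg_index S q = dim N"
proof (rule antisym)
  obtain U where U: "subspace U" "U \<subseteq> S" "dim U = neg_index S q"
    "\<And>u. u \<in> U \<Longrightarrow> u \<noteq> 0 \<Longrightarrow> q u < 0"
    using neg_index_attained[OF S] by metis
  have triv: "V \<inter> Z = {0}" if "subspace V" "\<And>u. u \<in> V \<Longrightarrow> u \<noteq> 0 \<Longrightarrow> q u < 0" for V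
    using that nonneg subspace_0[OF Z(1)] subspace_0[OF that(1)] by fastforce
  note fU = fin_dim_subset[OF S U(1,2)] and fZ = fin_dim_subset[OF S Z] and fN = fin_dim_subset[OF S N]
  note sumU = dim_direct_sum[OF fU fZ triv[OF U(1,4)]]
  note sumN = dim_direct_sum[OF fN fZ triv[OF N(1) neg]]
  have "{n + z | n z. n \<in> N \<and> z \<in> Z} = S"
    using dec N(2) Z(2) subspace_add[OF fin_dim_subspace[OF S]] by blast
  moreover have "{u + z | u z. u \<in> U \<and> z \<in> Z} \<subseteq> S"
    using U(2) Z(2) subspace_add[OF fin_dim_subspace[OF S]] by blast
  then have "dim {u + z | u z. u \<in> U \<and> z \<in> Z} \<le> dim S"
    using fin_dim_dim_mono[OF S] sumU(1) fin_dim_subspace by blast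
  ultimately show "neg_index S q \<le> dim N" using sumU(2) sumN(2) U(3) by simp
  show "dim N \<le> neg_index S q" using neg_index_ge[OF S N] neg by blast
qed

end

section \<open>Hermitian forms and Sylvester's decomposition\<close>

locale herm_form = complex_space scale
  for scale :: "complex \<Rightarrow> 'b::ab_group_add \<Rightarrow> 'b" +
  fixes S :: "'b set" and h :: "'b \<Rightarrow> 'b \<Rightarrow> complex"
  assumes subspace_S: "subspace S"
    and add_left: "\<And>u v w. u \<in> S \<Longrightarrow> v \<in> S \<Longrightarrow> w \<in> S \<Longrightarrow> h (u + v) w = h u w + h v w"
    and scale_left: "\<And>c u w. u \<in> S \<Longrightarrow> w \<in> S \<Longrightarrow> h (scale c u) w = c * h u w"
    and herm: "\<And>u v. u \<in> S \<Longrightarrow> v \<in> S \<Longrightarrow> h v u = cnj (h u v)"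
begin

lemma S_closed [simp]:
  "0 \<in> S" "u \<in> S \<Longrightarrow> v \<in> S \<Longrightarrow> u + v \<in> S" "u \<in> S \<Longrightarrow> scale c u \<in> S"
  "u \<in> S \<Longrightarrow> v \<in> S \<Longrightarrow> u - v \<in> S"
  using subspace_S subspace_0 subspace_add subspace_scale subspace_diff by auto

lemma add_right: "u \<in> S \<Longrightarrow> v \<in> S \<Longrightarrow> w \<in> S \<Longrightarrow> h w (u + v) = h w u + h w v"
  using add_left[of u v w] herm[of "u + v" w] herm[of u w] herm[of v w] by simp

lemma scale_right: "u \<in> S \<Longrightarrow> w \<in> S \<Longrightarrow> h w (scale c u) = cnj c * h w u"
  using scale_left[of u w c] herm[of "scale c u" w] herm[of u w] by simp

lemma zero_left: "w \<in> S \<Longrightarrow> h 0 w = 0"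
  using scale_left[of w w 0] by simp

lemma zero_right: "w \<in> S \<Longrightarrow> h w 0 = 0"
  using scale_right[of w w 0] by simp

lemma diff_left: "u \<in> S \<Longrightarrow> v \<in> S \<Longrightarrow> w \<in> S \<Longrightarrow> h (u - v) w = h u w - h v w"
  using add_left[of "u - v" v w] by simp

lemma diag_real: "u \<in> S \<Longrightarrow> h u u = of_real (Re (h u u))"
  using herm[of u u] by (metis Reals_cnj_iff of_real_Re)

lemma orth_sym: "u \<in> S \<Longrightarrow> v \<in> S \<Longrightarrow> h u v = 0 \<longleftrightarrow> h v u = 0"
  using herm[of u v] by simp

lemma herm_form_subspace: "subspace U \<Longrightarrow> U \<subseteq> S \<Longrightarrow> herm_form scale U h"
  by unfold_locales (auto simp: subset_iff add_left scale_left intro: herm)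

lemma herm_form_uminus: "herm_form scale S (\<lambda>u v. - h u v)"
  by unfold_locales (auto simp: add_left scale_left subspace_S intro: herm)

text \<open>Sylvester's decomposition: N negative definite, P positive definite, Z inside the
  radical. The signs make the sum direct, and Z turns out to be the whole radical; both are derived
  in \<open>neg_index_sum_radical\<close>.\<close>

definition splits :: "'b set \<Rightarrow> 'b set \<Rightarrow> 'b set \<Rightarrow> bool" where
  "splits N P Z \<longleftrightarrow> subspace N \<and> subspace P \<and> subspace Z \<and> N \<subseteq> S \<and> P \<subseteq> S \<and> Z \<subseteq> S \<and>
    (\<forall>s\<in>S. \<exists>n\<in>N. \<exists>p\<in>P. \<exists>z\<in>Z. s = n + p + z) \<and>
    (\<forall>u\<in>N. u \<noteq> 0 \<longrightarrow> Re (h u u) < 0) \<and> (\<forall>u\<in>P. u \<noteq> 0 \<longrightarrow> 0 < Re (h u u)) \<and>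
    (\<forall>z\<in>Z. \<forall>s\<in>S. h z s = 0) \<and> (\<forall>u\<in>N. \<forall>v\<in>P. h u v = 0)"

lemma splits_sum: "splits N P Z \<Longrightarrow> t \<in> S \<Longrightarrow> \<exists>n\<in>N. \<exists>p\<in>P. \<exists>z\<in>Z. t = n + p + z"
  by (simp add: splits_def)

text \<open>Polarisation: expanding the form at u + v gives h u v + h v u = 0, and at \<i> u + v it
  gives h u v - h v u = 0.\<close>

lemma isotropic_zero:
  assumes "\<And>u. u \<in> S \<Longrightarrow> h u u = 0" "u \<in> S" "v \<in> S"
  shows "h u v = 0"
proof -
  note diag = assms(1)[OF assms(2)] assms(1)[OF assms(3)]
  have "h (u + v) (u + v) = h u v + h v u"
    using assms(2,3) by (simp add: add_left add_right diag)
  then have 1: "h u v + h v u = 0" using assms by simp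
  have "h (scale \<i> u + v) (scale \<i> u + v) = \<i> * (h u v - h v u)"
    using assms(2,3) by (simp add: add_left add_right scale_left scale_right diag algebra_simps)
  then have "h u v - h v u = 0" using assms by simp
  with 1 show ?thesis by simp
qed

text \<open>S is the sum of the line through v and the orthogonal complement of v. A splitting of
  the complement extends to S by adding the line to the negative part.\<close>

lemma splits_step:
  assumes v: "v \<in> S" "Re (h v v) < 0"
    and sp: "herm_form.splits scale {s \<in> S. h s v = 0} h N P Z"
  shows "\<exists>N. splits N P Z"
proof -
  let ?S = "{s \<in> S. h s v = 0}"
  have sub: "subspace ?S"
    by (rule subspaceI) (auto simp: zero_left v add_left scale_left)
  interpret H': herm_form scale ?S h by (rule herm_form_subspace[OF sub]) auto
  let ?N = "{u + w | u w. u \<in> span {v} \<and> w \<in> N}"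
  note sp' = sp[unfolded H'.splits_def]
  have NP: "N \<subseteq> ?S" "P \<subseteq> ?S" "Z \<subseteq> ?S" "subspace N" "subspace P" "subspace Z" using sp' by auto
  have hv: "h v v \<noteq> 0" using v(2) by auto
  have orth: "h v s = 0" if "s \<in> ?S" for s using that orth_sym v by auto
  have subN: "subspace ?N" using subspace_sums[OF subspace_span NP(4)] .
  have memN: "\<exists>c. \<exists>w\<in>N. u = scale c v + w" if "u \<in> ?N" for u
    using that by (auto simp: span_singleton)
  have memN': "scale c v + w \<in> ?N" if "w \<in> N" for c w
    using that by (auto simp: span_singleton)
  have NS: "?N \<subseteq> S"
  proof
    fix u assume "u \<in> ?N"
    then obtain c w where "w \<in> N" "u = scale c v + w" using memN by blast
    then show "u \<in> S" using NP v by auto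
  qed
  have neg: "Re (h u u) < 0" if u: "u \<in> ?N" "u \<noteq> 0" for u
  proof -
    obtain c w where w: "w \<in> N" "u = scale c v + w" using memN[OF u(1)] by blast
    have wS: "w \<in> S" "h w v = 0" "h v w = 0" using w NP orth by auto
    have "h u u = c * cnj c * h v v + h w w"
      using w wS v by (simp add: add_left add_right scale_left scale_right)
    also have "c * cnj c = of_real ((cmod c)\<^sup>2)" using complex_norm_square[of c] by simp
    finally have eq: "Re (h u u) = (cmod c)\<^sup>2 * Re (h v v) + Re (h w w)" by simp
    have 1: "(cmod c)\<^sup>2 * Re (h v v) \<le> 0" using v(2) by (simp add: mult_le_0_iff)
    have 2: "Re (h w w) \<le> 0"
      using sp' w(1) zero_left[of 0] by (cases "w = 0") (auto simp: less_imp_le)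
    show ?thesis
    proof (cases "c = 0")
      case True
      then have "w \<noteq> 0" using w u by auto
      then show ?thesis using eq sp' w(1) True by auto
    next
      case False
      then have "(cmod c)\<^sup>2 * Re (h v v) < 0" using v(2) by (simp add: mult_less_0_iff)
      then show ?thesis using eq 2 by simp
    qed
  qed
  have dec: "\<exists>n\<in>?N. \<exists>p\<in>P. \<exists>z\<in>Z. s = n + p + z" if s: "s \<in> S" for s
  proof -
    \<comment> \<open>The coefficient of the orthogonal projection of s to the line through v, so
      that \<open>s - scale c v\<close> is orthogonal to v.\<close>
    define c where "c = h s v / h v v"
    have "s - scale c v \<in> ?S" using s v hv by (simp add: diff_left scale_left c_def)
    then obtain n p z where *: "n \<in> N" "p \<in> P" "z \<in> Z" "s - scale c v = n + p + z"
      using H'.splits_sum[OF sp] by blast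
    then have "s = (scale c v + n) + p + z" by (simp add: algebra_simps)
    then show ?thesis using * memN'[of n c] by blast
  qed
  have rad: "h z s = 0" if z: "z \<in> Z" and s: "s \<in> S" for z s
  proof -
    define c where "c = h s v / h v v"
    have m: "s - scale c v \<in> ?S" using s v hv by (simp add: diff_left scale_left c_def)
    have zS: "z \<in> S" "h z v = 0" using NP z by auto
    have "h z (scale c v + (s - scale c v)) = 0"
      using add_right[of "scale c v" "s - scale c v" z] sp' z m zS v s by (simp add: scale_right)
    then show ?thesis by simp
  qed
  have orth2: "h u p = 0" if u: "u \<in> ?N" and p: "p \<in> P" for u p
  proof -
    obtain c w where w: "w \<in> N" "u = scale c v + w" using memN[OF u] by blast
    have "w \<in> S" "p \<in> S" "h v p = 0" "h w p = 0" using NP w p orth sp' by auto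
    then show ?thesis using w v by (simp add: add_left scale_left)
  qed
  have "splits ?N P Z"
    unfolding splits_def
    using subN NP NS neg dec rad orth2 sp' by (intro conjI) (auto simp: subset_iff)
  then show ?thesis by blast
qed

end

text \<open>Changing the sign of the form exchanges N and P. Thus a vector with h v v > 0 is also
  handled by \<open>splits_step\<close>.\<close>

lemma herm_form_splits_uminus:
  assumes "herm_form s S h" "herm_form.splits s S (\<lambda>u v. - h u v) N P Z"
  shows "herm_form.splits s S h P N Z"
proof -
  interpret herm_form s S h by fact
  interpret m: herm_form s S "\<lambda>u v. - h u v" by (rule herm_form_uminus)
  have "h p n = 0" if "p \<in> P" "n \<in> N" for p n
    using assms(2) that orth_sym[of n p] by (auto simp: m.splits_def)
  moreover have "\<exists>n\<in>P. \<exists>p\<in>N. \<exists>z\<in>Z. t = n + p + z" if "t \<in> S" for t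
    using assms(2) that unfolding m.splits_def by (metis add.commute)
  ultimately show ?thesis using assms(2) unfolding m.splits_def splits_def by auto
qed

text \<open>Induction on dim S. A vector with h v v \<noteq> 0 has an orthogonal complement of
  smaller dimension; if there is no such vector, polarisation shows that all of S is
  radical.\<close>

theorem herm_form_splits:
  assumes "herm_form s S h" "complex_space.fin_dim s S"
  shows "\<exists>N P Z. herm_form.splits s S h N P Z"
proof -
  interpret complex_space s using assms(1) by (simp add: herm_form_def)
  show ?thesis
    using assms
  proof (induction "dim S" arbitrary: S h rule: less_induct)
    case (less S h)
    interpret herm_form s S h by (fact less.prems(1))
    show ?case
    proof (cases "\<forall>v\<in>S. h v v = 0")
      case True
      then have "splits {0} {0} S"
        using isotropic_zero unfolding splits_def by (auto simp: subspace_S)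
      then show ?thesis by blast
    next
      case False
      then obtain v where v: "v \<in> S" "h v v \<noteq> 0" by blast
      let ?S = "{w \<in> S. h w v = 0}"
      have sub: "subspace ?S"
        by (rule subspaceI) (auto simp: zero_left v add_left scale_left)
      have "?S \<subset> S" using v by blast
      then have lt: "dim ?S < dim S" by (rule fin_dim_dim_strict_mono[OF less.prems(2) sub])
      have fd: "fin_dim ?S" by (rule fin_dim_subset[OF less.prems(2) sub]) auto
      have hf: "herm_form s ?S h" by (rule herm_form_subspace[OF sub]) auto
      interpret H': herm_form s ?S h by (fact hf)
      obtain N P Z where sp: "H'.splits N P Z" using less.hyps[OF lt hf fd] by blast
      have "Re (h v v) \<noteq> 0" using v diag_real[of v] by (metis of_real_0)
      then consider "Re (h v v) < 0" | "Re (h v v) > 0" by linarith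
      then show ?thesis
      proof cases
        case 1
        then show ?thesis using splits_step[OF v(1) _ sp] by blast
      next
        case 2
        interpret m: herm_form s S "\<lambda>u v. - h u v" by (rule herm_form_uminus)
        have "herm_form.splits s ?S (\<lambda>u v. - h u v) P N Z"
          by (rule herm_form_splits_uminus[OF H'.herm_form_uminus]) (simp add: sp)
        then have "herm_form.splits s {w \<in> S. - h w v = 0} (\<lambda>u v. - h u v) P N Z" by simp
        then obtain P' where "m.splits P' N Z" using m.splits_step[of v P N Z] v 2 by auto
        then show ?thesis using herm_form_splits_uminus[OF less.prems(1)] by blast
      qed
    qed
  qed
qed

context herm_form
begin

lemma splits_nonneg:
  assumes "splits N P Z" "u \<in> {p + z | p z. p \<in> P \<and> z \<in> Z}"
  shows "0 \<le> Re (h u u)"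
proof -
  obtain p z where u: "p \<in> P" "z \<in> Z" "u = p + z" using assms(2) by blast
  have S: "p \<in> S" "z \<in> S" using assms(1) u by (auto simp: splits_def)
  have "h u u = h p p"
    using assms(1) u S orth_sym[of z p] by (auto simp: splits_def add_left add_right)
  then show ?thesis
    using assms(1) u(1) zero_left[of 0] by (cases "p = 0") (auto simp: splits_def less_imp_le)
qed

lemma splits_neg_index:
  assumes "fin_dim S" "splits N P Z"
  shows "neg_index S (\<lambda>u. Re (h u u)) = dim N"
proof (rule neg_index_eqI[OF assms(1)])
  let ?Z = "{p + z | p z. p \<in> P \<and> z \<in> Z}"
  show "subspace N" "N \<subseteq> S" "\<And>u. u \<in> N \<Longrightarrow> u \<noteq> 0 \<Longrightarrow> Re (h u u) < 0"
    using assms(2) by (auto simp: splits_def)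
  show "subspace ?Z" using assms(2) by (intro subspace_sums) (auto simp: splits_def)
  show "?Z \<subseteq> S" using assms(2) by (auto simp: splits_def subset_iff)
  show "0 \<le> Re (h u u)" if "u \<in> ?Z" for u using splits_nonneg[OF assms(2) that] .
  show "\<exists>n\<in>N. \<exists>z\<in>?Z. t = n + z" if t: "t \<in> S" for t
  proof -
    obtain n p z where "n \<in> N" "p \<in> P" "z \<in> Z" "t = n + p + z"
      using splits_sum[OF assms(2) t] by blast
    then show ?thesis by (auto simp: add.assoc intro!: bexI[of _ n])
  qed
qed

text \<open>Sylvester's decomposition with P and Z merged into a nonnegative part Q. This is the
  shape that \<open>neg_index_eqI\<close> consumes and that products inherit factor by
  factor.\<close>

lemma neg_index_decomp:
  assumes "fin_dim S"
  shows "\<exists>N Q. subspace N \<and> N \<subseteq> S \<and> subspace Q \<and> Q \<subseteq> S \<and> (\<forall>t\<in>S. \<exists>n\<in>N. \<exists>z\<in>Q. t = n + z) \<and>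
    (\<forall>u\<in>N. u \<noteq> 0 \<longrightarrow> Re (h u u) < 0) \<and> (\<forall>u\<in>Q. 0 \<le> Re (h u u)) \<and>
    dim N = neg_index S (\<lambda>u. Re (h u u))"
proof -
  obtain N P Z where sp: "splits N P Z" using herm_form_splits[OF herm_form_axioms assms] by blast
  let ?Z = "{p + z | p z. p \<in> P \<and> z \<in> Z}"
  have 1: "subspace ?Z" using sp by (intro subspace_sums) (auto simp: splits_def)
  have 2: "?Z \<subseteq> S" using sp by (auto simp: splits_def subset_iff)
  have 3: "\<exists>n\<in>N. \<exists>z\<in>?Z. t = n + z" if t: "t \<in> S" for t
  proof -
    obtain n p z where "n \<in> N" "p \<in> P" "z \<in> Z" "t = n + p + z"
      using splits_sum[OF sp t] by blast
    then show ?thesis by (auto simp: add.assoc intro!: bexI[of _ n])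
  qed
  show ?thesis
    using 1 2 3 splits_nonneg[OF sp] splits_neg_index[OF assms sp] sp
    by (intro exI[of _ N] exI[of _ ?Z]) (simp add: splits_def)
qed

text \<open>The three summands are the dimensions of N, P and Z in one splitting. For the form of a
  difference of two Hermitian matrices the radical has the dimension of the intersection of their
  graphs, so the dimension terms of the permutation identities originate here.\<close>

theorem neg_index_sum_radical:
  assumes fd: "fin_dim S"
  shows "neg_index S (\<lambda>u. Re (h u u)) + neg_index S (\<lambda>u. - Re (h u u)) +
    dim {z \<in> S. \<forall>t\<in>S. h z t = 0} = dim S"
proof -
  interpret m: herm_form scale S "\<lambda>u v. - h u v" by (rule herm_form_uminus)
  obtain N P Z where sp: "splits N P Z" using herm_form_splits[OF herm_form_axioms fd] by blast
  note dec = splits_sum[OF sp]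
  have msp: "m.splits P N Z"
    by (rule herm_form_splits_uminus[OF herm_form_uminus]) (simp add: sp)
  have sub: "subspace N" "subspace P" "subspace Z" "N \<subseteq> S" "P \<subseteq> S" "Z \<subseteq> S"
    using sp by (auto simp: splits_def)
  note fN = fin_dim_subset[OF fd sub(1,4)] and fP = fin_dim_subset[OF fd sub(2,5)]
    and fZ = fin_dim_subset[OF fd sub(3,6)]
  have zero: "0 \<in> N" "0 \<in> P" "0 \<in> Z" using sub subspace_0 by auto
  have rad: "{z \<in> S. \<forall>t\<in>S. h z t = 0} = Z"
  proof (intro antisym subsetI)
    fix y assume y: "y \<in> {z \<in> S. \<forall>t\<in>S. h z t = 0}"
    then have "y \<in> S" by simp
    then obtain n p z where npz: "n \<in> N" "p \<in> P" "z \<in> Z" "y = n + p + z"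
      using dec by blast
    have S: "n \<in> S" "p \<in> S" "z \<in> S" using npz sub by auto
    have o: "h n p = 0" "h p n = 0" "h z n = 0" "h z p = 0"
      using sp npz orth_sym[of n p] S by (auto simp: splits_def)
    \<comment> \<open>Pairing a radical vector with its own N- and P-components yields h n n = 0 and
      h p p = 0, and definiteness removes both components.\<close>
    have "h y n = 0" "h y p = 0" using y S by auto
    then have "h n n = 0" "h p p = 0" using npz S o by (simp_all add: add_left)
    moreover have "Re (h u u) < 0" if "u \<in> N" "u \<noteq> 0" for u using sp that by (simp add: splits_def)
    moreover have "Re (h u u) > 0" if "u \<in> P" "u \<noteq> 0" for u using sp that by (simp add: splits_def)
    ultimately have "n = 0" "p = 0" using npz(1,2) by fastforce+
    then show "y \<in> Z" using npz by simp
  qed (use sp in \<open>auto simp: splits_def\<close>)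
  have "P \<inter> Z = {0}"
  proof -
    have "x = 0" if "x \<in> P" "x \<in> Z" for x
    proof (rule ccontr)
      assume "x \<noteq> 0"
      then have "Re (h x x) > 0" using sp that(1) by (simp add: splits_def)
      moreover have "h x x = 0" using sp that sub by (auto simp: splits_def)
      ultimately show False by simp
    qed
    then show ?thesis using zero by blast
  qed
  note sumPZ = dim_direct_sum[OF fP fZ this]
  have "N \<inter> {p + z | p z. p \<in> P \<and> z \<in> Z} = {0}"
  proof -
    have "x = 0" if "x \<in> N" "x \<in> {p + z | p z. p \<in> P \<and> z \<in> Z}" for x
    proof (rule ccontr)
      assume "x \<noteq> 0"
      then have "Re (h x x) < 0" using sp that(1) by (auto simp: splits_def)
      then show False using splits_nonneg[OF sp that(2)] by simp
    qed
    moreover have "0 = 0 + (0::'b)" by simp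
    ultimately show ?thesis using zero by blast
  qed
  note sumN = dim_direct_sum[OF fN sumPZ(1) this]
  have "{n + w | n w. n \<in> N \<and> w \<in> {p + z | p z. p \<in> P \<and> z \<in> Z}} = S"
  proof (intro antisym subsetI)
    fix t assume "t \<in> S"
    then obtain n p z where "n \<in> N" "p \<in> P" "z \<in> Z" "t = n + p + z"
      using dec by blast
    then show "t \<in> {n + w | n w. n \<in> N \<and> w \<in> {p + z | p z. p \<in> P \<and> z \<in> Z}}"
      by (auto simp: add.assoc)
  qed (use sub in \<open>auto simp: subset_iff\<close>)
  then have "dim S = dim N + (dim P + dim Z)" using sumN(2) sumPZ(2) by simp
  then show ?thesis using splits_neg_index[OF fd sp] m.splits_neg_index[OF fd msp] rad by simp
qed

text \<open>Gram-Schmidt as an induction over a spanning set. A new vector b is replaced by b', its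
  difference from its projection to the old span; b' = 0 means that b adds nothing.\<close>

lemma orthogonal_projection:
  assumes "\<And>u. u \<in> S \<Longrightarrow> u \<noteq> 0 \<Longrightarrow> h u u \<noteq> 0" "fin_dim U" "U \<subseteq> S" "x \<in> S"
  shows "\<exists>u\<in>U. \<forall>w\<in>U. h (x - u) w = 0"
proof -
  obtain B where B: "finite B" "span B = U" "B \<subseteq> U" using fin_dim_basis[OF assms(2)] by metis
  have BS: "B \<subseteq> S" using B assms(3) by blast
  have spS: "span B \<subseteq> S" if "B \<subseteq> S" for B using that subspace_S by (rule span_minimal)
  have "\<forall>x\<in>S. \<exists>u\<in>span B. \<forall>w\<in>span B. h (x - u) w = 0"
    using B(1) BS
  proof (induction B)
    case empty
    then show ?case by (auto simp: zero_right)
  next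
    case (insert b B)
    then have b: "b \<in> S" and BS: "B \<subseteq> S" by auto
    note IH = insert.IH[OF BS]
    obtain b0 where b0: "b0 \<in> span B" "\<forall>w\<in>span B. h (b - b0) w = 0" using IH b by blast
    define b' where "b' = b - b0"
    have b0S: "b0 \<in> S" using b0(1) spS[OF BS] by blast
    then have b'S: "b' \<in> S" using b by (simp add: b'_def)
    have b'sp: "b' \<in> span (insert b B)"
      unfolding b'_def using b0(1) span_mono[of B "insert b B"]
      by (intro span_diff) (auto intro: span_base)
    show ?case
    proof
      fix x assume x: "x \<in> S"
      obtain u where u: "u \<in> span B" "\<forall>w\<in>span B. h (x - u) w = 0" using IH x by blast
      have uS: "u \<in> S" using u(1) spS[OF BS] by blast
      show "\<exists>u\<in>span (insert b B). \<forall>w\<in>span (insert b B). h (x - u) w = 0"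
      proof (cases "b' = 0")
        case True
        then have "span (insert b B) = span B" using b0 by (simp add: b'_def span_redundant)
        then show ?thesis using u by auto
      next
        case False
        then have nz: "h b' b' \<noteq> 0" using assms(1) b'S by blast
        define c where "c = h x b' / h b' b'"
        have ub': "h u b' = 0" using b0(2) u(1) orth_sym[of b' u] b'S uS by (simp add: b'_def)
        have "h (x - (u + scale c b')) w = 0" if w: "w \<in> span (insert b B)" for w
        proof -
          \<comment> \<open>Each w of the larger span is k b' plus a vector w1 of the old span, so
            orthogonality is tested against b' and w1 separately.\<close>
          obtain k where k: "w - scale k b \<in> span B" using w span_breakdown_eq by blast
          define w1 where "w1 = w - scale k b + scale k b0"
          have w1: "w1 \<in> span B" unfolding w1_def by (intro span_add span_scale k b0(1))
          then have w1S: "w1 \<in> S" using spS[OF BS] by blast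
          have weq: "w = scale k b' + w1" by (simp add: w1_def b'_def scale_right_diff_distrib)
          have "h (x - u) w1 = 0" "h b' w1 = 0" using u w1 b0 by (auto simp: b'_def)
          moreover have "h (x - u) b' = c * h b' b'" using ub' nz x uS b'S by (simp add: diff_left c_def)
          moreover have "h ((x - u) - scale c b') w
              = cnj k * (h (x - u) b' - c * h b' b') + (h (x - u) w1 - c * h b' w1)"
            using x uS b'S w1S unfolding weq
            by (subst diff_left) (auto simp: add_right scale_right scale_left diff_left right_diff_distrib)
          ultimately show ?thesis by (simp add: diff_diff_eq)
        qed
        moreover have "u + scale c b' \<in> span (insert b B)"
          using u(1) span_mono[of B "insert b B"] b'sp by (intro span_add span_scale) auto
        ultimately show ?thesis by blast
      qed
    qed
  qed
  then show ?thesis using B assms(4) by blast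
qed

end

section \<open>The negative index under injections and direct products\<close>

context complex_space_pair
begin

text \<open>The image of a negative definite subspace is negative definite of the same dimension.
  The inequality alone suffices for the diagonal embedding, whose image is a proper subspace in
  general.\<close>

lemma neg_index_le_inj:
  assumes S: "vs1.fin_dim S" and T: "vs2.fin_dim T"
    and f: "lin_on s1 s2 S f" "inj_on f S" "f ` S \<subseteq> T"
    and q: "\<And>u. u \<in> S \<Longrightarrow> r (f u) = q u"
  shows "vs1.neg_index S q \<le> vs2.neg_index T r"
proof -
  obtain U where U: "vs1.subspace U" "U \<subseteq> S" "vs1.dim U = vs1.neg_index S q"
    "\<And>u. u \<in> U \<Longrightarrow> u \<noteq> 0 \<Longrightarrow> q u < 0"
    using vs1.neg_index_attained[OF S] by metis
  have fU: "vs1.fin_dim U" using vs1.fin_dim_subset[OF S U(1,2)] .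
  have lU: "lin_on s1 s2 U f" using lin_on_subset[OF f(1) U(2)] .
  have iU: "inj_on f U" using inj_on_subset[OF f(2) U(2)] .
  have "f (s1 0 0) = s2 0 (f 0)" using lU vs1.subspace_0[OF U(1)] unfolding lin_on_def by blast
  then have f0: "f 0 = 0" by simp
  have "vs2.dim (f ` U) \<le> vs2.neg_index T r"
  proof (rule vs2.neg_index_ge[OF T lin_on_subspace_image[OF U(1) lU]])
    show "f ` U \<subseteq> T" using U(2) f(3) by blast
    fix y assume "y \<in> f ` U" "y \<noteq> 0"
    then obtain u where "u \<in> U" "y = f u" "u \<noteq> 0" using f0 by blast
    then show "r y < 0" using U q by auto
  qed
  then show ?thesis using dim_image_inj[OF fU lU iU] U(3) by simp
qed

text \<open>The previous inequality, applied to f and to its inverse on the image.\<close>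

lemma neg_index_bij:
  assumes S: "vs1.fin_dim S"
    and f: "lin_on s1 s2 S f" "inj_on f S"
    and q: "\<And>u. u \<in> S \<Longrightarrow> r (f u) = q u"
  shows "vs2.neg_index (f ` S) r = vs1.neg_index S q"
proof (rule antisym)
  interpret b: complex_space_pair s2 s1 ..
  have T: "vs2.fin_dim (f ` S)" by (rule fin_dim_image[OF S f(1)])
  show "vs1.neg_index S q \<le> vs2.neg_index (f ` S) r"
    by (rule neg_index_le_inj[OF S T f]) (auto simp: q)
  show "vs2.neg_index (f ` S) r \<le> vs1.neg_index S q"
  proof (rule b.neg_index_le_inj[OF T S, of "inv_into S f"])
    show "lin_on s2 s1 (f ` S) (inv_into S f)"
      by (rule lin_on_inv_into[OF vs1.complex_space_axioms vs1.fin_dim_subspace[OF S] f])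
    show "inj_on (inv_into S f) (f ` S)" by (rule inj_on_inv_into) simp
    show "inv_into S f ` f ` S \<subseteq> S" by (auto intro: inv_into_into)
    show "q (inv_into S f u) = r u" if "u \<in> f ` S" for u
      using q[of "inv_into S f u"] inv_into_into[OF that] f_inv_into_f[OF that] by simp
  qed
qed

text \<open>The product of the negative parts is negative definite, the product of the nonnegative
  parts is nonnegative, and together they span the product.\<close>

lemma neg_index_Times:
  assumes "herm_form s1 S h" "herm_form s2 T g" and fS: "vs1.fin_dim S" and fT: "vs2.fin_dim T"
  shows "complex_space.neg_index (prod_scale s1 s2) (S \<times> T)
      (\<lambda>u. Re (h (fst u) (fst u)) + Re (g (snd u) (snd u)))
    = vs1.neg_index S (\<lambda>u. Re (h u u)) + vs2.neg_index T (\<lambda>u. Re (g u u))"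
proof -
  interpret h: herm_form s1 S h by fact
  interpret g: herm_form s2 T g by fact
  interpret p: complex_space "prod_scale s1 s2" by (rule complex_space_prod)
  obtain N Q where N: "vs1.subspace N" "N \<subseteq> S" "vs1.subspace Q" "Q \<subseteq> S"
    "\<forall>t\<in>S. \<exists>n\<in>N. \<exists>z\<in>Q. t = n + z"
    "\<forall>u\<in>N. u \<noteq> 0 \<longrightarrow> Re (h u u) < 0" "\<forall>u\<in>Q. 0 \<le> Re (h u u)"
    "vs1.dim N = vs1.neg_index S (\<lambda>u. Re (h u u))"
    using h.neg_index_decomp[OF fS] by (elim exE conjE)
  obtain M R where M: "vs2.subspace M" "M \<subseteq> T" "vs2.subspace R" "R \<subseteq> T"
    "\<forall>t\<in>T. \<exists>n\<in>M. \<exists>z\<in>R. t = n + z"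
    "\<forall>u\<in>M. u \<noteq> 0 \<longrightarrow> Re (g u u) < 0" "\<forall>u\<in>R. 0 \<le> Re (g u u)"
    "vs2.dim M = vs2.neg_index T (\<lambda>u. Re (g u u))"
    using g.neg_index_decomp[OF fT] by (elim exE conjE)
  have Nle: "Re (h u u) \<le> 0" if "u \<in> N" for u
    using N(6) that h.zero_left[of 0] by (cases "u = 0") auto
  have Mle: "Re (g u u) \<le> 0" if "u \<in> M" for u
    using M(6) that g.zero_left[of 0] by (cases "u = 0") auto
  have "p.neg_index (S \<times> T) (\<lambda>u. Re (h (fst u) (fst u)) + Re (g (snd u) (snd u))) = p.dim (N \<times> M)"
  proof (rule p.neg_index_eqI)
    show "p.fin_dim (S \<times> T)" by (rule fin_dim_dim_Times[OF fS fT])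
    show "p.subspace (N \<times> M)" by (rule subspace_Times[OF N(1) M(1)])
    show "p.subspace (Q \<times> R)" by (rule subspace_Times[OF N(3) M(3)])
    show "N \<times> M \<subseteq> S \<times> T" "Q \<times> R \<subseteq> S \<times> T" using N M by auto
    show "\<exists>n\<in>N \<times> M. \<exists>z\<in>Q \<times> R. t = n + z" if "t \<in> S \<times> T" for t
    proof -
      obtain x y where t: "t = (x, y)" "x \<in> S" "y \<in> T" using \<open>t \<in> S \<times> T\<close> by auto
      obtain n z where "n \<in> N" "z \<in> Q" "x = n + z" using N(5) t(2) by blast
      moreover obtain m w where "m \<in> M" "w \<in> R" "y = m + w" using M(5) t(3) by blast
      ultimately show ?thesis using t by (intro bexI[of _ "(n, m)"] bexI[of _ "(z, w)"]) auto
    qed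
    show "Re (h (fst u) (fst u)) + Re (g (snd u) (snd u)) < 0" if "u \<in> N \<times> M" "u \<noteq> 0" for u
    proof -
      obtain x y where u: "u = (x, y)" "x \<in> N" "y \<in> M" using \<open>u \<in> N \<times> M\<close> by auto
      then have "x \<noteq> 0 \<or> y \<noteq> 0" using that by (auto simp: zero_prod_def)
      then show ?thesis using u N(6) M(6) Nle[OF u(2)] Mle[OF u(3)] by auto
    qed
    show "0 \<le> Re (h (fst u) (fst u)) + Re (g (snd u) (snd u))" if "u \<in> Q \<times> R" for u
      using that N(7) M(7) by auto
  qed
  then show ?thesis
    using fin_dim_dim_Times(2)[OF vs1.fin_dim_subset[OF fS N(1,2)] vs2.fin_dim_subset[OF fT M(1,2)]] N(8) M(8)
    by simp
qed

end

text \<open>The diagonal embedding of \<open>S\<close> into \<open>S \<times> S\<close> reduces this to direct sums.\<close>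

lemma neg_index_subadd:
  assumes "herm_form s S h" "herm_form s S g" and fS: "complex_space.fin_dim s S"
  shows "complex_space.neg_index s S (\<lambda>u. Re (h u u) + Re (g u u))
    \<le> complex_space.neg_index s S (\<lambda>u. Re (h u u)) + complex_space.neg_index s S (\<lambda>u. Re (g u u))"
proof -
  interpret herm_form s S h by fact
  interpret ss: complex_space_pair s s ..
  interpret p: complex_space "prod_scale s s" by (rule ss.complex_space_prod)
  interpret sp: complex_space_pair s "prod_scale s s" ..
  have "neg_index S (\<lambda>u. Re (h u u) + Re (g u u))
    \<le> p.neg_index (S \<times> S) (\<lambda>u. Re (h (fst u) (fst u)) + Re (g (snd u) (snd u)))"
    by (rule sp.neg_index_le_inj[OF fS ss.fin_dim_dim_Times(1)[OF fS fS], of "\<lambda>u. (u, u)"])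
      (auto simp: lin_on_def inj_on_def)
  then show ?thesis using ss.neg_index_Times[OF assms(1,2) fS fS] by simp
qed

section \<open>The space of complex vectors and the spectral theorem\<close>

context complex_space
begin

lemma lin_on_sum:
  assumes "subspace S" "lin_on scale scale S T" "finite I" "\<And>i. i \<in> I \<Longrightarrow> v i \<in> S"
  shows "T (\<Sum>i\<in>I. scale (c i) (v i)) = (\<Sum>i\<in>I. scale (c i) (T (v i)))"
  using assms(3,4)
proof (induction I)
  case empty
  have "T (scale 0 0) = scale 0 (T 0)"
    using assms(2) subspace_0[OF assms(1)] unfolding lin_on_def by blast
  then show ?case by simp
next
  case (insert j I)
  have "(\<Sum>i\<in>I. scale (c i) (v i)) \<in> S" "scale (c j) (v j) \<in> S"
    using insert.prems assms(1) by (auto intro!: subspace_sum subspace_scale)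
  then show ?case using insert assms(2) by (simp add: lin_on_def)
qed

text \<open>The argument without determinants. If T has no eigenvector in S, then every T - r is
  injective there, and factoring a nonzero polynomial p into linear factors gives p(T) x \<noteq> 0
  for all nonzero x. But x, T x, T (T x), ... are linearly dependent, which is a nonzero p with p(T)
  x = 0.\<close>

lemma eigenvector_exists:
  assumes S: "fin_dim S" "S \<noteq> {0}" and T: "lin_on scale scale S T" "T ` S \<subseteq> S"
  shows "\<exists>x\<in>S. \<exists>c. x \<noteq> 0 \<and> T x = scale c x"
proof (rule ccontr)
  assume no: "\<not> ?thesis"
  have sub: "subspace S" using S(1) by (rule fin_dim_subspace)
  have pow: "(T ^^ i) x \<in> S" if "x \<in> S" for x i
    using that T(2) by (induction i) auto
  \<comment> \<open>\<open>ev p x\<close> is p(T) x.\<close>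
  define ev where "ev p x = (\<Sum>i\<le>degree p. scale (coeff p i) ((T ^^ i) x))" for p :: "complex poly" and x
  have ev_bound: "ev p x = (\<Sum>i\<le>m. scale (coeff p i) ((T ^^ i) x))" if "degree p \<le> m" for p x m
    unfolding ev_def using that by (intro sum.mono_neutral_left) (auto simp: coeff_eq_0)
  have evS: "ev p x \<in> S" if "x \<in> S" for p x
    unfolding ev_def using pow[OF that] sub by (intro subspace_sum subspace_scale)
  have ev_root: "ev ([:- r, 1:] * q) x = T (ev q x) - scale r (ev q x)" if x: "x \<in> S" for r q x
  proof -
    let ?m = "Suc (degree q)"
    have eq: "[:- r, 1:] * q = pCons 0 q - smult r q" by simp
    have "degree ([:- r, 1:] * q) \<le> ?m"
      unfolding eq by (intro degree_diff_le degree_pCons_le order_trans[OF degree_smult_le]) auto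
    then have "ev ([:- r, 1:] * q) x = (\<Sum>i\<le>?m. scale (coeff ([:- r, 1:] * q) i) ((T ^^ i) x))"
      by (rule ev_bound)
    also have "\<dots> = (\<Sum>i\<le>?m. scale (coeff (pCons 0 q) i) ((T ^^ i) x))
        - (\<Sum>i\<le>?m. scale r (scale (coeff q i) ((T ^^ i) x)))"
      unfolding eq by (simp add: scale_left_diff_distrib sum_subtractf del: sum.atMost_Suc)
    \<comment> \<open>Multiplication by the variable shifts the coefficients by one, which amounts
      to one more application of T. The bound \<open>Suc (degree q)\<close> makes room for the
      shifted leading coefficient.\<close>
    also have "(\<Sum>i\<le>?m. scale (coeff (pCons 0 q) i) ((T ^^ i) x))
        = (\<Sum>i\<le>degree q. scale (coeff q i) (T ((T ^^ i) x)))"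
      by (subst sum.atMost_Suc_shift) (simp add: coeff_pCons)
    also have "\<dots> = T (ev q x)"
      unfolding ev_def using lin_on_sum[OF sub T(1), of "{..degree q}" "\<lambda>i. (T ^^ i) x" "coeff q"] pow[OF x]
      by simp
    also have "(\<Sum>i\<le>?m. scale r (scale (coeff q i) ((T ^^ i) x))) = scale r (ev q x)"
      using ev_bound[of q ?m x] by (simp add: scale_sum_right del: sum.atMost_Suc)
    finally show ?thesis .
  qed
  \<comment> \<open>One root is split off at a time: if (T - r) annihilated the nonzero vector q(T)
    x, that vector would be an eigenvector for r.\<close>
  have inj: "ev p x \<noteq> 0" if "p \<noteq> 0" "x \<in> S" "x \<noteq> 0" for p x
    using that(1)
  proof (induction "degree p" arbitrary: p)
    case 0
    then obtain a where "p = [:a:]" "a \<noteq> 0" by (metis degree_eq_zeroE pCons_0_0)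
    then show ?case using that(3) by (simp add: ev_def)
  next
    case (Suc d)
    have "\<not> constant (poly p)" using constant_degree[of p] Suc.hyps(2) by simp
    then obtain r where "poly p r = 0" using fundamental_theorem_of_algebra by blast
    then obtain q where q: "p = [:- r, 1:] * q" by (metis poly_eq_0_iff_dvd dvdE)
    then have q0: "q \<noteq> 0" using Suc.prems by auto
    have "degree p = Suc (degree q)" unfolding q using q0 by (subst degree_mult_eq) auto
    then have "d = degree q" using Suc.hyps(2) by simp
    then have "ev q x \<noteq> 0" using Suc.hyps(1) q0 by blast
    moreover have "ev q x \<in> S" using evS that by blast
    ultimately have "T (ev q x) \<noteq> scale r (ev q x)" using no by blast
    then show ?case unfolding q using ev_root[OF that(2)] by simp
  qed
  obtain x where x: "x \<in> S" "x \<noteq> 0" using S(2) subspace_0[OF sub] by blast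
  obtain c where c: "\<exists>i\<le>dim S. c i \<noteq> 0" "(\<Sum>i\<le>dim S. scale (c i) ((T ^^ i) x)) = 0"
    using linear_dependence[OF S(1), of "\<lambda>i. (T ^^ i) x"] pow[OF x(1)] by blast
  define p where "p = (\<Sum>i\<le>dim S. monom (c i) i)"
  have cp: "coeff p i = (if i \<le> dim S then c i else 0)" for i
    unfolding p_def by (simp add: coeff_sum)
  have "p \<noteq> 0"
  proof
    assume "p = 0"
    then have "coeff p i = 0" for i by simp
    then show False using c(1) cp by (metis (full_types))
  qed
  moreover have "degree p \<le> dim S" by (rule degree_le) (simp add: cp)
  then have "ev p x = (\<Sum>i\<le>dim S. scale (coeff p i) ((T ^^ i) x))" by (rule ev_bound)
  then have "ev p x = 0" using c(2) by (simp add: cp)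
  ultimately show False using inj x by blast
qed

end

section \<open>The model space of complex vectors and Hermitian matrices on it\<close>

lemma complex_space_vscale: "complex_space vscale"
  by unfold_locales (auto simp: vscale_def algebra_simps)

interpretation cv: complex_space vscale by (rule complex_space_vscale)
interpretation cvcv: complex_space_pair vscale vscale ..

lemma pscale_eq_prod_scale: "pscale = prod_scale vscale vscale"
  by (auto simp: pscale_def prod_scale_def fun_eq_iff)

lemma complex_space_pscale: "complex_space pscale"
  unfolding pscale_eq_prod_scale by (rule cvcv.complex_space_prod)

interpretation pv: complex_space pscale by (rule complex_space_pscale)

lemma Cn_closed [simp]:
  "0 \<in> Cn n" "x \<in> Cn n \<Longrightarrow> y \<in> Cn n \<Longrightarrow> x + y \<in> Cn n" "x \<in> Cn n \<Longrightarrow> vscale c x \<in> Cn n"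
  "x \<in> Cn n \<Longrightarrow> y \<in> Cn n \<Longrightarrow> x - y \<in> Cn n" "x \<in> Cn n \<Longrightarrow> - x \<in> Cn n"
  by (auto simp: Cn_def vscale_def)

lemma subspace_Cn: "cv.subspace (Cn n)"
  by (rule cv.subspaceI) auto

lemma fin_dim_dim_Cn: "cv.fin_dim (Cn n) \<and> cv.dim (Cn n) = n"
proof (induction n)
  case 0
  have "Cn 0 = {0}" by (auto simp: Cn_def fun_eq_iff)
  then show ?case by (simp add: cv.fin_dim_zero cv.dim_zero_space)
next
  case (Suc n)
  define e :: cvec where "e = (\<lambda>i. if i = n then 1 else 0)"
  have e0: "e \<noteq> 0" by (auto simp: e_def fun_eq_iff)
  have ce: "vscale c e = (\<lambda>i. if i = n then c else 0)" for c by (auto simp: vscale_def e_def)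
  have 1: "Cn n \<inter> cv.span {e} = {0}"
  proof -
    have "x = 0" if "x \<in> Cn n" "x \<in> cv.span {e}" for x
    proof -
      obtain c where "x = vscale c e" using \<open>x \<in> cv.span {e}\<close> by (auto simp: cv.span_singleton)
      then show ?thesis using that(1) by (auto simp: ce Cn_def fun_eq_iff)
    qed
    then show ?thesis using cv.span_zero by auto
  qed
  have 2: "{u + w | u w. u \<in> Cn n \<and> w \<in> cv.span {e}} = Cn (Suc n)"
  proof (intro antisym subsetI)
    fix x assume x: "x \<in> Cn (Suc n)"
    have "x = (\<lambda>i. if i = n then 0 else x i) + vscale (x n) e" by (auto simp: ce fun_eq_iff)
    moreover have "(\<lambda>i. if i = n then 0 else x i) \<in> Cn n"
      using x by (auto simp: Cn_def)
    moreover have "vscale (x n) e \<in> cv.span {e}" by (intro cv.span_scale cv.span_base) auto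
    ultimately show "x \<in> {u + w | u w. u \<in> Cn n \<and> w \<in> cv.span {e}}" by blast
  next
    fix x assume "x \<in> {u + w | u w. u \<in> Cn n \<and> w \<in> cv.span {e}}"
    then show "x \<in> Cn (Suc n)" by (auto simp: cv.span_singleton ce Cn_def)
  qed
  have "cv.fin_dim (cv.span {e})" by (rule cv.fin_dim_span) simp
  then show ?case
    using cv.dim_direct_sum[of "Cn n" "cv.span {e}"] Suc 1 cv.dim_span_singleton[OF e0] unfolding 2 by simp
qed

lemmas fin_dim_Cn = fin_dim_dim_Cn[THEN conjunct1] and dim_Cn = fin_dim_dim_Cn[THEN conjunct2]

text \<open>Sesquilinearity holds on the whole type, which keeps membership conditions out of
  calculations. Definiteness holds only on \<open>Cn n\<close>, since \<open>hinner n\<close>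
  ignores the coordinates from n on.\<close>

interpretation hi: herm_form vscale UNIV "hinner n" for n
  by unfold_locales
    (auto simp: hinner_def vscale_def algebra_simps sum.distrib sum_distrib_left mult.commute)

lemma hinner_self: "hinner n x x = of_real (\<Sum>i<n. (cmod (x i))\<^sup>2)"
  by (simp add: hinner_def complex_norm_square[symmetric] del: of_real_power)

lemma hinner_self_pos:
  assumes "x \<in> Cn n" "x \<noteq> 0"
  shows "0 < Re (hinner n x x)"
proof -
  obtain i where i: "x i \<noteq> 0" using assms(2) by (auto simp: fun_eq_iff)
  then have "i < n" using assms(1) by (auto simp: Cn_def not_le)
  then have "0 < (\<Sum>i<n. (cmod (x i))\<^sup>2)" using i by (intro sum_pos2[of _ i]) auto
  then show ?thesis by (simp add: hinner_self)
qed

lemma hinner_self_eq_0: "x \<in> Cn n \<Longrightarrow> hinner n x x = 0 \<longleftrightarrow> x = 0"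
  using hinner_self_pos[of x n] hi.zero_left[of 0 n] by fastforce

lemma hinner_diff_right: "hinner n x (y - z) = hinner n x y - hinner n x z"
  by (simp add: hinner_def right_diff_distrib sum_subtractf)

lemma hinner_minus_left: "hinner n (- x) y = - hinner n x y"
  by (simp add: hinner_def sum_negf)

lemma hinner_minus_right: "hinner n x (- y) = - hinner n x y"
  by (simp add: hinner_def sum_negf)

lemmas hinner_bilin = hi.add_left[OF UNIV_I UNIV_I UNIV_I] hi.add_right[OF UNIV_I UNIV_I UNIV_I]
  hi.diff_left[OF UNIV_I UNIV_I UNIV_I] hinner_diff_right hi.scale_left[OF UNIV_I UNIV_I]
  hi.scale_right[OF UNIV_I UNIV_I] hi.zero_left[OF UNIV_I] hi.zero_right[OF UNIV_I]
  hinner_minus_left hinner_minus_right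

lemma hinner_cnj: "hinner n y x = cnj (hinner n x y)"
  using hi.herm[of x y n] by simp

lemma Re_hinner_commute: "Re (hinner n y x) = Re (hinner n x y)"
  by (subst hinner_cnj) simp

lemma Cn_orthogonal_projection:
  assumes "cv.subspace U" "U \<subseteq> Cn n" "x \<in> Cn n"
  shows "\<exists>u\<in>U. \<forall>w\<in>U. hinner n (x - u) w = 0"
proof -
  interpret c: herm_form vscale "Cn n" "hinner n"
    by (rule hi.herm_form_subspace[OF subspace_Cn]) simp
  show ?thesis
    by (rule c.orthogonal_projection)
      (use assms in \<open>auto simp: hinner_self_eq_0 cv.fin_dim_subset[OF fin_dim_Cn]\<close>)
qed

lemma mat_vec_Cn [simp]: "mat_vec n A x \<in> Cn n"
  by (simp add: mat_vec_def Cn_def)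

lemma mat_vec_linear [simp]:
  "mat_vec n A (x + y) = mat_vec n A x + mat_vec n A y"
  "mat_vec n A (x - y) = mat_vec n A x - mat_vec n A y"
  "mat_vec n A (vscale c x) = vscale c (mat_vec n A x)"
  "mat_vec n A 0 = 0"
  by (auto simp: mat_vec_def vscale_def fun_eq_iff algebra_simps sum.distrib sum_subtractf sum_distrib_left)

lemma mat_vec_matrix [simp]:
  "mat_vec n (A + B) x = mat_vec n A x + mat_vec n B x"
  "mat_vec n (A - B) x = mat_vec n A x - mat_vec n B x"
  "mat_vec n (- A) x = - mat_vec n A x"
  "mat_vec n 0 x = 0"
  by (auto simp: mat_vec_def fun_eq_iff algebra_simps sum.distrib sum_subtractf sum_negf)

lemma hermitian_closed [simp]:
  "hermitian n A \<Longrightarrow> hermitian n B \<Longrightarrow> hermitian n (A + B)"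
  "hermitian n A \<Longrightarrow> hermitian n B \<Longrightarrow> hermitian n (A - B)"
  "hermitian n A \<Longrightarrow> hermitian n (- A)"
  "hermitian n 0"
  unfolding hermitian_def plus_fun_apply fun_diff_def uminus_apply zero_fun_apply
  by (metis complex_cnj_add, metis complex_cnj_diff, metis complex_cnj_minus, metis complex_cnj_zero)

lemma hermitian_hinner:
  assumes "hermitian n A"
  shows "hinner n (mat_vec n A x) y = hinner n x (mat_vec n A y)"
proof -
  have "hinner n (mat_vec n A x) y = (\<Sum>i<n. \<Sum>j<n. A i j * x j * cnj (y i))"
    by (simp add: hinner_def mat_vec_def sum_distrib_right)
  also have "\<dots> = (\<Sum>j<n. \<Sum>i<n. A i j * x j * cnj (y i))" by (rule sum.swap)
  also have "\<dots> = (\<Sum>j<n. \<Sum>i<n. x j * cnj (A j i * y i))"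
  proof (intro sum.cong refl)
    fix i j assume "i \<in> {..<n}" "j \<in> {..<n}"
    then have "A i j = cnj (A j i)" using assms unfolding hermitian_def by blast
    then show "A i j * x j * cnj (y i) = x j * cnj (A j i * y i)" by simp
  qed
  also have "\<dots> = hinner n x (mat_vec n A y)"
    by (simp add: hinner_def mat_vec_def sum_distrib_left)
  finally show ?thesis .
qed

lemma herm_form_mat:
  assumes "hermitian n A"
  shows "herm_form vscale (Cn n) (\<lambda>x y. hinner n (mat_vec n A x) y)"
proof unfold_locales
  show "hinner n (mat_vec n A v) u = cnj (hinner n (mat_vec n A u) v)" for u v
    using hermitian_hinner[OF assms, of v u] hinner_cnj[of n v "mat_vec n A u"] by simp
qed (auto simp: hinner_bilin subspace_Cn)

definition mat_neg_index :: "nat \<Rightarrow> (nat \<Rightarrow> nat \<Rightarrow> complex) \<Rightarrow> nat" where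
  "mat_neg_index n A = cv.neg_index (Cn n) (\<lambda>x. Re (hinner n (mat_vec n A x) x))"

text \<open>The radical of the form of A is the kernel of A, because A z lies in \<open>Cn n\<close>
  and may be paired with itself.\<close>

lemma mat_neg_index_sum_kernel:
  assumes "hermitian n A"
  shows "mat_neg_index n A + mat_neg_index n (- A) + cv.dim {x \<in> Cn n. mat_vec n A x = 0} = n"
proof -
  interpret herm_form vscale "Cn n" "\<lambda>x y. hinner n (mat_vec n A x) y" by (rule herm_form_mat[OF assms])
  have "{z \<in> Cn n. \<forall>t\<in>Cn n. hinner n (mat_vec n A z) t = 0} = {x \<in> Cn n. mat_vec n A x = 0}"
    using hinner_self_eq_0[OF mat_vec_Cn] by (fastforce simp: hinner_bilin)
  then show ?thesis
    using neg_index_sum_radical[OF fin_dim_Cn] by (simp add: mat_neg_index_def dim_Cn hinner_bilin)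
qed

lemma mat_neg_index_subadd:
  assumes "hermitian n A" "hermitian n B"
  shows "mat_neg_index n (A + B) \<le> mat_neg_index n A + mat_neg_index n B"
  using neg_index_subadd[OF herm_form_mat[OF assms(1)] herm_form_mat[OF assms(2)] fin_dim_Cn]
  by (simp add: mat_neg_index_def hinner_bilin)

lemma mat_neg_index_zero: "mat_neg_index n 0 = 0"
proof -
  have "{x \<in> Cn n. mat_vec n 0 x = 0} = Cn n" by auto
  then show ?thesis using mat_neg_index_sum_kernel[of n 0] by (simp add: dim_Cn)
qed

section \<open>Eigenspace decomposition of a Hermitian matrix\<close>

context
  fixes n :: nat and A :: "nat \<Rightarrow> nat \<Rightarrow> complex"
  assumes A: "hermitian n A"
begin

abbreviation "eig l \<equiv> eigenspace n A (complex_of_real l)"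
abbreviation "eig_sum F \<equiv> cv.span (\<Union>l\<in>F. eig l)"

lemma subspace_eig: "cv.subspace (eig l)"
  by (rule cv.subspaceI) (auto simp: eigenspace_def cv.scale_right_distrib cv.scale_left_commute)

lemma eig_Cn: "eig l \<subseteq> Cn n"
  by (auto simp: eigenspace_def)

lemma eig_sum_Cn: "eig_sum F \<subseteq> Cn n"
  by (rule cv.span_minimal[OF _ subspace_Cn]) (use eig_Cn in auto)

lemma eig_sum_mat_vec:
  assumes "x \<in> eig_sum F"
  shows "mat_vec n A x \<in> eig_sum F"
  using assms
proof (induct rule: cv.span_induct_alt)
  case base
  have "mat_vec n A 0 \<in> eig_sum F" using cv.span_zero by simp
  then show ?case .
next
  case (step c x y)
  then obtain l where l: "l \<in> F" "x \<in> eig l" by blast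
  then have "x \<in> eig_sum F" by (intro cv.span_base) auto
  moreover have "mat_vec n A x = vscale (complex_of_real l) x" using l by (simp add: eigenspace_def)
  ultimately have "mat_vec n A (vscale c x + y) \<in> eig_sum F"
    using step(2) by (auto intro!: cv.span_add cv.span_scale)
  then show ?case .
qed

text \<open>For eigenvectors x, y with real eigenvalues l, m, self-adjointness gives l <x, y> = m
  <x, y>; the span follows by linearity.\<close>

lemma eig_sum_orth:
  assumes "x \<in> eig_sum F" "m \<notin> F" "y \<in> eig m"
  shows "hinner n x y = 0"
  using assms(1)
proof (induct rule: cv.span_induct_alt)
  case base
  show ?case by (rule hi.zero_left) simp
next
  case (step c x z)
  then obtain l where l: "l \<in> F" "x \<in> eig l" by blast
  then have "mat_vec n A x = vscale (complex_of_real l) x" "mat_vec n A y = vscale (complex_of_real m) y"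
    using assms(3) by (auto simp: eigenspace_def)
  then have "complex_of_real l * hinner n x y = complex_of_real m * hinner n x y"
    using hermitian_hinner[OF A, of x y] by (simp add: hinner_bilin)
  then have "hinner n x y = 0" using l(1) assms(2) by auto
  moreover have "hinner n z y = 0" by (fact step(2))
  ultimately have "hinner n (vscale c x + z) y = 0" by (simp add: hinner_bilin)
  then show ?case .
qed

lemma eig_sum_insert: "eig_sum (insert m F) = {u + w | u w. u \<in> eig_sum F \<and> w \<in> eig m}"
proof -
  have E: "cv.span (eig m) = eig m" using subspace_eig[of m] cv.span_eq_iff by blast
  have "(\<Union>l\<in>insert m F. eig l) = (\<Union>l\<in>F. eig l) \<union> eig m" by auto
  then show ?thesis by (simp only: cv.span_Un E)
qed

lemma dim_eig_sum:
  assumes "finite F"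
  shows "cv.dim (eig_sum F) = (\<Sum>l\<in>F. cv.dim (eig l))"
  using assms
proof (induction F)
  case empty
  then show ?case using cv.dim_zero_space by simp
next
  case (insert m F)
  have f: "cv.fin_dim (eig_sum F)" "cv.fin_dim (eig m)"
    by (rule cv.fin_dim_subset[OF fin_dim_Cn cv.subspace_span eig_sum_Cn],
        rule cv.fin_dim_subset[OF fin_dim_Cn subspace_eig eig_Cn])
  have "x = 0" if x: "x \<in> eig_sum F" "x \<in> eig m" for x
    using eig_sum_orth[OF x(1) insert.hyps(2) x(2)] hinner_self_eq_0[of x n] eig_sum_Cn x by blast
  then have "eig_sum F \<inter> eig m = {0}" using cv.span_zero cv.subspace_0[OF subspace_eig] by auto
  then show ?case using cv.dim_direct_sum(2)[OF f] insert eig_sum_insert[of m F] by simp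
qed

text \<open>The mixed terms vanish because \<open>eig_sum F\<close> is invariant under A and
  orthogonal to the new eigenspace. This is the step by which the sign of the form is carried
  through an induction over the eigenvalues.\<close>

lemma eig_sum_insert_form:
  assumes "m \<notin> F" "u \<in> eig_sum F" "w \<in> eig m"
  shows "Re (hinner n (mat_vec n A (u + w)) (u + w))
    = Re (hinner n (mat_vec n A u) u) + m * Re (hinner n w w)"
proof -
  have "hinner n (mat_vec n A u) w = 0" "hinner n u w = 0"
    using eig_sum_orth[OF _ assms(1,3)] eig_sum_mat_vec assms(2) by auto
  moreover have "hinner n w u = 0" using calculation hinner_cnj[of n w u] by simp
  moreover have "mat_vec n A w = vscale (complex_of_real m) w" using assms by (simp add: eigenspace_def)
  ultimately show ?thesis by (simp add: hinner_bilin)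
qed

lemma eig_sum_neg:
  assumes "finite F" "\<forall>l\<in>F. l < 0"
  shows "\<forall>x\<in>eig_sum F. x \<noteq> 0 \<longrightarrow> Re (hinner n (mat_vec n A x) x) < 0"
  using assms
proof (induction F)
  case empty
  then show ?case by simp
next
  case (insert m F)
  have m: "m < 0" using insert.prems by simp
  have "\<forall>u\<in>eig_sum F. u \<noteq> 0 \<longrightarrow> Re (hinner n (mat_vec n A u) u) < 0"
    by (rule insert.IH) (use insert.prems in simp)
  then have IH: "Re (hinner n (mat_vec n A u) u) < 0" if "u \<in> eig_sum F" "u \<noteq> 0" for u
    using that by blast
  show ?case
  proof (intro ballI impI)
    fix x assume x: "x \<in> eig_sum (insert m F)" "x \<noteq> 0"
    then obtain u w where uw: "u \<in> eig_sum F" "w \<in> eig m" "x = u + w" unfolding eig_sum_insert by blast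
    note eq = eig_sum_insert_form[OF insert.hyps(2) uw(1,2)]
    have wC: "w \<in> Cn n" using uw eig_Cn by blast
    show "Re (hinner n (mat_vec n A x) x) < 0"
    proof (cases "w = 0")
      case True
      then show ?thesis using IH[OF uw(1)] uw x by simp
    next
      case False
      then have "m * Re (hinner n w w) < 0"
        using hinner_self_pos[OF wC] m by (simp add: mult_neg_pos)
      moreover have "Re (hinner n (mat_vec n A u) u) \<le> 0"
        using IH[OF uw(1)] by (cases "u = 0") (auto simp: hinner_bilin less_imp_le)
      ultimately show ?thesis using eq uw by simp
    qed
  qed
qed

lemma eig_sum_nonneg:
  assumes "finite F" "\<forall>l\<in>F. 0 \<le> l"
  shows "\<forall>x\<in>eig_sum F. 0 \<le> Re (hinner n (mat_vec n A x) x)"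
  using assms
proof (induction F)
  case empty
  have "\<forall>x\<in>eig_sum {}. 0 \<le> Re (hinner n (mat_vec n A x) x)" by (simp add: hinner_bilin)
  then show ?case .
next
  case (insert m F)
  show ?case
  proof
    fix x assume x: "x \<in> eig_sum (insert m F)"
    then obtain u w where uw: "u \<in> eig_sum F" "w \<in> eig m" "x = u + w" unfolding eig_sum_insert by blast
    note eq = eig_sum_insert_form[OF insert.hyps(2) uw(1,2)]
    have "0 \<le> m * Re (hinner n w w)" using insert.prems by (simp add: hinner_self sum_nonneg)
    moreover have "0 \<le> Re (hinner n (mat_vec n A u) u)" using insert uw(1) by auto
    ultimately show "0 \<le> Re (hinner n (mat_vec n A x) x)" using eq uw by simp
  qed
qed

text \<open>Each eigenvalue contributes at least 1 to the dimension of a sum of eigenspaces inside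
  \<open>Cn n\<close>, so there are at most n of them.\<close>

lemma finite_spectrum: "finite {l. eig l \<noteq> {0}}"
proof (rule conjunct1, rule finite_if_finite_subsets_card_bdd)
  fix F assume F: "F \<subseteq> {l. eig l \<noteq> {0}}" "finite F"
  have "(\<Sum>l\<in>F. 1) \<le> (\<Sum>l\<in>F. cv.dim (eig l))"
  proof (rule sum_mono)
    fix l assume "l \<in> F"
    then have "eig l \<noteq> {0}" using F by blast
    then have "cv.dim (eig l) \<noteq> 0"
      using cv.fin_dim_dim_0 cv.fin_dim_subset[OF fin_dim_Cn subspace_eig eig_Cn] by blast
    then show "1 \<le> cv.dim (eig l)" by simp
  qed
  also have "\<dots> = cv.dim (eig_sum F)" using dim_eig_sum F by simp
  also have "\<dots> \<le> n" using cv.fin_dim_dim_mono[OF fin_dim_Cn _ eig_sum_Cn] by (simp add: dim_Cn)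
  finally show "card F \<le> n" by simp
qed

text \<open>The orthogonal complement of the sum of eigenspaces is invariant under A. If nonzero, it
  would contain an eigenvector, which belongs to the sum and is thus orthogonal to itself.\<close>

lemma eig_sum_spectrum: "eig_sum {l. eig l \<noteq> {0}} = Cn n"
proof (intro antisym eig_sum_Cn subsetI)
  let ?eig_sum = "eig_sum {l. eig l \<noteq> {0}}"
  fix x assume x: "x \<in> Cn n"
  obtain u where u: "u \<in> ?eig_sum" "\<forall>w\<in>?eig_sum. hinner n (x - u) w = 0"
    using Cn_orthogonal_projection[OF cv.subspace_span eig_sum_Cn x] by blast
  let ?S = "{y \<in> Cn n. \<forall>w\<in>?eig_sum. hinner n y w = 0}"
  have sub: "cv.subspace ?S" by (rule cv.subspaceI) (auto simp: hinner_bilin)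
  have fd: "cv.fin_dim ?S" by (rule cv.fin_dim_subset[OF fin_dim_Cn sub]) auto
  have "?S = {0}"
  proof (rule ccontr)
    assume "?S \<noteq> {0}"
    moreover have "lin_on vscale vscale ?S (mat_vec n A)" by (auto simp: lin_on_def)
    moreover have "mat_vec n A ` ?S \<subseteq> ?S" using eig_sum_mat_vec by (auto simp: hermitian_hinner[OF A])
    ultimately have "\<exists>y\<in>?S. \<exists>c. y \<noteq> 0 \<and> mat_vec n A y = vscale c y"
      by (rule cv.eigenvector_exists[OF fd])
    then obtain y c where y: "y \<in> ?S" "y \<noteq> 0" "mat_vec n A y = vscale c y" by (elim bexE exE conjE)
    have yy: "hinner n y y \<noteq> 0" using y hinner_self_eq_0[of y n] by simp
    \<comment> \<open>Only real eigenvalues are collected in the sum, so the eigenvalue c has to be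
      shown real.\<close>
    have "c * hinner n y y = cnj c * hinner n y y"
      using hermitian_hinner[OF A, of y y] y(3) by (simp add: hinner_bilin)
    then have "c = complex_of_real (Re c)" using yy by (metis Reals_cnj_iff mult_right_cancel of_real_Re)
    then have "y \<in> eig (Re c)" using y by (simp add: eigenspace_def)
    then have "y \<in> ?eig_sum" using y(2) by (intro cv.span_base) auto
    then show False using y(1) yy by blast
  qed
  moreover have "u \<in> Cn n" using u(1) eig_sum_Cn by blast
  then have "x - u \<in> ?S" using u(2) x by simp
  ultimately show "x \<in> ?eig_sum" using u by auto
qed

text \<open>The eigenspaces of negative eigenvalues span a negative definite subspace and the
  remaining ones a nonnegative complement, so \<open>neg_index_eqI\<close> applies.\<close>

theorem n_minus_eq_mat_neg_index: "n_minus n A = mat_neg_index n A"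
proof -
  let ?F = "{l. eig l \<noteq> {0}}"
  let ?N = "{l. l < 0 \<and> eig l \<noteq> {0}}" and ?P = "{l. 0 \<le> l \<and> eig l \<noteq> {0}}"
  have fin: "finite ?N" "finite ?P" using finite_spectrum by (auto elim: rev_finite_subset)
  have "mat_neg_index n A = cv.dim (eig_sum ?N)"
    unfolding mat_neg_index_def
  proof (rule cv.neg_index_eqI[OF fin_dim_Cn])
    show "eig_sum ?N \<subseteq> Cn n" "eig_sum ?P \<subseteq> Cn n" by (rule eig_sum_Cn)+
    show "\<exists>u\<in>eig_sum ?N. \<exists>z\<in>eig_sum ?P. x = u + z" if "x \<in> Cn n" for x
    proof -
      have "?F = ?N \<union> ?P" by auto
      then have "(\<Union>l\<in>?F. eig l) = (\<Union>l\<in>?N. eig l) \<union> (\<Union>l\<in>?P. eig l)" by (simp only: UN_Un)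
      then have "x \<in> {u + w | u w. u \<in> eig_sum ?N \<and> w \<in> eig_sum ?P}"
        using that cv.span_Un[of "\<Union>l\<in>?N. eig l" "\<Union>l\<in>?P. eig l"] eig_sum_spectrum by simp
      then show ?thesis by blast
    qed
    show "Re (hinner n (mat_vec n A u) u) < 0" if "u \<in> eig_sum ?N" "u \<noteq> 0" for u
      using eig_sum_neg[OF fin(1)] that by simp
    show "0 \<le> Re (hinner n (mat_vec n A u) u)" if "u \<in> eig_sum ?P" for u
      using eig_sum_nonneg[OF fin(2)] that by simp
  qed auto
  then show ?thesis using dim_eig_sum[OF fin(1)] by (simp add: n_minus_def)
qed

end

section \<open>Lagrangian planes and graph coordinates\<close>

lemma (in complex_space_pair) herm_form_Times:
  assumes "herm_form s1 S h" "herm_form s2 T g"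
  shows "herm_form (prod_scale s1 s2) (S \<times> T) (\<lambda>u v. h (fst u) (fst v) + g (snd u) (snd v))"
proof -
  interpret h: herm_form s1 S h by fact
  interpret g: herm_form s2 T g by fact
  interpret p: complex_space "prod_scale s1 s2" by (rule complex_space_prod)
  show ?thesis
  proof unfold_locales
    show "p.subspace (S \<times> T)" by (rule subspace_Times[OF h.subspace_S g.subspace_S])
    show "h (fst v) (fst u) + g (snd v) (snd u) = cnj (h (fst u) (fst v) + g (snd u) (snd v))"
      if "u \<in> S \<times> T" "v \<in> S \<times> T" for u v
      using that h.herm[of "fst u" "fst v"] g.herm[of "snd u" "snd v"] by auto
  qed (auto simp: h.add_left g.add_left h.scale_left g.scale_left algebra_simps)
qed

interpretation pp: complex_space_pair pscale pscale ..
interpretation pvcv: complex_space_pair pscale vscale ..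
interpretation ppv: complex_space "prod_scale pscale pscale" by (rule pp.complex_space_prod)
interpretation ppp: complex_space_pair pscale "prod_scale pscale pscale" ..
interpretation tv: complex_space "prod_scale pscale (prod_scale pscale pscale)"
  by (rule ppp.complex_space_prod)
interpretation tt: complex_space_pair "prod_scale pscale (prod_scale pscale pscale)"
  "prod_scale pscale (prod_scale pscale pscale)" ..
interpretation vp: complex_space_pair vscale pscale ..
interpretation vpv: complex_space "prod_scale vscale pscale" by (rule vp.complex_space_prod)
interpretation vpt: complex_space_pair "prod_scale vscale pscale"
  "prod_scale pscale (prod_scale pscale pscale)" ..

lemma pscale_Pair [simp]: "pscale c (x, y) = (vscale c x, vscale c y)"
  by (simp add: pscale_def)

lemma fin_dim_carr: "pv.fin_dim (Cn n \<times> Cn n)" and dim_carr: "pv.dim (Cn n \<times> Cn n) = 2 * n"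
  using cvcv.fin_dim_dim_Times[OF fin_dim_Cn[of n] fin_dim_Cn[of n]]
  by (simp_all add: pscale_eq_prod_scale dim_Cn)

lemma neg_index_triple:
  assumes "herm_form vscale (Cn n) h1" "herm_form vscale (Cn n) h2" "herm_form vscale (Cn n) h3"
  shows "vpv.neg_index (Cn n \<times> Cn n \<times> Cn n)
      (\<lambda>u. Re (h1 (fst u) (fst u)) + (Re (h2 (fst (snd u)) (fst (snd u))) + Re (h3 (snd (snd u)) (snd (snd u)))))
    = cv.neg_index (Cn n) (\<lambda>x. Re (h1 x x)) + (cv.neg_index (Cn n) (\<lambda>x. Re (h2 x x)) +
      cv.neg_index (Cn n) (\<lambda>x. Re (h3 x x)))"
proof -
  have "herm_form pscale (Cn n \<times> Cn n) (\<lambda>u v. h2 (fst u) (fst v) + h3 (snd u) (snd v))"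
    unfolding pscale_eq_prod_scale by (rule cvcv.herm_form_Times[OF assms(2,3)])
  from vp.neg_index_Times[OF assms(1) this fin_dim_Cn fin_dim_carr]
    cvcv.neg_index_Times[OF assms(2,3) fin_dim_Cn fin_dim_Cn]
  show ?thesis by (simp add: pscale_eq_prod_scale)
qed

lemma Csymp_simps [simp]:
  "scal (Csymp n) = pscale" "carr (Csymp n) = Cn n \<times> Cn n" "form (Csymp n) = omega n"
  by (simp_all add: Csymp_def)

lemma omega_Pair: "omega n (a, b) (c, d) = hinner n a d - hinner n b c"
  by (simp add: omega_def)

lemma omega_bilin:
  "omega n (u + v) w = omega n u w + omega n v w"
  "omega n w (u + v) = omega n w u + omega n w v"
  "omega n (pscale c u) w = c * omega n u w"
  by (simp_all add: omega_def pscale_def hinner_bilin algebra_simps)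

lemma omega_cnj: "omega n v u = - cnj (omega n u v)"
  using hinner_cnj[of n "fst v" "snd u"] hinner_cnj[of n "snd v" "fst u"] by (simp add: omega_def)

lemma LagrD:
  assumes "L \<in> Lagr n"
  shows "pv.subspace L" "L \<subseteq> Cn n \<times> Cn n" "\<And>u v. u \<in> L \<Longrightarrow> v \<in> L \<Longrightarrow> omega n u v = 0"
    "\<And>v. v \<in> Cn n \<times> Cn n \<Longrightarrow> (\<And>u. u \<in> L \<Longrightarrow> omega n u v = 0) \<Longrightarrow> v \<in> L"
proof -
  have L: "pv.subspace L" "L = {v \<in> Cn n \<times> Cn n. \<forall>u\<in>L. omega n u v = 0}"
    using assms by (auto simp: Lagr_def lagrangian_def)
  show "pv.subspace L" by (fact L)
  show "L \<subseteq> Cn n \<times> Cn n" "\<And>u v. u \<in> L \<Longrightarrow> v \<in> L \<Longrightarrow> omega n u v = 0"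
    "\<And>v. v \<in> Cn n \<times> Cn n \<Longrightarrow> (\<And>u. u \<in> L \<Longrightarrow> omega n u v = 0) \<Longrightarrow> v \<in> L"
    using L(2) by blast+
qed

lemma LagrI:
  assumes "pv.subspace L" "L \<subseteq> Cn n \<times> Cn n" "\<And>u v. u \<in> L \<Longrightarrow> v \<in> L \<Longrightarrow> omega n u v = 0"
    "\<And>v. v \<in> Cn n \<times> Cn n \<Longrightarrow> (\<And>u. u \<in> L \<Longrightarrow> omega n u v = 0) \<Longrightarrow> v \<in> L"
  shows "L \<in> Lagr n"
proof -
  have "L = {v \<in> Cn n \<times> Cn n. \<forall>u\<in>L. omega n u v = 0}"
  proof (intro antisym subsetI)
    fix v assume "v \<in> L"
    then show "v \<in> {v \<in> Cn n \<times> Cn n. \<forall>u\<in>L. omega n u v = 0}" using assms(2,3) by blast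
  next
    fix v assume "v \<in> {v \<in> Cn n \<times> Cn n. \<forall>u\<in>L. omega n u v = 0}"
    then show "v \<in> L" using assms(4)[of v] by blast
  qed
  then show ?thesis using assms(1) by (simp add: Lagr_def lagrangian_def)
qed

lemma Lagr_fin_dim: "L \<in> Lagr n \<Longrightarrow> pv.fin_dim L"
  using pv.fin_dim_subset[OF fin_dim_carr] LagrD(1,2) by blast

lemma hinner_eq_0_all:
  assumes "x \<in> Cn n" "\<And>y. y \<in> Cn n \<Longrightarrow> hinner n y x = 0"
  shows "x = 0"
  using assms hinner_self_eq_0 by blast

lemma graph_plane_Lagr:
  assumes "hermitian n A"
  shows "graph_plane n A \<in> Lagr n"
proof (rule LagrI)
  show "pv.subspace (graph_plane n A)"
  proof (rule pv.subspaceI)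
    show "0 \<in> graph_plane n A"
      by (auto simp: graph_plane_def zero_prod_def intro!: exI[of _ "0::cvec"])
    fix u v assume "u \<in> graph_plane n A" "v \<in> graph_plane n A"
    then obtain x y where xy: "x \<in> Cn n" "y \<in> Cn n" "u = (x, mat_vec n A x)" "v = (y, mat_vec n A y)"
      by (auto simp: graph_plane_def)
    then show "u + v \<in> graph_plane n A" by (auto simp: graph_plane_def intro!: exI[of _ "x + y"])
  next
    fix c u assume "u \<in> graph_plane n A"
    then obtain x where x: "x \<in> Cn n" "u = (x, mat_vec n A x)" by (auto simp: graph_plane_def)
    then show "pscale c u \<in> graph_plane n A" by (auto simp: graph_plane_def intro!: exI[of _ "vscale c x"])
  qed
  show "graph_plane n A \<subseteq> Cn n \<times> Cn n" by (auto simp: graph_plane_def)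
  show "omega n u v = 0" if "u \<in> graph_plane n A" "v \<in> graph_plane n A" for u v
    using that by (auto simp: graph_plane_def omega_Pair hermitian_hinner[OF assms])
  fix v assume v: "v \<in> Cn n \<times> Cn n" "\<And>u. u \<in> graph_plane n A \<Longrightarrow> omega n u v = 0"
  obtain a b where ab: "v = (a, b)" "a \<in> Cn n" "b \<in> Cn n" using v(1) by auto
  have "hinner n y (b - mat_vec n A a) = 0" if "y \<in> Cn n" for y
    using v(2)[of "(y, mat_vec n A y)"] that
    by (auto simp: graph_plane_def ab omega_Pair hermitian_hinner[OF assms] hinner_bilin)
  then have "b - mat_vec n A a = 0" by (intro hinner_eq_0_all[of _ n]) (simp_all add: ab)
  then show "v \<in> graph_plane n A" using ab by (auto simp: graph_plane_def)
qed

lemma infinity_plane_Lagr: "infinity_plane n \<in> Lagr n"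
proof (rule LagrI)
  show "pv.subspace (infinity_plane n)"
    by (rule pv.subspaceI) (auto simp: infinity_plane_def zero_prod_def)
  show "infinity_plane n \<subseteq> Cn n \<times> Cn n" by (auto simp: infinity_plane_def)
  show "omega n u v = 0" if "u \<in> infinity_plane n" "v \<in> infinity_plane n" for u v
    using that by (auto simp: infinity_plane_def omega_Pair hinner_bilin)
  fix v assume v: "v \<in> Cn n \<times> Cn n" "\<And>u. u \<in> infinity_plane n \<Longrightarrow> omega n u v = 0"
  obtain a b where ab: "v = (a, b)" "a \<in> Cn n" "b \<in> Cn n" using v(1) by auto
  have "hinner n y a = 0" if "y \<in> Cn n" for y
    using v(2)[of "(0, y)"] that by (auto simp: infinity_plane_def ab omega_Pair hinner_bilin)
  then have "a = 0" using ab by (intro hinner_eq_0_all)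
  then show "v \<in> infinity_plane n" using ab by (simp add: infinity_plane_def)
qed

text \<open>Transversality to G_\<infinity> makes the second component a function g of the first.
  Maximality of L makes g total on \<open>Cn n\<close>, and isotropy makes it a Hermitian
  matrix.\<close>

lemma graph_of_transversal:
  assumes L: "L \<in> Lagr n" and tr: "\<And>z. (0, z) \<in> L \<Longrightarrow> z = 0"
  shows "\<exists>A. hermitian n A \<and> L = graph_plane n A"
proof -
  note Ld = LagrD[OF L]
  have sub: "cv.subspace (fst ` L)"
    by (rule pvcv.lin_on_subspace_image[OF Ld(1)]) (auto simp: lin_on_def pscale_def)
  have "\<exists>y. (x, y) \<in> L" if x: "x \<in> Cn n" for x
  proof -
    have sC: "fst ` L \<subseteq> Cn n" using Ld(2) by auto
    obtain u where u: "u \<in> fst ` L" "\<forall>w\<in>fst ` L. hinner n (x - u) w = 0"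
      using Cn_orthogonal_projection[OF sub sC x] by blast
    have xu: "x - u \<in> Cn n" using u(1) sC x by auto
    have "(0, x - u) \<in> L"
    proof (rule Ld(4))
      fix v assume "v \<in> L"
      then have "hinner n (x - u) (fst v) = 0" using u(2) by blast
      then have "hinner n (fst v) (x - u) = 0" using hinner_cnj[of n "fst v" "x - u"] by simp
      then show "omega n v (0, x - u) = 0" by (simp add: omega_def hinner_bilin)
    qed (use xu in simp)
    then have "x = u" using tr by (metis eq_iff_diff_eq_0)
    then show ?thesis using u(1) by auto
  qed
  then obtain g where g: "\<And>x. x \<in> Cn n \<Longrightarrow> (x, g x) \<in> L" by metis
  have uniq: "y = g x" if "(x, y) \<in> L" for x y
  proof -
    have "x \<in> Cn n" using that Ld(2) by auto
    then have "(x, y) - (x, g x) \<in> L" using g that Ld(1) by (intro pv.subspace_diff)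
    then show ?thesis using tr[of "y - g x"] by simp
  qed
  define e :: "nat \<Rightarrow> cvec" where "e j = (\<lambda>i. if i = j then 1 else 0)" for j
  have eC: "e j \<in> Cn n" if "j < n" for j using that by (auto simp: e_def Cn_def)
  \<comment> \<open>The columns of A are the values of g on the unit vectors.\<close>
  define A where "A i j = g (e j) i" for i j
  have gC: "g x \<in> Cn n" if "x \<in> Cn n" for x using g[OF that] Ld(2) by auto
  have hinner_e: "hinner n (e j) x = cnj (x j)" "hinner n x (e j) = x j" if "j < n" for j x
    using that by (simp_all add: hinner_def e_def if_distrib[of cnj] if_distrib[of "\<lambda>z. _ * z"] if_distrib[of "\<lambda>z. z * _"] cong: if_cong)
  have herm: "hermitian n A"
    unfolding hermitian_def
  proof (intro allI impI)
    fix i j assume ij: "i < n" "j < n"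
    have "omega n (e j, g (e j)) (e i, g (e i)) = 0" using Ld(3) g eC ij by blast
    then have "cnj (g (e i) j) = g (e j) i" using ij by (simp add: omega_Pair hinner_e)
    then show "A j i = cnj (A i j)" by (metis A_def complex_cnj_cnj)
  qed
  have gA: "g x = mat_vec n A x" if x: "x \<in> Cn n" for x
  proof
    fix i
    show "g x i = mat_vec n A x i"
    proof (cases "i < n")
      case True
      \<comment> \<open>Isotropy against the plane vector over \<open>e i\<close> expresses
        coordinate i of g x linearly in x.\<close>
      have "omega n (x, g x) (e i, g (e i)) = 0" using Ld(3) g eC True x by blast
      then have "g x i = hinner n x (g (e i))" using True by (simp add: omega_Pair hinner_e)
      also have "\<dots> = (\<Sum>j<n. A i j * x j)"
        unfolding hinner_def
      proof (intro sum.cong refl)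
        fix j assume "j \<in> {..<n}"
        then have "A i j = cnj (A j i)" using herm True unfolding hermitian_def by blast
        then show "x j * cnj (g (e i) j) = A i j * x j" by (simp add: A_def)
      qed
      finally show ?thesis using True by (simp add: mat_vec_def)
    next
      case False
      then show ?thesis using gC[OF x] by (simp add: Cn_def mat_vec_def)
    qed
  qed
  have "L = graph_plane n A"
  proof (intro antisym subsetI)
    fix v assume v: "v \<in> L"
    then obtain x y where xy: "v = (x, y)" "x \<in> Cn n" using Ld(2) by auto
    then have "y = mat_vec n A x" using uniq gA v by auto
    then show "v \<in> graph_plane n A" using xy by (auto simp: graph_plane_def)
  next
    fix v assume "v \<in> graph_plane n A"
    then show "v \<in> L" using g gA by (auto simp: graph_plane_def)
  qed
  then show ?thesis using herm by blast
qed

lemma finite_non_transversal: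
  assumes L: "L \<in> Lagr n"
  shows "finite {t::real. \<exists>x\<in>Cn n. x \<noteq> 0 \<and> (x, vscale (of_real t) x) \<in> L}"
proof (rule conjunct1, rule finite_if_finite_subsets_card_bdd)
  fix F assume F: "F \<subseteq> {t::real. \<exists>x\<in>Cn n. x \<noteq> 0 \<and> (x, vscale (of_real t) x) \<in> L}" "finite F"
  then have "\<forall>t\<in>F. \<exists>x. x \<in> Cn n \<and> x \<noteq> 0 \<and> (x, vscale (of_real t) x) \<in> L" by blast
  then obtain x where x: "\<And>t. t \<in> F \<Longrightarrow> x t \<in> Cn n" "\<And>t. t \<in> F \<Longrightarrow> x t \<noteq> 0"
    "\<And>t. t \<in> F \<Longrightarrow> (x t, vscale (of_real t) (x t)) \<in> L" by metis
  have orth: "hinner n (x s) (x t) = 0" if "s \<in> F" "t \<in> F" "s \<noteq> t" for s t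
  proof -
    \<comment> \<open>Because t is real, the left-hand side equals (t - s) <x s, x t>.\<close>
    have "omega n (x s, vscale (of_real s) (x s)) (x t, vscale (of_real t) (x t)) = 0"
      using LagrD(3)[OF L] x that by blast
    then have "(complex_of_real t - complex_of_real s) * hinner n (x s) (x t) = 0"
      by (simp add: omega_Pair hinner_bilin algebra_simps)
    then show ?thesis using that(3) by simp
  qed
  have nz: "hinner n (x t) (x t) \<noteq> 0" if "t \<in> F" for t
    using hinner_self_eq_0[OF x(1)[OF that]] x(2)[OF that] by simp
  have inj: "inj_on x F" by (rule inj_onI) (metis orth nz)
  have "cv.independent (x ` F)"
  proof (rule cv.independent_if_scalars_zero)
    show "finite (x ` F)" using F by simp
    fix f y assume s: "(\<Sum>z\<in>x ` F. vscale (f z) z) = 0" and y: "y \<in> x ` F"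
    obtain t where t: "t \<in> F" "y = x t" using y by blast
    have "additive (\<lambda>z. hinner n z y)" by (simp add: additive_def hinner_bilin)
    from additive.sum[OF this, of "\<lambda>z. vscale (f z) z" "x ` F"]
    have "0 = (\<Sum>z\<in>x ` F. f z * hinner n z y)"
      by (simp only: s hinner_bilin)
    also have "\<dots> = (\<Sum>s\<in>F. f (x s) * hinner n (x s) (x t))"
      using sum.reindex[OF inj] t by simp
    also have "\<dots> = (\<Sum>s\<in>{t}. f (x s) * hinner n (x s) (x t))"
      using F t orth by (intro sum.mono_neutral_right) auto
    finally show "f y = 0" using nz t by simp
  qed
  then have "card (x ` F) \<le> cv.dim (Cn n)" using x by (intro cv.card_le_dim(2)[OF fin_dim_Cn]) auto
  then show "card F \<le> n" using card_image[OF inj] by (simp add: dim_Cn)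
qed

section \<open>Symplectic and anti-symplectic maps acting on Lagrangian planes\<close>

lemma symplectic_isoD:
  assumes "symplectic_iso (Csymp m) (Csymp n) T"
  shows "lin_on pscale pscale (Cn m \<times> Cn m) T" "inj_on T (Cn m \<times> Cn m)"
    "T ` (Cn m \<times> Cn m) = Cn n \<times> Cn n"
    "\<And>u v. u \<in> Cn m \<times> Cn m \<Longrightarrow> v \<in> Cn m \<times> Cn m \<Longrightarrow> omega n (T u) (T v) = omega m u v"
  using assms by (auto simp: symplectic_iso_def linear_bij_def lin_on_def bij_betw_def)

text \<open>A nonzero factor c on the form does not change orthogonality. The factor 1 serves
  symplectic maps between arbitrary form spaces, and -1 serves anti-symplectic ones.\<close>

lemma lagrangian_image:
  assumes V: "complex_space (scal V)" and W: "complex_space (scal W)"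
    and T: "linear_bij V W T" and c: "c \<noteq> 0"
    and form: "\<And>u v. u \<in> carr V \<Longrightarrow> v \<in> carr V \<Longrightarrow> form W (T u) (T v) = c * form V u v"
    and L: "lagrangian V L"
  shows "lagrangian W (T ` L)"
proof -
  interpret complex_space_pair "scal V" "scal W" using V W by (simp add: complex_space_pair_def)
  have Ls: "vs1.subspace L" "L = {v \<in> carr V. \<forall>u\<in>L. form V u v = 0}"
    using L by (auto simp: lagrangian_def)
  then have LV: "L \<subseteq> carr V" by blast
  have lin: "lin_on (scal V) (scal W) L T"
    using T LV by (auto simp: linear_bij_def lin_on_def subset_iff)
  have im: "T ` carr V = carr W" using T by (simp add: linear_bij_def bij_betw_def)
  have "T ` L = {v \<in> carr W. \<forall>u\<in>T ` L. form W u v = 0}"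
  proof (intro antisym subsetI)
    fix v assume "v \<in> T ` L"
    then obtain w where w: "w \<in> L" "v = T w" by blast
    have "form V u w = 0" if "u \<in> L" for u using Ls(2) w(1) that by blast
    then have "form W (T u) v = 0" if "u \<in> L" for u using form[of u w] w LV that by auto
    then show "v \<in> {v \<in> carr W. \<forall>u\<in>T ` L. form W u v = 0}" using w LV im by auto
  next
    fix v assume v: "v \<in> {v \<in> carr W. \<forall>u\<in>T ` L. form W u v = 0}"
    then obtain w where w: "w \<in> carr V" "v = T w" using im by auto
    have "form V u w = 0" if "u \<in> L" for u
      using v w form[of u w] that LV c by auto
    then show "v \<in> T ` L" using w Ls(2) by blast
  qed
  then show ?thesis using lin_on_subspace_image[OF Ls(1) lin] unfolding lagrangian_def by blast
qed

lemma symplectic_image_Lagr: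
  assumes "symplectic_iso (Csymp m) (Csymp n) T" "L \<in> Lagr m"
  shows "T ` L \<in> Lagr n"
  using lagrangian_image[of "Csymp m" "Csymp n" T 1 L] assms complex_space_pscale
  by (auto simp: Lagr_def symplectic_iso_def)

lemma anti_symplectic_image_Lagr:
  assumes "anti_symplectic n T" "L \<in> Lagr n"
  shows "T ` L \<in> Lagr n"
  using lagrangian_image[of "Csymp n" "Csymp n" T "-1" L] assms complex_space_pscale
  by (auto simp: Lagr_def anti_symplectic_def)

text \<open>A symplectic map that sends the graph of \<open>t I\<close> to \<open>G\<^sub>\<infinity>\<close>.\<close>

definition tilt :: "real \<Rightarrow> cvec \<times> cvec \<Rightarrow> cvec \<times> cvec" where
  "tilt t u = (vscale (of_real t) (fst u) - snd u, fst u)"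

lemma symplectic_tilt: "symplectic_iso (Csymp n) (Csymp n) (tilt t)"
  unfolding symplectic_iso_def linear_bij_def
proof (intro conjI ballI allI)
  show "bij_betw (tilt t) (carr (Csymp n)) (carr (Csymp n))"
    by (rule bij_betw_byWitness[where f' = "\<lambda>u. (snd u, vscale (of_real t) (snd u) - fst u)"])
      (auto simp: tilt_def)
qed (auto simp: tilt_def omega_def hinner_bilin algebra_simps cv.scale_right_distrib
  cv.scale_right_diff_distrib cv.scale_left_commute)

text \<open>It subtracts A from every graph and fixes G_\<infinity>, and so brings two graphs and
  G_\<infinity> into the position of the normalisation property.\<close>

definition shear :: "nat \<Rightarrow> (nat \<Rightarrow> nat \<Rightarrow> complex) \<Rightarrow> cvec \<times> cvec \<Rightarrow> cvec \<times> cvec" where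
  "shear n A u = (fst u, snd u - mat_vec n A (fst u))"

lemma symplectic_shear:
  assumes "hermitian n A"
  shows "symplectic_iso (Csymp n) (Csymp n) (shear n A)"
  unfolding symplectic_iso_def linear_bij_def
proof (intro conjI ballI allI)
  show "bij_betw (shear n A) (carr (Csymp n)) (carr (Csymp n))"
    by (rule bij_betw_byWitness[where f' = "\<lambda>u. (fst u, snd u + mat_vec n A (fst u))"])
      (auto simp: shear_def)
qed (auto simp: shear_def omega_def hinner_bilin algebra_simps cv.scale_right_diff_distrib
  hermitian_hinner[OF assms])

lemma shear_graph_plane: "shear n A ` graph_plane n B = graph_plane n (B - A)"
  by (force simp: shear_def graph_plane_def image_iff)

lemma shear_infinity_plane: "shear n A ` infinity_plane n = infinity_plane n"
  by (force simp: shear_def infinity_plane_def image_iff)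

text \<open>The matrices form a function M of the plane, so equal planes get equal matrices; the
  identities with repeated arguments rely on this.\<close>

lemma common_graph_coordinates:
  assumes "finite X" "X \<subseteq> Lagr n"
  obtains T M where "symplectic_iso (Csymp n) (Csymp n) T"
    "\<And>L. L \<in> X \<Longrightarrow> hermitian n (M L)" "\<And>L. L \<in> X \<Longrightarrow> T ` L = graph_plane n (M L)"
proof -
  have "finite (\<Union>L\<in>X. {t::real. \<exists>x\<in>Cn n. x \<noteq> 0 \<and> (x, vscale (of_real t) x) \<in> L})"
    using assms finite_non_transversal by (intro finite_UN_I) auto
  then obtain t where t: "t \<notin> (\<Union>L\<in>X. {t::real. \<exists>x\<in>Cn n. x \<noteq> 0 \<and> (x, vscale (of_real t) x) \<in> L})"
    using ex_new_if_finite infinite_UNIV_char_0 by blast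
  have ex: "\<exists>A. hermitian n A \<and> tilt t ` L = graph_plane n A" if L: "L \<in> X" for L
  proof (rule graph_of_transversal)
    have LL: "L \<in> Lagr n" using L assms by blast
    then show "tilt t ` L \<in> Lagr n" by (rule symplectic_image_Lagr[OF symplectic_tilt])
    \<comment> \<open>A vertical vector of the tilted plane comes from a vector of L on the graph of
      t I, which is 0 by the choice of t.\<close>
    fix z assume "(0, z) \<in> tilt t ` L"
    then obtain x y where xy: "(x, y) \<in> L" "vscale (of_real t) x - y = 0" "z = x"
      by (auto simp: tilt_def)
    then have "(x, vscale (of_real t) x) \<in> L" by simp
    moreover have "x \<in> Cn n" using xy(1) LagrD(2)[OF LL] by auto
    ultimately show "z = 0" using t L xy by blast
  qed
  show ?thesis
    by (rule that[OF symplectic_tilt, of "\<lambda>L. SOME A. hermitian n A \<and> tilt t ` L = graph_plane n A"])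
      (use someI_ex[OF ex] in auto)
qed

section \<open>The index of three Lagrangian planes\<close>

text \<open>Half of the quadratic form of \<open>\<Omega>\<close>; the factor does not affect the negative index.\<close>

definition triple_form :: "nat \<Rightarrow> (cvec \<times> cvec) \<times> (cvec \<times> cvec) \<times> (cvec \<times> cvec) \<Rightarrow> real" where
  "triple_form n u = Re (omega n (fst u) (fst (snd u)) + omega n (fst (snd u)) (snd (snd u))
    + omega n (snd (snd u)) (fst u))"

definition triple_neg_index :: "nat \<Rightarrow> triple_index" where
  "triple_neg_index n L1 L2 L3 =
    complex_space.neg_index (prod_scale pscale (prod_scale pscale pscale)) (L1 \<times> L2 \<times> L3) (triple_form n)"

lemma fin_dim_triple:
  assumes "pv.fin_dim L1" "pv.fin_dim L2" "pv.fin_dim L3"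
  shows "tv.fin_dim (L1 \<times> L2 \<times> L3)"
  using ppp.fin_dim_dim_Times(1)[OF assms(1) pp.fin_dim_dim_Times(1)[OF assms(2,3)]] .

lemma dim_inter_image:
  assumes T: "lin_on pscale pscale (Cn m \<times> Cn m) T" "inj_on T (Cn m \<times> Cn m)"
    and L: "L1 \<in> Lagr m" "L2 \<in> Lagr m"
  shows "pv.dim (T ` L1 \<inter> T ` L2) = pv.dim (L1 \<inter> L2)"
proof -
  have sub: "L1 \<inter> L2 \<subseteq> Cn m \<times> Cn m" using LagrD(2)[OF L(1)] by blast
  have "T ` L1 \<inter> T ` L2 = T ` (L1 \<inter> L2)"
    using inj_on_image_Int[OF T(2)] LagrD(2)[OF L(1)] LagrD(2)[OF L(2)] by blast
  moreover have "pv.fin_dim (L1 \<inter> L2)"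
    using pv.fin_dim_subset[OF Lagr_fin_dim[OF L(1)]] LagrD(1)[OF L(1)] LagrD(1)[OF L(2)]
    by (simp add: pv.subspace_inter)
  ultimately show ?thesis
    using pp.dim_image_inj[OF _ lin_on_subset[OF T(1) sub] inj_on_subset[OF T(2) sub]] by simp
qed

lemma triple_neg_index_symplectic:
  assumes T: "symplectic_iso (Csymp m) (Csymp n) T"
    and L: "L1 \<in> Lagr m" "L2 \<in> Lagr m" "L3 \<in> Lagr m"
  shows "triple_neg_index n (T ` L1) (T ` L2) (T ` L3) = triple_neg_index m L1 L2 L3"
proof -
  note Td = symplectic_isoD[OF T]
  note C = LagrD(2)[OF L(1)] LagrD(2)[OF L(2)] LagrD(2)[OF L(3)]
  let ?f = "\<lambda>u. (T (fst u), T (fst (snd u)), T (snd (snd u)))"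
  have "?f ` (L1 \<times> L2 \<times> L3) = T ` L1 \<times> T ` L2 \<times> T ` L3" by force
  moreover have "tv.neg_index (?f ` (L1 \<times> L2 \<times> L3)) (triple_form n) = tv.neg_index (L1 \<times> L2 \<times> L3) (triple_form m)"
  proof (rule tt.neg_index_bij)
    show "tv.fin_dim (L1 \<times> L2 \<times> L3)" using L by (intro fin_dim_triple Lagr_fin_dim)
    have mem: "fst u \<in> Cn m \<times> Cn m \<and> fst (snd u) \<in> Cn m \<times> Cn m \<and> snd (snd u) \<in> Cn m \<times> Cn m"
      if "u \<in> L1 \<times> L2 \<times> L3" for u using that C by auto
    show "lin_on (prod_scale pscale (prod_scale pscale pscale)) (prod_scale pscale (prod_scale pscale pscale))
      (L1 \<times> L2 \<times> L3) ?f"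
      using lin_on_subset[OF Td(1) C(1)] lin_on_subset[OF Td(1) C(2)] lin_on_subset[OF Td(1) C(3)]
      by (simp add: lin_on_def prod_scale_def)
    show "inj_on ?f (L1 \<times> L2 \<times> L3)"
    proof (rule inj_onI)
      fix u v assume uv: "u \<in> L1 \<times> L2 \<times> L3" "v \<in> L1 \<times> L2 \<times> L3" and "?f u = ?f v"
      then have e: "T (fst u) = T (fst v)" "T (fst (snd u)) = T (fst (snd v))" "T (snd (snd u)) = T (snd (snd v))" by auto
      note d = inj_onD[OF Td(2) e(1)] inj_onD[OF Td(2) e(2)] inj_onD[OF Td(2) e(3)]
      have "fst u = fst v" "fst (snd u) = fst (snd v)" "snd (snd u) = snd (snd v)"
        using mem[OF uv(1)] mem[OF uv(2)] by (auto intro!: d)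
      then show "u = v" by (simp add: prod_eq_iff)
    qed
    show "triple_form n (?f u) = triple_form m u" if "u \<in> L1 \<times> L2 \<times> L3" for u
      using mem[OF that] Td(4) by (simp add: triple_form_def)
  qed
  ultimately show ?thesis by (simp add: triple_neg_index_def)
qed

text \<open>T changes the sign of \<open>omega\<close>. Reversing the order of the three vectors
  changes the sign of the triple form as well, since the real part of \<open>omega\<close> is
  antisymmetric, and the two signs cancel.\<close>

lemma triple_neg_index_anti_symplectic:
  assumes T: "anti_symplectic n T"
    and L: "L1 \<in> Lagr n" "L2 \<in> Lagr n" "L3 \<in> Lagr n"
  shows "triple_neg_index n (T ` L1) (T ` L2) (T ` L3) = triple_neg_index n L3 L2 L1"
proof -
  have lin: "lin_on pscale pscale (Cn n \<times> Cn n) T" and inj: "inj_on T (Cn n \<times> Cn n)"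
    and om: "\<And>u v. u \<in> Cn n \<times> Cn n \<Longrightarrow> v \<in> Cn n \<times> Cn n \<Longrightarrow> omega n (T u) (T v) = - omega n u v"
    using T by (auto simp: anti_symplectic_def linear_bij_def lin_on_def bij_betw_def)
  note C = LagrD(2)[OF L(1)] LagrD(2)[OF L(2)] LagrD(2)[OF L(3)]
  let ?f = "\<lambda>u. (T (snd (snd u)), T (fst (snd u)), T (fst u))"
  have "?f ` (L3 \<times> L2 \<times> L1) = T ` L1 \<times> T ` L2 \<times> T ` L3" by force
  moreover have "tv.neg_index (?f ` (L3 \<times> L2 \<times> L1)) (triple_form n) = tv.neg_index (L3 \<times> L2 \<times> L1) (triple_form n)"
  proof (rule tt.neg_index_bij)
    show "tv.fin_dim (L3 \<times> L2 \<times> L1)" using L by (intro fin_dim_triple Lagr_fin_dim)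
    have mem: "fst u \<in> Cn n \<times> Cn n \<and> fst (snd u) \<in> Cn n \<times> Cn n \<and> snd (snd u) \<in> Cn n \<times> Cn n"
      if "u \<in> L3 \<times> L2 \<times> L1" for u using that C by auto
    show "lin_on (prod_scale pscale (prod_scale pscale pscale)) (prod_scale pscale (prod_scale pscale pscale))
      (L3 \<times> L2 \<times> L1) ?f"
      using lin_on_subset[OF lin C(1)] lin_on_subset[OF lin C(2)] lin_on_subset[OF lin C(3)]
      by (simp add: lin_on_def prod_scale_def)
    show "inj_on ?f (L3 \<times> L2 \<times> L1)"
    proof (rule inj_onI)
      fix u v assume uv: "u \<in> L3 \<times> L2 \<times> L1" "v \<in> L3 \<times> L2 \<times> L1" and "?f u = ?f v"
      then have e: "T (fst u) = T (fst v)" "T (fst (snd u)) = T (fst (snd v))" "T (snd (snd u)) = T (snd (snd v))" by auto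
      note d = inj_onD[OF inj e(1)] inj_onD[OF inj e(2)] inj_onD[OF inj e(3)]
      have "fst u = fst v" "fst (snd u) = fst (snd v)" "snd (snd u) = snd (snd v)"
        using mem[OF uv(1)] mem[OF uv(2)] by (auto intro!: d)
      then show "u = v" by (simp add: prod_eq_iff)
    qed
    show "triple_form n (?f u) = triple_form n u" if "u \<in> L3 \<times> L2 \<times> L1" for u
    proof -
      have sk: "Re (omega n y x) = - Re (omega n x y)" for x y using omega_cnj[of n y x] by simp
      show ?thesis
        using mem[OF that] om sk[of "fst u" "fst (snd u)"] sk[of "fst (snd u)" "snd (snd u)"] sk[of "snd (snd u)" "fst u"]
        by (simp add: triple_form_def)
    qed
  qed
  ultimately show ?thesis by (simp add: triple_neg_index_def)
qed

lemma Re_hermitian_commute: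
  "hermitian n A \<Longrightarrow> Re (hinner n (mat_vec n A x) y) = Re (hinner n (mat_vec n A y) x)"
  using hermitian_hinner[of n A x y] Re_hinner_commute by metis

text \<open>In graph coordinates the substitution \<open>x\<^sub>1 = u - w\<close>, \<open>x\<^sub>2 = u + v\<close>, \<open>x\<^sub>3 = v - w\<close> diagonalises
  the triple form into \<open>\<langle>(B - A)u, u\<rangle> + \<langle>(C - B)v, v\<rangle> - \<langle>(C - A)w, w\<rangle>\<close>.\<close>

lemma triple_neg_index_graph:
  assumes A: "hermitian n A" and B: "hermitian n B" and C: "hermitian n C"
  shows "triple_neg_index n (graph_plane n A) (graph_plane n B) (graph_plane n C)
    = mat_neg_index n (B - A) + (mat_neg_index n (C - B) + mat_neg_index n (- (C - A)))"
proof -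
  let ?g = "\<lambda>M x. (x, mat_vec n M x)"
  let ?f = "\<lambda>u::cvec \<times> cvec \<times> cvec. (?g A (fst u - snd (snd u)), ?g B (fst u + fst (snd u)), ?g C (fst (snd u) - snd (snd u)))"
  let ?S = "Cn n \<times> Cn n \<times> Cn n"
  let ?q = "\<lambda>u. Re (hinner n (mat_vec n (B - A) (fst u)) (fst u)) +
    (Re (hinner n (mat_vec n (C - B) (fst (snd u))) (fst (snd u))) +
     Re (hinner n (mat_vec n (- (C - A)) (snd (snd u))) (snd (snd u))))"
  have im: "?f ` ?S = graph_plane n A \<times> graph_plane n B \<times> graph_plane n C"
  proof (intro antisym subsetI)
    fix p assume "p \<in> ?f ` ?S"
    then obtain u v w where u: "u \<in> Cn n" "v \<in> Cn n" "w \<in> Cn n" and p: "p = ?f (u, v, w)"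
      by (auto simp del: mat_vec_linear)
    have "?g M x \<in> graph_plane n M" if "x \<in> Cn n" for M x using that by (auto simp: graph_plane_def)
    then show "p \<in> graph_plane n A \<times> graph_plane n B \<times> graph_plane n C" unfolding p
      using u by (simp del: mat_vec_linear)
  next
    fix p assume "p \<in> graph_plane n A \<times> graph_plane n B \<times> graph_plane n C"
    then obtain x y z where x: "x \<in> Cn n" "y \<in> Cn n" "z \<in> Cn n" and p: "p = (?g A x, ?g B y, ?g C z)"
      by (auto simp: graph_plane_def simp del: mat_vec_linear)
    let ?h = "vscale (1/2)"
    have "?h (x + y - z) - ?h (y - z - x) = x" "?h (x + y - z) + ?h (y + z - x) = y"
      "?h (y + z - x) - ?h (y - z - x) = z"
      by (auto simp: vscale_def fun_eq_iff field_simps)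
    then have peq: "p = ?f (?h (x + y - z), ?h (y + z - x), ?h (y - z - x))"
      unfolding p by (simp del: mat_vec_linear)
    have "(?h (x + y - z), ?h (y + z - x), ?h (y - z - x)) \<in> ?S" using x by simp
    from imageI[OF this, of ?f] show "p \<in> ?f ` ?S" unfolding peq .
  qed
  have "tv.neg_index (?f ` ?S) (triple_form n) = vpv.neg_index ?S ?q"
  proof (rule vpt.neg_index_bij)
    show "vpv.fin_dim ?S" by (rule vp.fin_dim_dim_Times(1)[OF fin_dim_Cn fin_dim_carr])
    show "lin_on (prod_scale vscale pscale) (prod_scale pscale (prod_scale pscale pscale)) ?S ?f"
      by (auto simp: lin_on_def cv.scale_right_distrib cv.scale_right_diff_distrib)
    show "inj_on ?f ?S"
    proof (rule inj_onI)
      fix a b assume "?f a = ?f b"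
      then have e: "fst a - snd (snd a) = fst b - snd (snd b)" "fst a + fst (snd a) = fst b + fst (snd b)"
        "fst (snd a) - snd (snd a) = fst (snd b) - snd (snd b)" by auto
      have dbl: "x = y" if "x + x = y + y" for x y :: cvec
      proof
        fix i
        from that have "x i + x i = y i + y i" by (metis plus_fun_apply)
        then show "x i = y i" by (simp flip: mult_2)
      qed
      have "fst a + fst a = (fst a - snd (snd a)) + (fst a + fst (snd a)) - (fst (snd a) - snd (snd a))"
        by (simp add: algebra_simps)
      also have "\<dots> = fst b + fst b" unfolding e by (simp add: algebra_simps)
      finally have "fst a = fst b" by (rule dbl)
      then show "a = b" using e by (simp add: prod_eq_iff)
    qed
    show "triple_form n (?f s) = ?q s" for s
    proof -
      obtain u v w where s: "s = (u, v, w)" by (metis prod.collapse)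
      note c = Re_hermitian_commute[OF A, of v u] Re_hermitian_commute[OF A, of w u] Re_hermitian_commute[OF A, of w v]
        Re_hermitian_commute[OF B, of v u] Re_hermitian_commute[OF B, of w u] Re_hermitian_commute[OF B, of w v]
        Re_hermitian_commute[OF C, of v u] Re_hermitian_commute[OF C, of w u] Re_hermitian_commute[OF C, of w v]
      show ?thesis
        unfolding s by (simp add: triple_form_def omega_Pair hinner_bilin c
            hermitian_hinner[OF A, symmetric] hermitian_hinner[OF B, symmetric] hermitian_hinner[OF C, symmetric])
    qed
  qed
  also have "\<dots> = mat_neg_index n (B - A) + (mat_neg_index n (C - B) + mat_neg_index n (- (C - A)))"
    unfolding mat_neg_index_def
    by (rule neg_index_triple) (intro herm_form_mat hermitian_closed A B C)+
  finally show ?thesis unfolding triple_neg_index_def im .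
qed

lemma neg_index_hinner:
  "cv.neg_index (Cn n) (\<lambda>x. Re (hinner n x x)) = 0"
  "cv.neg_index (Cn n) (\<lambda>x. Re (- hinner n x x)) = n"
proof -
  have pos: "0 \<le> Re (hinner n x x)" for x by (simp add: hinner_self sum_nonneg)
  have "cv.neg_index (Cn n) (\<lambda>x. Re (hinner n x x)) = cv.dim {0}"
    by (rule cv.neg_index_eqI[OF fin_dim_Cn _ _ subspace_Cn]) (auto simp: pos)
  then show "cv.neg_index (Cn n) (\<lambda>x. Re (hinner n x x)) = 0" by (simp add: cv.dim_zero_space)
  have "cv.neg_index (Cn n) (\<lambda>x. Re (- hinner n x x)) = cv.dim (Cn n)"
    by (rule cv.neg_index_eqI[OF fin_dim_Cn subspace_Cn _ cv.subspace_single_0])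
      (auto simp: hinner_self_pos hinner_bilin)
  then show "cv.neg_index (Cn n) (\<lambda>x. Re (- hinner n x x)) = n" by (simp add: dim_Cn)
qed

text \<open>On vectors (x, 0), (y, A y), (0, z) the triple form is the real part of <x, A y> + <y -
  x, z>. The substitution x = y - a - b, z = A y + a - b turns it into <A y, y> + <a, a> - <b, b>.
  The last square accounts for the summand n, which \<open>iota_int\<close> subtracts again.\<close>

lemma triple_neg_index_zero_infinity:
  assumes A: "hermitian n A"
  shows "triple_neg_index n (graph_plane n 0) (graph_plane n A) (infinity_plane n) = mat_neg_index n A + n"
proof -
  let ?f = "\<lambda>u::cvec \<times> cvec \<times> cvec. ((fst u - fst (snd u) - snd (snd u), 0::cvec), (fst u, mat_vec n A (fst u)),
    (0::cvec, mat_vec n A (fst u) + fst (snd u) - snd (snd u)))"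
  let ?S = "Cn n \<times> Cn n \<times> Cn n"
  let ?q = "\<lambda>u. Re (hinner n (mat_vec n A (fst u)) (fst u)) +
    (Re (hinner n (fst (snd u)) (fst (snd u))) + Re (- hinner n (snd (snd u)) (snd (snd u))))"
  have im: "?f ` ?S = graph_plane n 0 \<times> graph_plane n A \<times> infinity_plane n"
  proof (intro antisym subsetI)
    fix p assume "p \<in> ?f ` ?S"
    then show "p \<in> graph_plane n 0 \<times> graph_plane n A \<times> infinity_plane n"
      by (auto simp: graph_plane_def infinity_plane_def)
  next
    fix p assume "p \<in> graph_plane n 0 \<times> graph_plane n A \<times> infinity_plane n"
    then obtain x y z where x: "x \<in> Cn n" "y \<in> Cn n" "z \<in> Cn n"
      and p: "p = ((x, 0), (y, mat_vec n A y), (0, z))"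
      by (auto simp: graph_plane_def infinity_plane_def)
    \<comment> \<open>The inverse substitution: a + b = y - x and a - b = z - A y.\<close>
    let ?h = "vscale (1/2)" and ?k = "z - mat_vec n A y"
    have "y - ?h (y - x + ?k) - ?h (y - x - ?k) = x" "mat_vec n A y + ?h (y - x + ?k) - ?h (y - x - ?k) = z"
      by (auto simp: vscale_def fun_eq_iff field_simps)
    then have peq: "p = ?f (y, ?h (y - x + ?k), ?h (y - x - ?k))" unfolding p by simp
    have "(y, ?h (y - x + ?k), ?h (y - x - ?k)) \<in> ?S" using x by simp
    from imageI[OF this, of ?f] show "p \<in> ?f ` ?S" unfolding peq .
  qed
  have "tv.neg_index (?f ` ?S) (triple_form n) = vpv.neg_index ?S ?q"
  proof (rule vpt.neg_index_bij)
    show "vpv.fin_dim ?S" by (rule vp.fin_dim_dim_Times(1)[OF fin_dim_Cn fin_dim_carr])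
    show "lin_on (prod_scale vscale pscale) (prod_scale pscale (prod_scale pscale pscale)) ?S ?f"
      by (auto simp: lin_on_def cv.scale_right_distrib cv.scale_right_diff_distrib)
    show "inj_on ?f ?S"
    proof (rule inj_onI)
      fix a b assume "?f a = ?f b"
      then have e: "fst a = fst b" "fst a - fst (snd a) - snd (snd a) = fst b - fst (snd b) - snd (snd b)"
        "mat_vec n A (fst a) + fst (snd a) - snd (snd a) = mat_vec n A (fst b) + fst (snd b) - snd (snd b)" by auto
      have dbl: "x = y" if "x + x = y + y" for x y :: cvec
      proof
        fix i
        from that have "x i + x i = y i + y i" by (metis plus_fun_apply)
        then show "x i = y i" by (simp flip: mult_2)
      qed
      have "snd (snd a) + snd (snd a) = mat_vec n A (fst a) + fst a - (fst a - fst (snd a) - snd (snd a))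
          - (mat_vec n A (fst a) + fst (snd a) - snd (snd a))"
        by (simp add: algebra_simps)
      also have "\<dots> = snd (snd b) + snd (snd b)" unfolding e(2,3) unfolding e(1) by (simp add: algebra_simps)
      finally have "snd (snd a) = snd (snd b)" by (rule dbl)
      then show "a = b" using e by (simp add: prod_eq_iff)
    qed
    show "triple_form n (?f s) = ?q s" for s
    proof -
      obtain y a b where s: "s = (y, a, b)" by (metis prod.collapse)
      note c = Re_hermitian_commute[OF A, of a y] Re_hermitian_commute[OF A, of b y] Re_hermitian_commute[OF A, of a b]
        Re_hinner_commute[of n a y] Re_hinner_commute[of n b y] Re_hinner_commute[of n a b]
      show ?thesis
        unfolding s by (simp add: triple_form_def omega_Pair hinner_bilin c hermitian_hinner[OF A, symmetric])
    qed
  qed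
  also have "\<dots> = mat_neg_index n A + (0 + n)"
    unfolding mat_neg_index_def
    using neg_index_triple[OF herm_form_mat[OF A] hi.herm_form_subspace[OF subspace_Cn subset_UNIV]
        herm_form.herm_form_uminus[OF hi.herm_form_subspace[OF subspace_Cn subset_UNIV]], of n n]
    by (simp add: neg_index_hinner[simplified])
  finally show ?thesis unfolding triple_neg_index_def im by simp
qed

lemma dim_graph_inter:
  "pv.dim (graph_plane n A \<inter> graph_plane n B) = cv.dim {x \<in> Cn n. mat_vec n (B - A) x = 0}"
proof -
  let ?K = "{x \<in> Cn n. mat_vec n (B - A) x = 0}"
  let ?g = "\<lambda>x. (x, mat_vec n A x)"
  have "graph_plane n A \<inter> graph_plane n B = ?g ` ?K"
    by (auto simp: graph_plane_def image_iff)
  moreover have "cv.subspace ?K" by (rule cv.subspaceI) (auto simp: cv.scale_right_diff_distrib[symmetric])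
  then have "cv.fin_dim ?K" by (rule cv.fin_dim_subset[OF fin_dim_Cn]) auto
  then have "pv.dim (?g ` ?K) = cv.dim ?K"
    by (rule vp.dim_image_inj) (auto simp: lin_on_def inj_on_def)
  ultimately show ?thesis by simp
qed

text \<open>The explicit formula as an integer, because truncated subtraction would spoil the
  algebra before nonnegativity is known.\<close>

definition iota_int :: "nat \<Rightarrow> (cvec \<times> cvec) set \<Rightarrow> (cvec \<times> cvec) set \<Rightarrow> (cvec \<times> cvec) set \<Rightarrow> int" where
  "iota_int n L1 L2 L3 = int (triple_neg_index n L1 L2 L3) + pdim (L1 \<inter> L3) - int n"

text \<open>The graphs of A and C intersect in dimension dim ker (C - A), and \<nu>(A - C) + dim ker
  (C - A) - n = - \<nu>(C - A).\<close>

lemma iota_int_graph: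
  assumes "hermitian n A" "hermitian n B" "hermitian n C"
  shows "iota_int n (graph_plane n A) (graph_plane n B) (graph_plane n C)
    = int (mat_neg_index n (B - A)) - int (mat_neg_index n (C - A)) + int (mat_neg_index n (C - B))"
  using triple_neg_index_graph[OF assms] dim_graph_inter[of n A C] mat_neg_index_sum_kernel[of n "C - A"] assms
  by (simp add: iota_int_def)

lemma iota_int_symplectic:
  assumes "symplectic_iso (Csymp n) (Csymp n) T" "L1 \<in> Lagr n" "L2 \<in> Lagr n" "L3 \<in> Lagr n"
  shows "iota_int n (T ` L1) (T ` L2) (T ` L3) = iota_int n L1 L2 L3"
  using triple_neg_index_symplectic[OF assms] dim_inter_image[OF symplectic_isoD(1,2)[OF assms(1)] assms(2,4)]
  by (simp add: iota_int_def)

text \<open>The lower bound is subadditivity for C - A = (B - A) + (C - B). The upper bound is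
  subadditivity for B - A = (C - A) - (C - B), together with \<nu>(C - B) + \<nu>(B - C) \<le>
  n.\<close>

lemma iota_int_bounds:
  assumes L: "L1 \<in> Lagr n" "L2 \<in> Lagr n" "L3 \<in> Lagr n"
  shows "0 \<le> iota_int n L1 L2 L3" "iota_int n L1 L2 L3 \<le> int n"
proof -
  obtain T M where T: "symplectic_iso (Csymp n) (Csymp n) T"
    "\<And>L. L \<in> {L1, L2, L3} \<Longrightarrow> hermitian n (M L)" "\<And>L. L \<in> {L1, L2, L3} \<Longrightarrow> T ` L = graph_plane n (M L)"
    by (rule common_graph_coordinates[of "{L1, L2, L3}" n]) (use L in auto)
  define A and B and C where "A = M L1" and "B = M L2" and "C = M L3"
  have h: "hermitian n A" "hermitian n B" "hermitian n C"
    and g: "T ` L1 = graph_plane n A" "T ` L2 = graph_plane n B" "T ` L3 = graph_plane n C"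
    using T(2,3) by (simp_all add: A_def B_def C_def)
  have eq: "iota_int n L1 L2 L3
      = int (mat_neg_index n (B - A)) - int (mat_neg_index n (C - A)) + int (mat_neg_index n (C - B))"
    using iota_int_symplectic[OF T(1) L] iota_int_graph[OF h] g by simp
  have "mat_neg_index n (C - A) \<le> mat_neg_index n (B - A) + mat_neg_index n (C - B)"
    using mat_neg_index_subadd[of n "B - A" "C - B"] h by simp
  then show "0 \<le> iota_int n L1 L2 L3" using eq by simp
  have "mat_neg_index n (B - A) \<le> mat_neg_index n (C - A) + mat_neg_index n (- (C - B))"
    using mat_neg_index_subadd[of n "C - A" "- (C - B)"] h by simp
  moreover have "mat_neg_index n (C - B) + mat_neg_index n (- (C - B)) \<le> n"
    using mat_neg_index_sum_kernel[of n "C - B"] h by simp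
  ultimately show "iota_int n L1 L2 L3 \<le> int n" using eq by simp
qed

section \<open>Existence and uniqueness of the Duistermaat index\<close>

definition iota :: "nat \<Rightarrow> triple_index" where
  "iota n L1 L2 L3 =
    (if L1 \<in> Lagr n \<and> L2 \<in> Lagr n \<and> L3 \<in> Lagr n then nat (iota_int n L1 L2 L3) else 0)"

lemma int_iota:
  "L1 \<in> Lagr n \<Longrightarrow> L2 \<in> Lagr n \<Longrightarrow> L3 \<in> Lagr n \<Longrightarrow> int (iota n L1 L2 L3) = iota_int n L1 L2 L3"
  using iota_int_bounds(1) by (simp add: iota_def)

lemma is_duistermaat_iota: "is_duistermaat n (iota n)"
  unfolding is_duistermaat_def
proof (intro conjI allI ballI impI)
  show "iota n L1 L2 L3 = 0" if "\<not> (L1 \<in> Lagr n \<and> L2 \<in> Lagr n \<and> L3 \<in> Lagr n)" for L1 L2 L3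
    using that by (auto simp: iota_def)
  show "iota n L1 L2 L3 \<le> n" if "L1 \<in> Lagr n" "L2 \<in> Lagr n" "L3 \<in> Lagr n" for L1 L2 L3
    using int_iota[OF that] iota_int_bounds(2)[OF that] by simp
next
  fix A assume A: "hermitian n A"
  have G: "graph_plane n 0 \<in> Lagr n" "graph_plane n A \<in> Lagr n"
    using A by (auto intro: graph_plane_Lagr)
  have "graph_plane n 0 \<inter> infinity_plane n = {0}"
    by (auto simp: graph_plane_def infinity_plane_def zero_prod_def)
  then have "iota_int n (graph_plane n 0) (graph_plane n A) (infinity_plane n) = int (mat_neg_index n A)"
    using triple_neg_index_zero_infinity[OF A] pv.dim_zero_space by (simp add: iota_int_def)
  then have "iota n (graph_plane n 0) (graph_plane n A) (infinity_plane n) = n_minus n A"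
    using int_iota[OF G infinity_plane_Lagr] n_minus_eq_mat_neg_index[OF A] by simp
  then show "iota n (graph_plane n (\<lambda>i j. 0)) (graph_plane n A) (infinity_plane n) = n_minus n A"
    by (simp add: zero_fun_def)
next
  fix T L1 L2 L3
  assume T: "symplectic_iso (Csymp n) (Csymp n) T" and L: "L1 \<in> Lagr n" "L2 \<in> Lagr n" "L3 \<in> Lagr n"
  show "iota n (T ` L1) (T ` L2) (T ` L3) = iota n L1 L2 L3"
    using symplectic_image_Lagr[OF T] L iota_int_symplectic[OF T L] by (simp add: iota_def)
next
  fix L1 L2 L3 L4
  assume L: "L1 \<in> Lagr n" "L2 \<in> Lagr n" "L3 \<in> Lagr n" "L4 \<in> Lagr n"
  obtain T M where T: "symplectic_iso (Csymp n) (Csymp n) T"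
    "\<And>L. L \<in> {L1, L2, L3, L4} \<Longrightarrow> hermitian n (M L)" "\<And>L. L \<in> {L1, L2, L3, L4} \<Longrightarrow> T ` L = graph_plane n (M L)"
    by (rule common_graph_coordinates[of "{L1, L2, L3, L4}" n]) (use L in auto)
  define A and B and C and D where "A = M L1" and "B = M L2" and "C = M L3" and "D = M L4"
  have h: "hermitian n A" "hermitian n B" "hermitian n C" "hermitian n D"
    and g: "T ` L1 = graph_plane n A" "T ` L2 = graph_plane n B" "T ` L3 = graph_plane n C" "T ` L4 = graph_plane n D"
    using T(2,3) by (simp_all add: A_def B_def C_def D_def)
  \<comment> \<open>In common coordinates the index is the coboundary of the function \<nu>(M j - M
    i) of pairs, so each of the twelve terms cancels against another one.\<close>
  show "int (iota n L1 L2 L3) - int (iota n L1 L2 L4) + int (iota n L1 L3 L4) - int (iota n L2 L3 L4) = 0"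
    using L g h iota_int_symplectic[OF T(1), of L1 L2 L3, symmetric] iota_int_symplectic[OF T(1), of L1 L2 L4, symmetric]
      iota_int_symplectic[OF T(1), of L1 L3 L4, symmetric] iota_int_symplectic[OF T(1), of L2 L3 L4, symmetric]
    by (simp add: int_iota iota_int_graph)
qed

lemma is_duistermaat_symplectic:
  assumes "is_duistermaat n f" "symplectic_iso (Csymp n) (Csymp n) T"
    "L1 \<in> Lagr n" "L2 \<in> Lagr n" "L3 \<in> Lagr n"
  shows "f (T ` L1) (T ` L2) (T ` L3) = f L1 L2 L3"
  using assms(1) unfolding is_duistermaat_def by (elim conjE) (use assms(2-5) in blast)

lemma is_duistermaat_graph:
  assumes f: "is_duistermaat n f" and h: "hermitian n A" "hermitian n B" "hermitian n C"
  shows "int (f (graph_plane n A) (graph_plane n B) (graph_plane n C))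
    = int (mat_neg_index n (B - A)) - int (mat_neg_index n (C - A)) + int (mat_neg_index n (C - B))"
proof -
  have val: "f (graph_plane n M) (graph_plane n N) (infinity_plane n) = mat_neg_index n (N - M)"
    if M: "hermitian n M" and N: "hermitian n N" for M N
  proof -
    have "f (graph_plane n M) (graph_plane n N) (infinity_plane n)
      = f (shear n M ` graph_plane n M) (shear n M ` graph_plane n N) (shear n M ` infinity_plane n)"
      by (rule is_duistermaat_symplectic[OF f symplectic_shear[OF M] graph_plane_Lagr[OF M]
          graph_plane_Lagr[OF N] infinity_plane_Lagr, symmetric])
    also have "\<dots> = f (graph_plane n (\<lambda>i j. 0)) (graph_plane n (N - M)) (infinity_plane n)"
      by (simp add: shear_graph_plane shear_infinity_plane zero_fun_def)
    also have "\<dots> = n_minus n (N - M)"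
      using f M N unfolding is_duistermaat_def by simp
    finally show ?thesis using n_minus_eq_mat_neg_index[of n "N - M"] M N by simp
  qed
  note G = graph_plane_Lagr[OF h(1)] graph_plane_Lagr[OF h(2)] graph_plane_Lagr[OF h(3)]
  have "int (f (graph_plane n A) (graph_plane n B) (graph_plane n C))
      - int (f (graph_plane n A) (graph_plane n B) (infinity_plane n))
      + int (f (graph_plane n A) (graph_plane n C) (infinity_plane n))
      - int (f (graph_plane n B) (graph_plane n C) (infinity_plane n)) = 0"
    using f G infinity_plane_Lagr unfolding is_duistermaat_def by blast
  then show ?thesis using val h by simp
qed

lemma is_duistermaat_unique:
  assumes f: "is_duistermaat n f"
  shows "f = iota n"
proof (intro ext)
  fix L1 L2 L3
  show "f L1 L2 L3 = iota n L1 L2 L3"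
  proof (cases "L1 \<in> Lagr n \<and> L2 \<in> Lagr n \<and> L3 \<in> Lagr n")
    case False
    then have "f L1 L2 L3 = 0" using f unfolding is_duistermaat_def by (elim conjE) blast
    moreover have "iota n L1 L2 L3 = 0" using False by (auto simp: iota_def)
    ultimately show ?thesis by simp
  next
    case True
    then have L: "L1 \<in> Lagr n" "L2 \<in> Lagr n" "L3 \<in> Lagr n" by auto
    obtain T M where T: "symplectic_iso (Csymp n) (Csymp n) T"
      "\<And>L. L \<in> {L1, L2, L3} \<Longrightarrow> hermitian n (M L)" "\<And>L. L \<in> {L1, L2, L3} \<Longrightarrow> T ` L = graph_plane n (M L)"
      by (rule common_graph_coordinates[of "{L1, L2, L3}" n]) (use L in auto)
    define A and B and C where "A = M L1" and "B = M L2" and "C = M L3"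
  have h: "hermitian n A" "hermitian n B" "hermitian n C"
    and g: "T ` L1 = graph_plane n A" "T ` L2 = graph_plane n B" "T ` L3 = graph_plane n C"
    using T(2,3) by (simp_all add: A_def B_def C_def)
    have inv: "F L1 L2 L3 = F (graph_plane n A) (graph_plane n B) (graph_plane n C)" if "is_duistermaat n F" for F
      using is_duistermaat_symplectic[OF that T(1) L] g by simp
    have "int (f L1 L2 L3) = int (iota n L1 L2 L3)"
      unfolding inv[OF f] inv[OF is_duistermaat_iota] is_duistermaat_graph[OF f h] is_duistermaat_graph[OF is_duistermaat_iota h] ..
    then show ?thesis by simp
  qed
qed

theorem duistermaat_eq_iota: "duistermaat n = iota n"
  unfolding duistermaat_def using is_duistermaat_iota is_duistermaat_unique by (intro the_equality)

lemma is_duistermaat_duistermaat: "is_duistermaat n (duistermaat n)"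
  unfolding duistermaat_eq_iota by (rule is_duistermaat_iota)

text \<open>With N i j = \<nu>(M j - M i), the special values and the permutation identities become
  linear arithmetic in N. The planes themselves serve as indices, which admits repetitions among
  them.\<close>

lemma duistermaat_graph_coordinates:
  assumes L: "L1 \<in> Lagr n" "L2 \<in> Lagr n" "L3 \<in> Lagr n"
  obtains N where
    "\<And>i j. i \<in> {L1, L2, L3} \<Longrightarrow> j \<in> {L1, L2, L3} \<Longrightarrow> int (N i j) + int (N j i) = int n - pdim (i \<inter> j)"
    "\<And>i. i \<in> {L1, L2, L3} \<Longrightarrow> N i i = 0"
    "\<And>i j k. i \<in> {L1, L2, L3} \<Longrightarrow> j \<in> {L1, L2, L3} \<Longrightarrow> k \<in> {L1, L2, L3} \<Longrightarrow>
      int (duistermaat n i j k) = int (N i j) - int (N i k) + int (N j k)"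
proof -
  obtain T M where T: "symplectic_iso (Csymp n) (Csymp n) T"
    "\<And>L. L \<in> {L1, L2, L3} \<Longrightarrow> hermitian n (M L)" "\<And>L. L \<in> {L1, L2, L3} \<Longrightarrow> T ` L = graph_plane n (M L)"
    by (rule common_graph_coordinates[of "{L1, L2, L3}" n]) (use L in auto)
  note M = T(2,3)
  have La: "L \<in> Lagr n" if "L \<in> {L1, L2, L3}" for L using that L by auto
  define N where "N i j = mat_neg_index n (M j - M i)" for i j
  show ?thesis
  proof (rule that[of N])
    fix i j assume ij: "i \<in> {L1, L2, L3}" "j \<in> {L1, L2, L3}"
    have "pv.dim (i \<inter> j) = pv.dim (graph_plane n (M i) \<inter> graph_plane n (M j))"
      using dim_inter_image[OF symplectic_isoD(1,2)[OF T(1)] La[OF ij(1)] La[OF ij(2)]] M(2) ij by simp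
    also have "\<dots> = cv.dim {x \<in> Cn n. mat_vec n (M j - M i) x = 0}" by (rule dim_graph_inter)
    finally show "int (N i j) + int (N j i) = int n - pdim (i \<inter> j)"
      using mat_neg_index_sum_kernel[of n "M j - M i"] M(1) ij by (simp add: N_def)
  next
    fix i show "N i i = 0" by (simp add: N_def mat_neg_index_zero)
  next
    fix i j k assume m: "i \<in> {L1, L2, L3}" "j \<in> {L1, L2, L3}" "k \<in> {L1, L2, L3}"
    have "duistermaat n i j k = duistermaat n (T ` i) (T ` j) (T ` k)"
      using is_duistermaat_symplectic[OF is_duistermaat_duistermaat T(1)] La m by simp
    then show "int (duistermaat n i j k) = int (N i j) - int (N i k) + int (N j k)"
      using is_duistermaat_graph[OF is_duistermaat_duistermaat, of n "M i" "M j" "M k"] M m by (simp add: N_def)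
  qed
qed

lemma duistermaat_anti_symplectic:
  assumes T: "anti_symplectic n T" and L: "L1 \<in> Lagr n" "L2 \<in> Lagr n" "L3 \<in> Lagr n"
  shows "duistermaat n (T ` L1) (T ` L2) (T ` L3) = duistermaat n L3 L2 L1"
proof -
  have "lin_on pscale pscale (Cn n \<times> Cn n) T" "inj_on T (Cn n \<times> Cn n)"
    using T by (auto simp: anti_symplectic_def linear_bij_def lin_on_def bij_betw_def)
  then have "pv.dim (T ` L1 \<inter> T ` L3) = pv.dim (L3 \<inter> L1)"
    using dim_inter_image[of n T L1 L3] L by (simp add: Int_commute)
  then have "iota_int n (T ` L1) (T ` L2) (T ` L3) = iota_int n L3 L2 L1"
    using triple_neg_index_anti_symplectic[OF T L] by (simp add: iota_int_def)
  then show ?thesis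
    using anti_symplectic_image_Lagr[OF T] L by (simp add: duistermaat_eq_iota iota_def)
qed

section \<open>Symplectic additivity\<close>

text \<open>Two identifications of V with model spaces differ by a symplectic map between the
  models. Together with the invariance of the index this makes \<open>duistermaat_on\<close> well
  defined.\<close>

lemma symplectic_iso_compose_inv:
  assumes V: "symplectic_space V" and T: "symplectic_iso V (Csymp m) T" and T': "symplectic_iso V (Csymp n) T'"
  shows "symplectic_iso (Csymp m) (Csymp n) (T' \<circ> inv_into (carr V) T)"
proof -
  interpret complex_space "scal V" using V by (simp add: symplectic_space_def complex_space_def)
  have sub: "subspace (carr V)" using V by (simp add: symplectic_space_def)
  have bT: "bij_betw T (carr V) (Cn m \<times> Cn m)" and bT': "bij_betw T' (carr V) (Cn n \<times> Cn n)"
    using T T' by (auto simp: symplectic_iso_def linear_bij_def)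
  have "lin_on (scal V) pscale (carr V) T" using T by (simp add: symplectic_iso_def linear_bij_def lin_on_def)
  then have li: "lin_on pscale (scal V) (T ` carr V) (inv_into (carr V) T)"
    using lin_on_inv_into[OF complex_space_axioms sub _ bij_betw_imp_inj_on[OF bT]] by blast
  have im: "T ` carr V = Cn m \<times> Cn m" using bT by (simp add: bij_betw_def)
  have mem: "inv_into (carr V) T u \<in> carr V" if "u \<in> Cn m \<times> Cn m" for u
    using that im inv_into_into[of u T "carr V"] by simp
  have Tinv: "T (inv_into (carr V) T u) = u" if "u \<in> Cn m \<times> Cn m" for u
    using that im f_inv_into_f[of u T "carr V"] by simp
  show ?thesis
    unfolding symplectic_iso_def linear_bij_def Csymp_simps
  proof (intro conjI ballI allI)
    show "bij_betw (T' \<circ> inv_into (carr V) T) (Cn m \<times> Cn m) (Cn n \<times> Cn n)"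
      using bij_betw_trans[OF bij_betw_inv_into[OF bT] bT'] .
    fix u v assume uv: "u \<in> Cn m \<times> Cn m" "v \<in> Cn m \<times> Cn m"
    have "inv_into (carr V) T (u + v) = inv_into (carr V) T u + inv_into (carr V) T v"
      using li uv unfolding im lin_on_def by blast
    then show "(T' \<circ> inv_into (carr V) T) (u + v) = (T' \<circ> inv_into (carr V) T) u + (T' \<circ> inv_into (carr V) T) v"
      using T' mem uv by (simp add: symplectic_iso_def linear_bij_def)
    show "omega n ((T' \<circ> inv_into (carr V) T) u) ((T' \<circ> inv_into (carr V) T) v) = omega m u v"
      using T T' mem[OF uv(1)] mem[OF uv(2)] Tinv[OF uv(1)] Tinv[OF uv(2)]
      unfolding symplectic_iso_def Csymp_simps comp_def by metis
  next
    fix c u assume u: "u \<in> Cn m \<times> Cn m"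
    have "inv_into (carr V) T (pscale c u) = scal V c (inv_into (carr V) T u)"
      using li u unfolding im lin_on_def by blast
    then show "(T' \<circ> inv_into (carr V) T) (pscale c u) = pscale c ((T' \<circ> inv_into (carr V) T) u)"
      using T' mem u by (simp add: symplectic_iso_def linear_bij_def)
  qed
qed

text \<open>The carriers have dimensions 2 m and 2 n, so the model of a symplectic space is
  determined by the space.\<close>

lemma symplectic_iso_dim_eq:
  assumes "symplectic_iso (Csymp m) (Csymp n) T"
  shows "m = n"
  using pp.dim_image_inj[OF fin_dim_carr symplectic_isoD(1,2)[OF assms]] symplectic_isoD(3)[OF assms]
  by (simp add: dim_carr)

lemma lagrangian_symplectic_image:
  assumes "symplectic_space V" "symplectic_iso V (Csymp m) T" "lagrangian V L"
  shows "T ` L \<in> Lagr m"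
  using lagrangian_image[of V "Csymp m" T 1 L] assms complex_space_pscale
  by (auto simp: Lagr_def symplectic_space_def symplectic_iso_def complex_space_def)

lemma duistermaat_on_eq:
  assumes V: "symplectic_space V" and T: "symplectic_iso V (Csymp m) T"
    and L: "lagrangian V L1" "lagrangian V L2" "lagrangian V L3"
  shows "duistermaat_on V L1 L2 L3 = duistermaat m (T ` L1) (T ` L2) (T ` L3)"
  unfolding duistermaat_on_def
proof (rule the_equality)
  show "\<exists>m' T'. symplectic_iso V (Csymp m') T' \<and>
      duistermaat m (T ` L1) (T ` L2) (T ` L3) = duistermaat m' (T' ` L1) (T' ` L2) (T' ` L3)"
    using T by blast
  fix k assume "\<exists>m T. symplectic_iso V (Csymp m) T \<and> k = duistermaat m (T ` L1) (T ` L2) (T ` L3)"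
  then obtain m' T' where T': "symplectic_iso V (Csymp m') T'"
    and k: "k = duistermaat m' (T' ` L1) (T' ` L2) (T' ` L3)" by blast
  let ?S = "T' \<circ> inv_into (carr V) T"
  have S: "symplectic_iso (Csymp m) (Csymp m') ?S" by (rule symplectic_iso_compose_inv[OF V T T'])
  then have mm: "m' = m" using symplectic_iso_dim_eq by blast
  have inj: "inj_on T (carr V)" using T by (auto simp: symplectic_iso_def linear_bij_def bij_betw_def)
  have im: "?S ` T ` L = T' ` L" if "lagrangian V L" for L
  proof -
    have "L \<subseteq> carr V" using that unfolding lagrangian_def by blast
    then show ?thesis using inv_into_image_cancel[OF inj] by (simp only: image_comp[symmetric])
  qed
  show "k = duistermaat m (T ` L1) (T ` L2) (T ` L3)"
    using is_duistermaat_symplectic[OF is_duistermaat_duistermaat S[unfolded mm]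
        lagrangian_symplectic_image[OF V T L(1)] lagrangian_symplectic_image[OF V T L(2)]
        lagrangian_symplectic_image[OF V T L(3)]] k
    by (simp only: im L mm)
qed

section \<open>Concatenation of model spaces\<close>

definition cat :: "nat \<Rightarrow> cvec \<Rightarrow> cvec \<Rightarrow> cvec" where
  "cat m x y = (\<lambda>i. if i < m then x i else y (i - m))"

text \<open>The isomorphism from the direct sum of the models of dimensions m and k to the model of
  dimension m + k. First and second components are concatenated separately, so that
  \<open>omega\<close> splits as a sum.\<close>

definition join :: "nat \<Rightarrow> (cvec \<times> cvec) \<times> (cvec \<times> cvec) \<Rightarrow> cvec \<times> cvec" where
  "join m p = (cat m (fst (fst p)) (fst (snd p)), cat m (snd (fst p)) (snd (snd p)))"

lemma cat_linear:
  "cat m (x + x') (y + y') = cat m x y + cat m x' y'"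
  "cat m (vscale c x) (vscale c y) = vscale c (cat m x y)"
  by (auto simp: cat_def vscale_def fun_eq_iff)

lemma hinner_cat: "hinner (m + k) (cat m x y) (cat m x' y') = hinner m x x' + hinner k y y'"
proof -
  have split: "(\<Sum>i<m + k. f i) = (\<Sum>i<m. f i) + (\<Sum>i<k. f (m + i))" for f :: "nat \<Rightarrow> complex"
    by (induction k) (simp_all add: add.assoc)
  show ?thesis unfolding hinner_def split by (simp add: cat_def)
qed

lemma omega_join: "omega (m + k) (join m p) (join m q) = omega m (fst p) (fst q) + omega k (snd p) (snd q)"
  by (simp add: omega_def join_def hinner_cat)

lemma join_linear:
  "join m (u + v) = join m u + join m v"
  "join m (prod_scale pscale pscale c u) = pscale c (join m u)"
  by (simp_all add: join_def cat_linear prod_scale_def pscale_def)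

lemma lin_on_join: "lin_on (prod_scale pscale pscale) pscale S (join m)"
  by (simp add: lin_on_def join_linear)

lemma bij_betw_join:
  "bij_betw (join m) ((Cn m \<times> Cn m) \<times> (Cn k \<times> Cn k)) (Cn (m + k) \<times> Cn (m + k))"
proof -
  define l r :: "cvec \<Rightarrow> cvec" where "l x = (\<lambda>i. if i < m then x i else 0)" and "r x = (\<lambda>i. x (m + i))" for x
  have inv: "l (cat m x y) = x" "r (cat m x y) = y" "cat m x y \<in> Cn (m + k)"
    if "x \<in> Cn m" "y \<in> Cn k" for x y
    using that by (auto simp: cat_def Cn_def fun_eq_iff l_def r_def)
  have inv': "cat m (l x) (r x) = x" for x by (auto simp: cat_def fun_eq_iff l_def r_def)
  have mem: "l x \<in> Cn m" "r x \<in> Cn k" if "x \<in> Cn (m + k)" for x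
    using that by (auto simp: Cn_def l_def r_def)
  show ?thesis
    by (rule bij_betw_byWitness[where f' = "\<lambda>u. ((l (fst u), l (snd u)), (r (fst u), r (snd u)))"])
      (use inv inv' mem in \<open>auto simp: join_def\<close>)
qed

lemma lagrangian_Times:
  assumes V: "complex_space (scal V)" and W: "complex_space (scal W)"
    and lin: "\<And>u. u \<in> carr V \<Longrightarrow> form V 0 u = 0" "\<And>u. u \<in> carr W \<Longrightarrow> form W 0 u = 0"
    and L: "lagrangian V L" and M: "lagrangian W M"
  shows "lagrangian (symp_sum V W) (L \<times> M)"
proof -
  interpret complex_space_pair "scal V" "scal W" using V W by (simp add: complex_space_pair_def)
  have Ls: "vs1.subspace L" "L = {v \<in> carr V. \<forall>u\<in>L. form V u v = 0}"
    using L by (auto simp: lagrangian_def)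
  have Ms: "vs2.subspace M" "M = {v \<in> carr W. \<forall>u\<in>M. form W u v = 0}"
    using M by (auto simp: lagrangian_def)
  have sc: "scal (symp_sum V W) = prod_scale (scal V) (scal W)"
    by (simp add: symp_sum_def prod_scale_def fun_eq_iff)
  have "L \<times> M = {v \<in> carr V \<times> carr W. \<forall>u\<in>L \<times> M. form V (fst u) (fst v) + form W (snd u) (snd v) = 0}"
  proof (intro antisym subsetI)
    fix v assume v: "v \<in> L \<times> M"
    then have "fst v \<in> carr V" "snd v \<in> carr W" "\<forall>u\<in>L. form V u (fst v) = 0" "\<forall>u\<in>M. form W u (snd v) = 0"
      using Ls(2) Ms(2) by auto
    then show "v \<in> {v \<in> carr V \<times> carr W. \<forall>u\<in>L \<times> M. form V (fst u) (fst v) + form W (snd u) (snd v) = 0}"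
      by (auto simp: mem_Times_iff)
  next
    fix v assume "v \<in> {v \<in> carr V \<times> carr W. \<forall>u\<in>L \<times> M. form V (fst u) (fst v) + form W (snd u) (snd v) = 0}"
    then have v: "fst v \<in> carr V" "snd v \<in> carr W"
      and *: "\<And>a b. a \<in> L \<Longrightarrow> b \<in> M \<Longrightarrow> form V a (fst v) + form W b (snd v) = 0" by auto
    \<comment> \<open>Testing against (u, 0) and (0, u) separates the two summands of the
      form.\<close>
    have "form V u (fst v) = 0" if "u \<in> L" for u
      using *[OF that vs2.subspace_0[OF Ms(1)]] lin(2)[OF v(2)] by simp
    moreover have "form W u (snd v) = 0" if "u \<in> M" for u
      using *[OF vs1.subspace_0[OF Ls(1)] that] lin(1)[OF v(1)] by simp
    ultimately have "fst v \<in> L" "snd v \<in> M" using v Ls(2) Ms(2) by blast+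
    then show "v \<in> L \<times> M" by (simp add: mem_Times_iff)
  qed
  moreover have cs: "carr (symp_sum V W) = carr V \<times> carr W"
    and fs: "form (symp_sum V W) = (\<lambda>u v. form V (fst u) (fst v) + form W (snd u) (snd v))"
    by (simp_all add: symp_sum_def)
  ultimately show ?thesis
    unfolding lagrangian_def sc cs fs by (intro conjI subspace_Times[OF Ls(1) Ms(1)])
qed

interpretation t2: complex_space "prod_scale (prod_scale pscale (prod_scale pscale pscale)) (prod_scale pscale (prod_scale pscale pscale))"
  by (rule tt.complex_space_prod)
interpretation t2t: complex_space_pair
  "prod_scale (prod_scale pscale (prod_scale pscale pscale)) (prod_scale pscale (prod_scale pscale pscale))"
  "prod_scale pscale (prod_scale pscale pscale)" ..
interpretation p2p: complex_space_pair "prod_scale pscale pscale" pscale ..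

text \<open>\<open>\<Omega> / 2\<close>\<close>

definition triple_herm :: "nat \<Rightarrow> (cvec \<times> cvec) \<times> (cvec \<times> cvec) \<times> (cvec \<times> cvec) \<Rightarrow>
    (cvec \<times> cvec) \<times> (cvec \<times> cvec) \<times> (cvec \<times> cvec) \<Rightarrow> complex" where
  "triple_herm n u v =
    (omega n (fst u) (fst (snd v)) + omega n (fst (snd u)) (snd (snd v)) + omega n (snd (snd u)) (fst v)
     - omega n (fst (snd u)) (fst v) - omega n (snd (snd u)) (fst (snd v)) - omega n (fst u) (snd (snd v))) / 2"

text \<open>\<open>neg_index_Times\<close> works with Hermitian forms, so the quadratic
  \<open>triple_form\<close> has to be exhibited as the diagonal of one.\<close>

lemma herm_form_triple: "herm_form (prod_scale pscale (prod_scale pscale pscale)) UNIV (triple_herm n)"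
proof unfold_locales
  show "triple_herm n v u = cnj (triple_herm n u v)" for u v
    using omega_cnj[of n "fst v" "fst (snd u)"] omega_cnj[of n "fst (snd v)" "snd (snd u)"]
      omega_cnj[of n "snd (snd v)" "fst u"] omega_cnj[of n "fst (snd v)" "fst u"]
      omega_cnj[of n "snd (snd v)" "fst (snd u)"] omega_cnj[of n "fst v" "snd (snd u)"]
    by (simp add: triple_herm_def)
qed (auto simp: triple_herm_def omega_bilin prod_scale_def field_simps)

lemma triple_form_eq: "triple_form n u = Re (triple_herm n u u)"
proof -
  have sk: "Re (omega n y x) = - Re (omega n x y)" for x y using omega_cnj[of n y x] by simp
  show ?thesis
    using sk[of "fst u" "fst (snd u)"] sk[of "fst (snd u)" "snd (snd u)"] sk[of "snd (snd u)" "fst u"]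
    by (simp add: triple_form_def triple_herm_def)
qed

lemma join_Lagr:
  assumes "L \<in> Lagr m" "M \<in> Lagr k"
  shows "join m ` (L \<times> M) \<in> Lagr (m + k)"
proof -
  have sum: "lagrangian (symp_sum (Csymp m) (Csymp k)) (L \<times> M)"
    using assms by (intro lagrangian_Times) (auto simp: Lagr_def complex_space_pscale omega_def hinner_bilin)
  have sc: "scal (symp_sum (Csymp m) (Csymp k)) = prod_scale pscale pscale"
    by (simp add: symp_sum_def prod_scale_def fun_eq_iff)
  have "linear_bij (symp_sum (Csymp m) (Csymp k)) (Csymp (m + k)) (join m)"
    using bij_betw_join[of m k] lin_on_join[of "carr (symp_sum (Csymp m) (Csymp k))" m]
    unfolding linear_bij_def sc lin_on_def by (simp add: symp_sum_def)
  moreover have "complex_space (scal (symp_sum (Csymp m) (Csymp k)))"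
    unfolding sc by (rule ppv.complex_space_axioms)
  ultimately have "lagrangian (Csymp (m + k)) (join m ` (L \<times> M))"
    using lagrangian_image[of "symp_sum (Csymp m) (Csymp k)" "Csymp (m + k)" "join m" 1 "L \<times> M"] sum
      complex_space_pscale omega_join by (simp add: symp_sum_def)
  then show ?thesis by (simp add: Lagr_def)
qed

text \<open>Regrouping three pairs (u_i, v_i) into the triples of the u_i and of the v_i splits the
  triple form into a direct sum. The intersection dimension and the half dimension are additive too,
  hence so is the explicit formula.\<close>

lemma duistermaat_join:
  assumes L: "L1 \<in> Lagr m" "L2 \<in> Lagr m" "L3 \<in> Lagr m" and M: "M1 \<in> Lagr k" "M2 \<in> Lagr k" "M3 \<in> Lagr k"
  shows "duistermaat (m + k) (join m ` (L1 \<times> M1)) (join m ` (L2 \<times> M2)) (join m ` (L3 \<times> M3))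
    = duistermaat m L1 L2 L3 + duistermaat k M1 M2 M3"
proof -
  let ?C = "(Cn m \<times> Cn m) \<times> (Cn k \<times> Cn k)"
  have inj: "inj_on (join m) ?C" using bij_betw_join by (simp add: bij_betw_def)
  note C = LagrD(2)[OF L(1)] LagrD(2)[OF L(2)] LagrD(2)[OF L(3)]
    LagrD(2)[OF M(1)] LagrD(2)[OF M(2)] LagrD(2)[OF M(3)]
  let ?A = "L1 \<times> L2 \<times> L3" and ?B = "M1 \<times> M2 \<times> M3"
  let ?f = "\<lambda>p. (join m (fst (fst p), fst (snd p)), join m (fst (snd (fst p)), fst (snd (snd p))),
    join m (snd (snd (fst p)), snd (snd (snd p))))"
  have fA: "tv.fin_dim ?A" "tv.fin_dim ?B" using L M by (auto intro!: fin_dim_triple Lagr_fin_dim)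
  have im: "?f ` (?A \<times> ?B) = join m ` (L1 \<times> M1) \<times> join m ` (L2 \<times> M2) \<times> join m ` (L3 \<times> M3)"
    by force
  have "tv.neg_index (?f ` (?A \<times> ?B)) (triple_form (m + k))
    = t2.neg_index (?A \<times> ?B) (\<lambda>p. Re (triple_herm m (fst p) (fst p)) + Re (triple_herm k (snd p) (snd p)))"
  proof (rule t2t.neg_index_bij)
    show "t2.fin_dim (?A \<times> ?B)" by (rule tt.fin_dim_dim_Times(1)[OF fA])
    show "lin_on (prod_scale (prod_scale pscale (prod_scale pscale pscale)) (prod_scale pscale (prod_scale pscale pscale)))
        (prod_scale pscale (prod_scale pscale pscale)) (?A \<times> ?B) ?f"
      by (auto simp: lin_on_def join_linear[symmetric] prod_scale_def)
    show "inj_on ?f (?A \<times> ?B)"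
    proof (rule inj_onI)
      fix p q assume pq: "p \<in> ?A \<times> ?B" "q \<in> ?A \<times> ?B" and "?f p = ?f q"
      then have e: "join m (fst (fst p), fst (snd p)) = join m (fst (fst q), fst (snd q))"
        "join m (fst (snd (fst p)), fst (snd (snd p))) = join m (fst (snd (fst q)), fst (snd (snd q)))"
        "join m (snd (snd (fst p)), snd (snd (snd p))) = join m (snd (snd (fst q)), snd (snd (snd q)))"
        by auto
      have mem: "(fst (fst p), fst (snd p)) \<in> ?C \<and> (fst (snd (fst p)), fst (snd (snd p))) \<in> ?C
          \<and> (snd (snd (fst p)), snd (snd (snd p))) \<in> ?C" if "p \<in> ?A \<times> ?B" for p
        using that C by (auto simp: subset_iff)
      note d = inj_onD[OF inj e(1)] inj_onD[OF inj e(2)] inj_onD[OF inj e(3)]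
      show "p = q" using mem[OF pq(1)] mem[OF pq(2)] d by (simp add: prod_eq_iff)
    qed
    show "triple_form (m + k) (?f p) = Re (triple_herm m (fst p) (fst p)) + Re (triple_herm k (snd p) (snd p))" for p
      by (simp add: triple_form_eq[symmetric]) (simp add: triple_form_def omega_join)
  qed
  also have "\<dots> = tv.neg_index ?A (triple_form m) + tv.neg_index ?B (triple_form k)"
    using tt.neg_index_Times[OF
        herm_form.herm_form_subspace[OF herm_form_triple tv.fin_dim_subspace[OF fA(1)] subset_UNIV]
        herm_form.herm_form_subspace[OF herm_form_triple tv.fin_dim_subspace[OF fA(2)] subset_UNIV] fA, of m k]
    by (simp add: triple_form_eq[abs_def])
  finally have t: "triple_neg_index (m + k) (join m ` (L1 \<times> M1)) (join m ` (L2 \<times> M2)) (join m ` (L3 \<times> M3))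
      = triple_neg_index m L1 L2 L3 + triple_neg_index k M1 M2 M3"
    unfolding im triple_neg_index_def .
  have sub: "(L1 \<inter> L3) \<times> (M1 \<inter> M3) \<subseteq> ?C" using C by auto
  have f: "pv.fin_dim (L1 \<inter> L3)" "pv.fin_dim (M1 \<inter> M3)"
    using pv.fin_dim_subset[OF Lagr_fin_dim[OF L(1)], of "L1 \<inter> L3"]
      pv.fin_dim_subset[OF Lagr_fin_dim[OF M(1)], of "M1 \<inter> M3"] LagrD(1)[OF L(1)] LagrD(1)[OF L(3)]
      LagrD(1)[OF M(1)] LagrD(1)[OF M(3)]
    by (auto simp: pv.subspace_inter)
  have "join m ` (L1 \<times> M1) \<inter> join m ` (L3 \<times> M3) = join m ` ((L1 \<inter> L3) \<times> (M1 \<inter> M3))"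
  proof -
    have "L1 \<times> M1 \<subseteq> ?C" "L3 \<times> M3 \<subseteq> ?C" using C by auto
    then show ?thesis using inj_on_image_Int[OF inj, of "L1 \<times> M1" "L3 \<times> M3"] by (simp add: Times_Int_Times)
  qed
  then have "pv.dim (join m ` (L1 \<times> M1) \<inter> join m ` (L3 \<times> M3)) = pv.dim (L1 \<inter> L3) + pv.dim (M1 \<inter> M3)"
    using p2p.dim_image_inj[OF pp.fin_dim_dim_Times(1)[OF f] lin_on_join inj_on_subset[OF inj sub]]
      pp.fin_dim_dim_Times(2)[OF f] by simp
  then have "iota_int (m + k) (join m ` (L1 \<times> M1)) (join m ` (L2 \<times> M2)) (join m ` (L3 \<times> M3))
      = iota_int m L1 L2 L3 + iota_int k M1 M2 M3"
    using t by (simp add: iota_int_def)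
  moreover have "int (duistermaat (m + k) (join m ` (L1 \<times> M1)) (join m ` (L2 \<times> M2)) (join m ` (L3 \<times> M3)))
      = iota_int (m + k) (join m ` (L1 \<times> M1)) (join m ` (L2 \<times> M2)) (join m ` (L3 \<times> M3))"
    unfolding duistermaat_eq_iota using L M by (intro int_iota join_Lagr)
  moreover have "int (duistermaat m L1 L2 L3) = iota_int m L1 L2 L3" "int (duistermaat k M1 M2 M3) = iota_int k M1 M2 M3"
    unfolding duistermaat_eq_iota using L M by (auto intro!: int_iota)
  ultimately show ?thesis by simp
qed

text \<open>A form space carries its form as a bare function; this instance of linearity is pulled
  back from the model.\<close>

lemma form_zero_left:
  assumes V: "symplectic_space V" and u: "u \<in> carr V"
  shows "form V 0 u = 0"
proof -
  interpret complex_space "scal V" using V by (simp add: symplectic_space_def complex_space_def)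
  obtain m T where T: "symplectic_iso V (Csymp m) T" using V by (auto simp: symplectic_space_def)
  have 0: "0 \<in> carr V" using V subspace_0 by (auto simp: symplectic_space_def)
  have "T (scal V 0 0) = pscale 0 (T 0)"
    using T 0 unfolding symplectic_iso_def linear_bij_def Csymp_simps by blast
  then have "T 0 = 0" by simp
  moreover have "form V 0 u = omega m (T 0) (T u)" using T 0 u by (simp add: symplectic_iso_def)
  ultimately show ?thesis by (simp add: omega_def hinner_bilin)
qed

text \<open>Identifications T of V and U of W with models combine through \<open>join\<close> into
  one of the sum, which reduces the claim to \<open>duistermaat_join\<close>.\<close>

lemma duistermaat_on_symp_sum:
  assumes V: "symplectic_space V" and W: "symplectic_space W"
    and L: "lagrangian V L1" "lagrangian V L2" "lagrangian V L3"
    and M: "lagrangian W M1" "lagrangian W M2" "lagrangian W M3"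
  shows "duistermaat_on (symp_sum V W) (L1 \<times> M1) (L2 \<times> M2) (L3 \<times> M3)
    = duistermaat_on V L1 L2 L3 + duistermaat_on W M1 M2 M3"
proof -
  obtain m T where T: "symplectic_iso V (Csymp m) T" using V by (auto simp: symplectic_space_def)
  obtain k U where U: "symplectic_iso W (Csymp k) U" using W by (auto simp: symplectic_space_def)
  interpret complex_space_pair "scal V" "scal W"
    using V W by (simp add: symplectic_space_def complex_space_pair_def complex_space_def)
  have sc: "scal (symp_sum V W) = prod_scale (scal V) (scal W)"
    by (simp add: symp_sum_def prod_scale_def fun_eq_iff)
  have cs: "carr (symp_sum V W) = carr V \<times> carr W" by (simp add: symp_sum_def)
  have sV: "vs1.subspace (carr V)" and sW: "vs2.subspace (carr W)"
    using V W by (auto simp: symplectic_space_def)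
  let ?J = "join m \<circ> map_prod T U"
  have bT: "bij_betw T (carr V) (Cn m \<times> Cn m)" and bU: "bij_betw U (carr W) (Cn k \<times> Cn k)"
    using T U by (auto simp: symplectic_iso_def linear_bij_def)
  have J: "symplectic_iso (symp_sum V W) (Csymp (m + k)) ?J"
    unfolding symplectic_iso_def linear_bij_def sc cs Csymp_simps
  proof (intro conjI ballI allI)
    have "bij_betw (map_prod T U) (carr V \<times> carr W) ((Cn m \<times> Cn m) \<times> (Cn k \<times> Cn k))"
      using bT bU by (auto simp: bij_betw_def map_prod_inj_on map_prod_surj_on)
    then show "bij_betw ?J (carr V \<times> carr W) (Cn (m + k) \<times> Cn (m + k))"
      using bij_betw_join by (rule bij_betw_trans)
  next
    fix u v assume "u \<in> carr V \<times> carr W" "v \<in> carr V \<times> carr W"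
    then show "?J (u + v) = ?J u + ?J v" "omega (m + k) (?J u) (?J v) = form (symp_sum V W) u v"
      using T U by (auto simp: symplectic_iso_def linear_bij_def join_linear[symmetric] omega_join symp_sum_def)
  next
    fix c u assume "u \<in> carr V \<times> carr W"
    then show "?J (prod_scale (scal V) (scal W) c u) = pscale c (?J u)"
      using T U by (auto simp: symplectic_iso_def linear_bij_def join_linear[symmetric])
  qed
  have VW: "symplectic_space (symp_sum V W)"
    using complex_space_prod subspace_Times[OF sV sW] J
    unfolding symplectic_space_def sc cs complex_space_def by blast
  have LM: "lagrangian (symp_sum V W) (L \<times> M)" if "lagrangian V L" "lagrangian W M" for L M
    by (rule lagrangian_Times[OF vs1.complex_space_axioms vs2.complex_space_axioms
          form_zero_left[OF V] form_zero_left[OF W] that])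
  have im: "?J ` (L \<times> M) = join m ` (T ` L \<times> U ` M)" for L M by (force simp: image_comp)
  have "duistermaat_on (symp_sum V W) (L1 \<times> M1) (L2 \<times> M2) (L3 \<times> M3)
    = duistermaat (m + k) (?J ` (L1 \<times> M1)) (?J ` (L2 \<times> M2)) (?J ` (L3 \<times> M3))"
    by (rule duistermaat_on_eq[OF VW J LM[OF L(1) M(1)] LM[OF L(2) M(2)] LM[OF L(3) M(3)]])
  also have "\<dots> = duistermaat m (T ` L1) (T ` L2) (T ` L3) + duistermaat k (U ` M1) (U ` M2) (U ` M3)"
    unfolding im using L M by (intro duistermaat_join lagrangian_symplectic_image[OF V T] lagrangian_symplectic_image[OF W U])
  also have "\<dots> = duistermaat_on V L1 L2 L3 + duistermaat_on W M1 M2 M3"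
    using duistermaat_on_eq[OF V T L] duistermaat_on_eq[OF W U M] by simp
  finally show ?thesis .
qed

theorem theorem3p1:
  fixes n :: nat
  shows
   "(\<forall>L\<in>Lagr n. \<forall>M\<in>Lagr n.
       duistermaat n L L M = 0 \<and> duistermaat n M L L = 0 \<and>
       int (duistermaat n L M L) = int n - pdim (L \<inter> M)) \<and>
    (\<forall>L1\<in>Lagr n. \<forall>L2\<in>Lagr n. \<forall>L3\<in>Lagr n.
       int (duistermaat n L1 L2 L3) + int (duistermaat n L2 L1 L3)
         = int n - pdim (L1 \<inter> L2) \<and>
       int (duistermaat n L1 L2 L3) + int (duistermaat n L1 L3 L2)
         = int n - pdim (L2 \<inter> L3) \<and>
       int (duistermaat n L1 L2 L3) + int (duistermaat n L3 L2 L1)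
         = int n - pdim (L1 \<inter> L2) - pdim (L2 \<inter> L3) + pdim (L1 \<inter> L3) \<and>
       int (duistermaat n L1 L2 L3) - pdim (L1 \<inter> L3)
         = int (duistermaat n L3 L1 L2) - pdim (L2 \<inter> L3) \<and>
       int (duistermaat n L3 L1 L2) - pdim (L2 \<inter> L3)
         = int (duistermaat n L2 L3 L1) - pdim (L1 \<inter> L2)) \<and>
    (\<forall>(V :: 'v::ab_group_add form_space) (W :: 'w::ab_group_add form_space).
       symplectic_space V \<longrightarrow> symplectic_space W \<longrightarrow>
       (\<forall>L1 L2 L3 M1 M2 M3.
          lagrangian V L1 \<longrightarrow> lagrangian V L2 \<longrightarrow> lagrangian V L3 \<longrightarrow>
          lagrangian W M1 \<longrightarrow> lagrangian W M2 \<longrightarrow> lagrangian W M3 \<longrightarrow>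
          duistermaat_on (symp_sum V W) (L1 \<times> M1) (L2 \<times> M2) (L3 \<times> M3)
            = duistermaat_on V L1 L2 L3 + duistermaat_on W M1 M2 M3)) \<and>
    (\<forall>A. anti_symplectic n A \<longrightarrow>
       (\<forall>L1\<in>Lagr n. \<forall>L2\<in>Lagr n. \<forall>L3\<in>Lagr n.
          duistermaat n (A ` L1) (A ` L2) (A ` L3) = duistermaat n L3 L2 L1))"
proof (intro conjI)
  show "\<forall>L\<in>Lagr n. \<forall>M\<in>Lagr n.
       duistermaat n L L M = 0 \<and> duistermaat n M L L = 0 \<and>
       int (duistermaat n L M L) = int n - pdim (L \<inter> M)"
  proof (intro ballI)
    fix L M assume LM: "L \<in> Lagr n" "M \<in> Lagr n"
    show "duistermaat n L L M = 0 \<and> duistermaat n M L L = 0 \<and>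
       int (duistermaat n L M L) = int n - pdim (L \<inter> M)"
    proof (rule duistermaat_graph_coordinates[OF LM(1) LM(1) LM(2)])
      fix N
      assume sum: "\<And>i j. i \<in> {L, L, M} \<Longrightarrow> j \<in> {L, L, M} \<Longrightarrow> int (N i j) + int (N j i) = int n - pdim (i \<inter> j)"
        and z: "\<And>i. i \<in> {L, L, M} \<Longrightarrow> N i i = 0"
        and d: "\<And>i j k. i \<in> {L, L, M} \<Longrightarrow> j \<in> {L, L, M} \<Longrightarrow> k \<in> {L, L, M} \<Longrightarrow>
          int (duistermaat n i j k) = int (N i j) - int (N i k) + int (N j k)"
      \<comment> \<open>By N L L = 0 the first two values cancel to 0, and the third is N L M + N M
        L.\<close>
      show ?thesis
        using sum[of L M] z[of L] d[of L L M] d[of M L L] d[of L M L] by simp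
    qed
  qed
next
  show "\<forall>L1\<in>Lagr n. \<forall>L2\<in>Lagr n. \<forall>L3\<in>Lagr n.
       int (duistermaat n L1 L2 L3) + int (duistermaat n L2 L1 L3)
         = int n - pdim (L1 \<inter> L2) \<and>
       int (duistermaat n L1 L2 L3) + int (duistermaat n L1 L3 L2)
         = int n - pdim (L2 \<inter> L3) \<and>
       int (duistermaat n L1 L2 L3) + int (duistermaat n L3 L2 L1)
         = int n - pdim (L1 \<inter> L2) - pdim (L2 \<inter> L3) + pdim (L1 \<inter> L3) \<and>
       int (duistermaat n L1 L2 L3) - pdim (L1 \<inter> L3)
         = int (duistermaat n L3 L1 L2) - pdim (L2 \<inter> L3) \<and>
       int (duistermaat n L3 L1 L2) - pdim (L2 \<inter> L3)
         = int (duistermaat n L2 L3 L1) - pdim (L1 \<inter> L2)" (is "\<forall>L1\<in>_. \<forall>L2\<in>_. \<forall>L3\<in>_. ?P L1 L2 L3")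
  proof (intro ballI)
    fix L1 L2 L3 assume L: "L1 \<in> Lagr n" "L2 \<in> Lagr n" "L3 \<in> Lagr n"
    show "?P L1 L2 L3"
    proof (rule duistermaat_graph_coordinates[OF L])
      fix N
      assume sum: "\<And>i j. i \<in> {L1, L2, L3} \<Longrightarrow> j \<in> {L1, L2, L3} \<Longrightarrow> int (N i j) + int (N j i) = int n - pdim (i \<inter> j)"
        and d: "\<And>i j k. i \<in> {L1, L2, L3} \<Longrightarrow> j \<in> {L1, L2, L3} \<Longrightarrow> k \<in> {L1, L2, L3} \<Longrightarrow>
          int (duistermaat n i j k) = int (N i j) - int (N i k) + int (N j k)"
      \<comment> \<open>The cyclic identities hold because index minus dimension is N L1 L2 + N L2
        L3 + N L3 L1 - n, which is invariant under cyclic permutation.\<close>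
      show ?thesis
        using sum[of L1 L2] sum[of L2 L3] sum[of L1 L3] d[of L1 L2 L3] d[of L2 L1 L3] d[of L1 L3 L2]
          d[of L3 L2 L1] d[of L3 L1 L2] d[of L2 L3 L1]
        by simp
    qed
  qed
next
  show "\<forall>(V :: 'v form_space) (W :: 'w form_space).
       symplectic_space V \<longrightarrow> symplectic_space W \<longrightarrow>
       (\<forall>L1 L2 L3 M1 M2 M3.
          lagrangian V L1 \<longrightarrow> lagrangian V L2 \<longrightarrow> lagrangian V L3 \<longrightarrow>
          lagrangian W M1 \<longrightarrow> lagrangian W M2 \<longrightarrow> lagrangian W M3 \<longrightarrow>
          duistermaat_on (symp_sum V W) (L1 \<times> M1) (L2 \<times> M2) (L3 \<times> M3)
            = duistermaat_on V L1 L2 L3 + duistermaat_on W M1 M2 M3)"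
    by (intro allI impI duistermaat_on_symp_sum)
next
  show "\<forall>A. anti_symplectic n A \<longrightarrow>
       (\<forall>L1\<in>Lagr n. \<forall>L2\<in>Lagr n. \<forall>L3\<in>Lagr n.
          duistermaat n (A ` L1) (A ` L2) (A ` L3) = duistermaat n L3 L2 L1)"
    by (intro allI impI ballI duistermaat_anti_symplectic)
qed

end
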